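(* Let $m\ge 1$ be an integer, $h>0$, and $A,A_d\in\mathbb{R}^{m\times m}$. Consider the time-delay system $$\dot{x}(t)=Ax(t)+A_dx(t-h),\qquad t\ge 0,\qquad x_0=\varphi\in\mathcal{C}_{pw}(-h,0;\mathbb{R}^m),$$ and assume that the Lyapunov condition holds, i.e. the matrix $N$ defined in the context is nonsingular. Let $\eta_0$, $\mathcal{E}(\cdot)$, $\mathcal{N}(\cdot)$ and $\mathbf{P}_n$ be as defined in the context. Then the system is exponentially stable if and only if the matrix $\mathbf{P}_{\mathcal{N}(\mathcal{E}(\eta_0))}$ is positive definite.
   Context: Notation. $|\cdot|$ is the Euclidean norm of vectors and the induced 2-norm (largest singular value) of matrices; $\otimes$ is the Kronecker product; $\mathrm{vec}$ stacks the columns of a matrix and $\mathrm{vec}^{-1}$ is its inverse; $\lceil\cdot\rceil$ is the ceiling; $e$ is the base of the natural logarithm $\log$. $\mathcal{C}_{pw}(-h,0;\mathbb{R}^m)$ is the set of piecewise continuous functions from $[-h,0]$ to $\mathbb{R}^m$, with norm $\|\varphi\|=\sup_{[-h,0]}|\varphi(\tau)|$; $x_t(\tau)=x(t+\tau)$ for $\tau\in[-h,0]$. In symmetric block matrices, $\ast$ denotes the transpose of the symmetric block. Exponential stability: there exist $\kappa\ge 1$, $\alpha>0$ such that $\|x_t\|\le\kappa e^{-\alpha t}\|x_0\|$ for all $t\ge 0$ and all $x_0\in\mathcal{C}_{pw}(-h,0;\mathbb{R}^m)$. Lyapunov matrix. Let $$M=\begin{bmatrix}A^\top\otimes I_m &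 A_d^\top\otimes I_m\\ -I_m\otimes A_d^\top & -I_m\otimes A^\top\end{bmatrix},$$ $$N=\begin{bmatrix}A^\top\otimes I_m+I_m\otimes A^\top & A_d^\top\otimes I_m\\ I_{m^2}&0\end{bmatrix}+\begin{bmatrix}I_m\otimes A_d^\top&0\\0&-I_{m^2}\end{bmatrix}e^{hM}.$$ When $N$ is nonsingular, $U:[-h,h]\to\mathbb{R}^{m\times m}$ is defined by $U(\tau)=\mathrm{vec}^{-1}(\mathcal{U}(\tau))$ with $$\mathcal{U}(\tau)=\begin{bmatrix}I_{m^2}&0\end{bmatrix}e^{\tau M}N^{-1}\begin{bmatrix}-\mathrm{vec}(I_m)\\0\end{bmatrix}\ (\tau\ge 0),\qquad \mathcal{U}(\tau)=\begin{bmatrix}0&I_{m^2}\end{bmatrix}e^{(h+\tau)M}N^{-1}\begin{bmatrix}-\mathrm{vec}(I_m)\\0\end{bmatrix}\ (\tau<0).$$ Legendre polynomials on $[-h,0]$: $l_k(\tau)=(-1)^k\sum_{j=0}^k(-1)^j\binom{k}{j}\binom{k+j}{j}\left(\frac{\tau+h}{h}\right)^j$, $k\in\mathbb{N}$, and $\ell_n(\tau)=\begin{bmatrix}l_0(\tau)I_m&\cdots&l_{n-1}(\tau)I_m\end{bmatrix}^\top\in\mathbb{R}^{nm\times m}$. Let $\mathbf{I}_n=\mathrm{diag}\left(\frac1h,\frac3h,\dots,\frac{2n-1}{h}\right)\otimes I_m$. Matrix $\mathbf{P}_n$: $$\mathbf{P}_n=\begin{bmatrix}U(0)&\mathbf{Q}_n\\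 \ast&\mathbf{T}_n+\mathbf{I}_n^{-1}\end{bmatrix},\qquad \mathbf{Q}_n=\int_{-h}^0U^\top(h+\tau)A_d\,\ell_n^\top(\tau)\,d\tau,$$ $$\mathbf{T}_n=\int_{-h}^0\int_{-h}^0\ell_n(\tau_1)A_d^\top U(\tau_1-\tau_2)A_d\,\ell_n^\top(\tau_2)\,d\tau_1d\tau_2.$$ Constants. $r=|A|+|A_d|$; $b_0$ is the unique root on $[0,\pi/2]$ of $g(b)=\sin^4(b)\big((hr)^2+b^2\big)-(hr)^2$; $$\eta_0=\frac{e^{-2rh}}{4r}\cos^2(b_0),\qquad \kappa_1=\max_{\tau\in[0,h]}|U(\tau)A_d|,\qquad \kappa_2=\max_{\tau\in[-h,h]}|A_d^\top U(\tau)A_d|,$$ $$\mathcal{E}(\eta)=-\frac{\kappa_1+\kappa_2}{\kappa_2+1}+\sqrt{\left(\frac{\kappa_1+\kappa_2}{\kappa_2+1}\right)^2+\frac{\eta}{h(\kappa_2+1)}},$$ $$\mu=\frac{hr}{2},\qquad \rho=\sqrt{\frac{2\lceil\mu\rceil}{\pi^3}}\,\frac{1}{\mu^2}\left(\frac{\mu e}{\lceil\mu\rceil+\frac12}\right)^{\lceil\mu\rceil+\frac12},$$ $$\mathcal{N}(\varepsilon)=\max\left(4,\left\lceil\frac32+\mu\, e^{1+\mathcal{W}\left(-\frac{\log(\rho\varepsilon)}{\mu e}\right)}\right\rceil\right),$$ where $\mathcal{W}:\mathbb{R}_+\to\mathbb{R}_+$ is the Lambert function: $\mathcal{W}(z)=y$,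 where $y$ is uniquely defined by the relation $ye^y=z$.
   Formalization: When ρε > 1 with ε = 𝓔(η₀), the argument of the Lambert function is negative and 𝒲 is undefined in the text (e.g. m = 1, h = 1, A = −0.1, A_d = 0); the formal statement sets 𝒲 = 0 there, so 𝒩(ε) = 4. *)

theory Defs
  imports "HOL-Analysis.Analysis"
begin

section \<open>Matrices\<close>

text \<open>
  The product on \<open>real ^ 'n ^ 'n\<close> provided by the type class is entrywise, so the library
  function \<open>exp\<close> is not the matrix exponential.
\<close>

definition mat_exp :: "real ^ 'n ^ 'n \<Rightarrow> real ^ 'n ^ 'n" where
  "mat_exp X = (\<Sum>k. inverse (fact k) *\<^sub>R (((\<lambda>Y. X ** Y) ^^ k) (mat 1)))"

definition spec_norm :: "real ^ 'n ^ 'm \<Rightarrow> real" where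
  "spec_norm X = onorm (\<lambda>v. X *v v)"

text \<open>
  The row (column) index \<open>(i, k)\<close> of a Kronecker product stands for entry \<open>k\<close> of block \<open>i\<close>.
  Accordingly, the entry of \<open>vectorize X\<close> at \<open>(j, i)\<close> is entry \<open>i\<close> of column \<open>j\<close> of \<open>X\<close>.
\<close>

definition kron ::
  "real ^ 'n::finite ^ 'm::finite \<Rightarrow> real ^ 'q::finite ^ 'p::finite \<Rightarrow> real ^ ('n \<times> 'q) ^ ('m \<times> 'p)"
    (infixr "\<otimes>\<^sub>K" 75) where
  "X \<otimes>\<^sub>K Y = (\<chi> r c. X $ fst r $ fst c * Y $ snd r $ snd c)"

definition vectorize :: "real ^ 'n ^ 'm \<Rightarrow> real ^ ('n \<times> 'm)" where
  "vectorize X = (\<chi> p. X $ snd p $ fst p)"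

definition unvectorize :: "real ^ ('n::finite \<times> 'm::finite) \<Rightarrow> real ^ 'n ^ 'm" where
  "unvectorize v = (\<chi> i j. v $ (j, i))"

definition block_mat ::
  "real ^ 'c ^ 'a \<Rightarrow> real ^ 'd ^ 'a \<Rightarrow> real ^ 'c ^ 'b \<Rightarrow> real ^ 'd ^ 'b \<Rightarrow> real ^ ('c + 'd) ^ ('a + 'b)"
where
  "block_mat X11 X12 X21 X22 =
     (\<chi> r c. case r of
        Inl i \<Rightarrow> (case c of Inl j \<Rightarrow> X11 $ i $ j | Inr j \<Rightarrow> X12 $ i $ j)
      | Inr i \<Rightarrow> (case c of Inl j \<Rightarrow> X21 $ i $ j | Inr j \<Rightarrow> X22 $ i $ j))"

definition block_vec :: "real ^ 'a \<Rightarrow> real ^ 'b \<Rightarrow> real ^ ('a + 'b)" where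
  "block_vec u v = (\<chi> r. case r of Inl i \<Rightarrow> u $ i | Inr i \<Rightarrow> v $ i)"

definition upper_part :: "real ^ ('a::finite + 'b::finite) \<Rightarrow> real ^ 'a" where
  "upper_part v = (\<chi> i. v $ Inl i)"

definition lower_part :: "real ^ ('a::finite + 'b::finite) \<Rightarrow> real ^ 'b" where
  "lower_part v = (\<chi> i. v $ Inr i)"

text \<open>
  Matrices whose size depends on a natural number are functions of two indices, restricted to a
  finite index set.
\<close>

definition positive_definite_on :: "'i set \<Rightarrow> ('i \<Rightarrow> 'i \<Rightarrow> real) \<Rightarrow> bool" where
  "positive_definite_on I P \<longleftrightarrow>
     (\<forall>i\<in>I. \<forall>j\<in>I. P i j = P j i) \<and>
     (\<forall>v. (\<exists>i\<in>I. v i \<noteq> 0) \<longrightarrow> 0 < (\<Sum>i\<in>I. \<Sum>j\<in>I. v i * P i j * v j))"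


section \<open>The time-delay system\<close>

definition piecewise_continuous :: "real \<Rightarrow> real \<Rightarrow> (real \<Rightarrow> 'a::real_normed_vector) \<Rightarrow> bool" where
  "piecewise_continuous a b f \<longleftrightarrow>
     (\<exists>S. finite S \<and> continuous_on ({a..b} - S) f) \<and>
     (\<forall>t\<in>{a..<b}. \<exists>l. (f \<longlongrightarrow> l) (at_right t)) \<and>
     (\<forall>t\<in>{a<..b}. \<exists>l. (f \<longlongrightarrow> l) (at_left t))"

definition seg_norm :: "real \<Rightarrow> (real \<Rightarrow> 'a::real_normed_vector) \<Rightarrow> real" where
  "seg_norm h \<phi> = (SUP \<tau>\<in>{-h..0}. norm (\<phi> \<tau>))"

text \<open>
  The derivative at a time \<open>t\<close> may fail to exist if the initial function jumps at \<open>t - h\<close>;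
  hence the differential equation is required up to finitely many times. Together with the
  continuity on \<open>[0, \<infinity>)\<close> this is equivalent to the integrated equation.
\<close>

definition delay_solution ::
  "real \<Rightarrow> real ^ 'm ^ 'm \<Rightarrow> real ^ 'm ^ 'm \<Rightarrow> (real \<Rightarrow> real ^ 'm) \<Rightarrow> (real \<Rightarrow> real ^ 'm) \<Rightarrow> bool"
where
  "delay_solution h A Ad \<phi> x \<longleftrightarrow>
     (\<forall>\<tau>\<in>{-h..0}. x \<tau> = \<phi> \<tau>) \<and>
     continuous_on {0..} x \<and>
     (\<exists>S. finite S \<and>
        (\<forall>t\<in>{0..} - S. (x has_vector_derivative (A *v x t + Ad *v x (t - h))) (at t within {0..})))"

definition exponentially_stable :: "real \<Rightarrow> real ^ 'm ^ 'm \<Rightarrow> real ^ 'm ^ 'm \<Rightarrow> bool" where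
  "exponentially_stable h A Ad \<longleftrightarrow>
     (\<exists>\<kappa>\<ge>1. \<exists>\<alpha>>0. \<forall>\<phi> x. piecewise_continuous (-h) 0 \<phi> \<longrightarrow> delay_solution h A Ad \<phi> x \<longrightarrow>
        (\<forall>t\<ge>0. seg_norm h (\<lambda>\<tau>. x (t + \<tau>)) \<le> \<kappa> * exp (- \<alpha> * t) * seg_norm h \<phi>))"


section \<open>The Lyapunov matrix\<close>

definition lyap_M ::
  "real ^ 'm ^ 'm \<Rightarrow> real ^ 'm ^ 'm \<Rightarrow> real ^ (('m \<times> 'm) + ('m \<times> 'm)) ^ (('m \<times> 'm) + ('m \<times> 'm))"
where
  "lyap_M A Ad = block_mat
     (transpose A \<otimes>\<^sub>K mat 1) (transpose Ad \<otimes>\<^sub>K mat 1)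
     (- (mat 1 \<otimes>\<^sub>K transpose Ad)) (- (mat 1 \<otimes>\<^sub>K transpose A))"

definition lyap_N ::
  "real \<Rightarrow> real ^ 'm ^ 'm \<Rightarrow> real ^ 'm ^ 'm \<Rightarrow>
     real ^ (('m \<times> 'm) + ('m \<times> 'm)) ^ (('m \<times> 'm) + ('m \<times> 'm))"
where
  "lyap_N h A Ad =
     block_mat (transpose A \<otimes>\<^sub>K mat 1 + mat 1 \<otimes>\<^sub>K transpose A) (transpose Ad \<otimes>\<^sub>K mat 1) (mat 1) 0
     + block_mat (mat 1 \<otimes>\<^sub>K transpose Ad) 0 0 (- mat 1) ** mat_exp (h *\<^sub>R lyap_M A Ad)"

definition lyap_U :: "real \<Rightarrow> real ^ 'm ^ 'm \<Rightarrow> real ^ 'm ^ 'm \<Rightarrow> real \<Rightarrow> real ^ 'm ^ 'm" where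
  "lyap_U h A Ad \<tau> =
     (let w = matrix_inv (lyap_N h A Ad) *v block_vec (- vectorize (mat 1)) 0
      in unvectorize
          (if \<tau> \<ge> 0 then upper_part (mat_exp (\<tau> *\<^sub>R lyap_M A Ad) *v w)
           else lower_part (mat_exp ((h + \<tau>) *\<^sub>R lyap_M A Ad) *v w)))"


section \<open>The matrix obtained from the Legendre discretization\<close>

definition legendre :: "real \<Rightarrow> nat \<Rightarrow> real \<Rightarrow> real" where
  "legendre h k \<tau> =
     (-1) ^ k * (\<Sum>j\<le>k. (-1) ^ j * real (k choose j) * real ((k + j) choose j) * ((\<tau> + h) / h) ^ j)"

text \<open>
  \<open>leg_block h k \<tau>\<close> is the \<open>k\<close>-th block row of the stacked matrix of Legendre polynomials.
  \<open>Q_block\<close>, \<open>T_block\<close> are the blocks that result from multiplying with this stacked matrix, and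
  \<open>I_inv_block\<close> gives the blocks of the inverse of the block diagonal matrix with diagonal
  blocks \<open>((2 * k + 1) / h) *\<^sub>R mat 1\<close>. Blocks are numbered from \<open>0\<close>.
\<close>

definition leg_block :: "real \<Rightarrow> nat \<Rightarrow> real \<Rightarrow> real ^ 'm ^ 'm" where
  "leg_block h k \<tau> = legendre h k \<tau> *\<^sub>R mat 1"

definition Q_block :: "real \<Rightarrow> real ^ 'm ^ 'm \<Rightarrow> real ^ 'm ^ 'm \<Rightarrow> nat \<Rightarrow> real ^ 'm ^ 'm" where
  "Q_block h A Ad k =
     integral {-h..0} (\<lambda>\<tau>. transpose (lyap_U h A Ad (h + \<tau>)) ** Ad ** transpose (leg_block h k \<tau>))"

definition T_block :: "real \<Rightarrow> real ^ 'm ^ 'm \<Rightarrow> real ^ 'm ^ 'm \<Rightarrow> nat \<Rightarrow> nat \<Rightarrow> real ^ 'm ^ 'm" where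
  "T_block h A Ad j k =
     integral {-h..0} (\<lambda>\<tau>2. integral {-h..0} (\<lambda>\<tau>1.
       leg_block h j \<tau>1 ** transpose Ad ** lyap_U h A Ad (\<tau>1 - \<tau>2) ** Ad ** transpose (leg_block h k \<tau>2)))"

definition I_inv_block :: "real \<Rightarrow> nat \<Rightarrow> nat \<Rightarrow> real ^ 'm ^ 'm" where
  "I_inv_block h j k = (if j = k then (h / (2 * real k + 1)) *\<^sub>R mat 1 else 0)"

text \<open>
  The index \<open>Inr (k, i)\<close> is the \<open>i\<close>-th row (column) of the \<open>k\<close>-th block in the second
  block row (column) of the matrix; the number \<open>n\<close> of such blocks only enters the index set.
\<close>

definition P_index :: "nat \<Rightarrow> ('m + nat \<times> 'm) set" where
  "P_index n = UNIV <+> ({..<n} \<times> UNIV)"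

fun P_mat ::
  "real \<Rightarrow> real ^ 'm ^ 'm \<Rightarrow> real ^ 'm ^ 'm \<Rightarrow> ('m::finite) + nat \<times> 'm \<Rightarrow> 'm + nat \<times> 'm \<Rightarrow> real"
where
  "P_mat h A Ad (Inl a) (Inl b) = lyap_U h A Ad 0 $ a $ b"
| "P_mat h A Ad (Inl a) (Inr (k, b)) = Q_block h A Ad k $ a $ b"
| "P_mat h A Ad (Inr (j, a)) (Inl b) = transpose (Q_block h A Ad j) $ a $ b"
| "P_mat h A Ad (Inr (j, a)) (Inr (k, b)) = (T_block h A Ad j k + I_inv_block h j k) $ a $ b"


section \<open>The constants\<close>

definition r_const :: "real ^ 'm ^ 'm \<Rightarrow> real ^ 'm ^ 'm \<Rightarrow> real" where
  "r_const A Ad = spec_norm A + spec_norm Ad"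

definition b0_const :: "real \<Rightarrow> real ^ 'm ^ 'm \<Rightarrow> real ^ 'm ^ 'm \<Rightarrow> real" where
  "b0_const h A Ad =
     (THE b. 0 \<le> b \<and> b \<le> pi / 2 \<and>
        (sin b) ^ 4 * ((h * r_const A Ad)\<^sup>2 + b\<^sup>2) - (h * r_const A Ad)\<^sup>2 = 0)"

definition eta0_const :: "real \<Rightarrow> real ^ 'm ^ 'm \<Rightarrow> real ^ 'm ^ 'm \<Rightarrow> real" where
  "eta0_const h A Ad =
     exp (- 2 * r_const A Ad * h) / (4 * r_const A Ad) * (cos (b0_const h A Ad))\<^sup>2"

definition kappa1_const :: "real \<Rightarrow> real ^ 'm ^ 'm \<Rightarrow> real ^ 'm ^ 'm \<Rightarrow> real" where
  "kappa1_const h A Ad = (SUP \<tau>\<in>{0..h}. spec_norm (lyap_U h A Ad \<tau> ** Ad))"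

definition kappa2_const :: "real \<Rightarrow> real ^ 'm ^ 'm \<Rightarrow> real ^ 'm ^ 'm \<Rightarrow> real" where
  "kappa2_const h A Ad = (SUP \<tau>\<in>{-h..h}. spec_norm (transpose Ad ** lyap_U h A Ad \<tau> ** Ad))"

definition E_fun :: "real \<Rightarrow> real ^ 'm ^ 'm \<Rightarrow> real ^ 'm ^ 'm \<Rightarrow> real \<Rightarrow> real" where
  "E_fun h A Ad \<eta> =
     (let \<kappa>1 = kappa1_const h A Ad; \<kappa>2 = kappa2_const h A Ad; q = (\<kappa>1 + \<kappa>2) / (\<kappa>2 + 1)
      in - q + sqrt (q\<^sup>2 + \<eta> / (h * (\<kappa>2 + 1))))"

text \<open>
  The Lambert function is only defined for nonnegative arguments; the value \<open>0\<close> for negative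
  ones is a convention. It concerns only small \<open>h * r_const A Ad\<close>, where the maximum in
  \<open>N_fun\<close> is then \<open>4\<close>.
\<close>

definition lambert_W :: "real \<Rightarrow> real" where
  "lambert_W z = (if z \<ge> 0 then (THE y. y \<ge> 0 \<and> y * exp y = z) else 0)"

definition mu_const :: "real \<Rightarrow> real ^ 'm ^ 'm \<Rightarrow> real ^ 'm ^ 'm \<Rightarrow> real" where
  "mu_const h A Ad = h * r_const A Ad / 2"

definition rho_const :: "real \<Rightarrow> real ^ 'm ^ 'm \<Rightarrow> real ^ 'm ^ 'm \<Rightarrow> real" where
  "rho_const h A Ad =
     (let \<mu> = mu_const h A Ad; c = real_of_int \<lceil>\<mu>\<rceil>
      in sqrt (2 * c / pi ^ 3) * (1 / \<mu>\<^sup>2) * (\<mu> * exp 1 / (c + 1 / 2)) powr (c + 1 / 2))"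

definition N_fun :: "real \<Rightarrow> real ^ 'm ^ 'm \<Rightarrow> real ^ 'm ^ 'm \<Rightarrow> real \<Rightarrow> nat" where
  "N_fun h A Ad \<epsilon> =
     (let \<mu> = mu_const h A Ad; \<rho> = rho_const h A Ad
      in nat (max 4 \<lceil>3 / 2 + \<mu> * exp (1 + lambert_W (- ln (\<rho> * \<epsilon>) / (\<mu> * exp 1)))\<rceil>))"

end

theory Submission
  imports Defs "HOL-Computational_Algebra.Polynomial"
begin

text \<open>
  Along solutions, the Lyapunov-Krasovskii functional built from \<open>U\<close> decreases over each delay interval
  by the squared \<open>L\<^sup>2\<close> norm of the oldest state segment, and the matrix is its restriction to
  polynomial segments. If the system is stable, iterating gives a positive value of the functional. If it is
  not, there are solutions whose values during an arbitrarily long past are dominated by the present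
  one. Along such a history the functional is bounded, so the history is small somewhere in the
  past, whereas its growth is limited by \<open>r\<close>; hence the functional is at most
  \<open>- exp (- 2 * r * h) / (4 * r)\<close> at present. This replaces the usual unstable characteristic root and
  needs no spectral theory. Since the derivative of order \<open>n\<close> of the history is at most \<open>2 * r ^ n\<close>,
  projecting it to polynomials of degree less than \<open>n\<close> (with the error controlled by interpolation in
  Chebyshev nodes) keeps the value of the functional nonpositive.

  The constants require some care: \<open>\<kappa>1\<close> bounds \<open>U \<tau> ** Ad\<close> although the functional contains
  \<open>transpose (U \<tau>) ** Ad\<close>, and \<open>E_fun\<close> weights \<open>\<kappa>2\<close> by \<open>h\<close> where the double
  integral contributes \<open>h\<^sup>2\<close>. Both are compensated by the margin in \<open>N_fun\<close>: the interpolation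
  error contains an additional factor \<open>2 ^ n\<close> in the denominator.
\<close>

section \<open>The matrix exponential\<close>

text \<open>A stable system makes the matrix positive definite for every order \<open>n\<close>; the
  size of \<open>n\<close> matters only for the converse. There, replacing a history by its
  projection lets the squared norm only drop, and changes the double integral by a multiple of
  \<open>\<kappa>2\<close> that is of first order in the approximation error \<delta>. The single
  integral is the obstacle: bounding its kernel through \<open>\<kappa>1\<close> costs a factor
  \<open>exp (r * h)\<close>. But the projection error is orthogonal to all polynomials of degree
  less than \<open>n\<close>, so the kernel may be replaced by its own approximation error, and the
  term becomes of second order in \<delta>; the second factor \<delta> pays for the exponential. The
  inequality \<open>\<kappa>2 \<le> r * \<kappa>1\<close> turns the whole loss into a multiple of
  \<open>\<kappa>1\<close>, the weight \<open>h * \<kappa>2\<close> becoming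
  \<open>2 * \<mu> * \<kappa>1\<close>. Of \<open>eta0_const\<close> two facts enter: it is
  positive, and it is at most \<open>exp (- 2 * r * h) / (4 * r)\<close>.\<close>

lemma bounded_linear_matrix_mult_right: "bounded_linear (\<lambda>Y :: real ^ 'p ^ 'n. (X :: real ^ 'n ^ 'm) ** Y)"
  by (intro linear_conv_bounded_linear[THEN iffD1] linearI)
    (simp_all add: matrix_matrix_mult_def vec_eq_iff sum.distrib algebra_simps sum_distrib_left)

lemma bounded_linear_matrix_mult_left: "bounded_linear (\<lambda>X :: real ^ 'n ^ 'm. X ** (Y :: real ^ 'p ^ 'n))"
  by (intro linear_conv_bounded_linear[THEN iffD1] linearI)
    (simp_all add: matrix_matrix_mult_def vec_eq_iff sum.distrib algebra_simps sum_distrib_left)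

lemma bounded_linear_matrix_vector_left: "bounded_linear (\<lambda>X :: real ^ 'n ^ 'm. X *v w)"
  by (intro linear_conv_bounded_linear[THEN iffD1] linearI)
    (simp_all add: matrix_vector_mult_def vec_eq_iff sum.distrib algebra_simps sum_distrib_left)

lemma bounded_linear_transpose: "bounded_linear (transpose :: real ^ 'n ^ 'm \<Rightarrow> real ^ 'm ^ 'n)"
  by (intro linear_conv_bounded_linear[THEN iffD1] linearI)
    (simp_all add: transpose_def vec_eq_iff)

text \<open>Left multiplication by \<open>X\<close> is a bounded operator on matrices, and the
  exponential series of its bound dominates.\<close>

lemma mat_exp_sums:
  fixes X :: "real ^ 'n ^ 'n"
  shows "(\<lambda>k. inverse (fact k) *\<^sub>R (((\<lambda>Y. X ** Y) ^^ k) (mat 1))) sums mat_exp X"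
proof -
  obtain K where K: "K > 0" "\<And>Y :: real ^ 'n ^ 'n. norm (X ** Y) \<le> norm Y * K"
    using bounded_linear.pos_bounded[OF bounded_linear_matrix_mult_right[of X]] by blast
  have pow: "norm (((\<lambda>Y. X ** Y) ^^ k) (mat 1)) \<le> K ^ k * norm (mat 1 :: real ^ 'n ^ 'n)" for k
  proof (induction k)
    case (Suc k)
    have "norm (((\<lambda>Y. X ** Y) ^^ Suc k) (mat 1)) \<le> norm (((\<lambda>Y. X ** Y) ^^ k) (mat 1)) * K"
      using K(2) by simp
    also have "\<dots> \<le> (K ^ k * norm (mat 1 :: real ^ 'n ^ 'n)) * K"
      using Suc K(1) by (intro mult_right_mono) auto
    finally show ?case by (simp add: mult_ac)
  qed simp
  have "summable (\<lambda>k. inverse (fact k) *\<^sub>R (((\<lambda>Y. X ** Y) ^^ k) (mat 1)))"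
  proof (rule summable_comparison_test')
    show "summable (\<lambda>k. (inverse (fact k) * K ^ k) * norm (mat 1 :: real ^ 'n ^ 'n))"
      by (intro summable_mult2 summable_exp)
    show "norm (inverse (fact k) *\<^sub>R (((\<lambda>Y. X ** Y) ^^ k) (mat 1)))
        \<le> (inverse (fact k) * K ^ k) * norm (mat 1 :: real ^ 'n ^ 'n)" if "k \<ge> 0" for k
      using mult_left_mono[OF pow[of k], of "inverse (fact k)"] by (simp add: mult_ac)
  qed
  then show ?thesis unfolding mat_exp_def by (rule summable_sums)
qed

lemma funpow_matrix_mult_vec: "((\<lambda>Y. X ** Y) ^^ k) (mat 1) *v w = (((*v) X) ^^ k) w"
  for X :: "real ^ 'n ^ 'n"
  by (induction k) (simp_all add: matrix_vector_mul_assoc[symmetric])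

lemma funpow_scaleR_matrix: "(((*v) (t *\<^sub>R X)) ^^ k) w = t ^ k *\<^sub>R (((*v) X) ^^ k) w"
  for X :: "real ^ 'n ^ 'n"
  by (induction k) (simp_all add: scaleR_matrix_vector_assoc[symmetric] matrix_vector_mult_scaleR mult_ac)

lemma mat_exp_mult_vec_sums:
  fixes X :: "real ^ 'n ^ 'n"
  shows "(\<lambda>k. (t ^ k / fact k) *\<^sub>R (((*v) X) ^^ k) w) sums (mat_exp (t *\<^sub>R X) *v w)"
  using bounded_linear.sums[OF bounded_linear_matrix_vector_left[of w] mat_exp_sums[of "t *\<^sub>R X"]]
  by (simp add: scaleR_matrix_vector_assoc[symmetric] funpow_matrix_mult_vec funpow_scaleR_matrix divide_inverse mult.commute)

lemma mat_exp_zero: "mat_exp 0 *v w = w" for w :: "real ^ 'n"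
proof -
  have "(\<lambda>k. ((0::real) ^ k / fact k) *\<^sub>R (((*v) 0) ^^ k) w) sums
    (\<Sum>k\<in>{0::nat}. ((0::real) ^ k / fact k) *\<^sub>R (((*v) 0) ^^ k) w)"
    by (rule sums_finite) auto
  from sums_unique2[OF mat_exp_mult_vec_sums[of 0 0 w] this] show ?thesis by simp
qed

lemma has_vector_derivative_cart:
  fixes f :: "real \<Rightarrow> real ^ 'n"
  assumes "\<And>i. ((\<lambda>x. f x $ i) has_real_derivative f' $ i) (at t within S)"
  shows "(f has_vector_derivative f') (at t within S)"
  unfolding has_vector_derivative_def
proof (subst has_derivative_componentwise_within, intro ballI)
  fix b :: "real ^ 'n" assume "b \<in> Basis"
  then obtain i where b: "b = axis i 1" by (auto simp: Basis_vec_def)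
  show "((\<lambda>x. f x \<bullet> b) has_derivative (\<lambda>x. (x *\<^sub>R f') \<bullet> b)) (at t within S)"
    using assms[of i] by (simp add: b inner_axis has_field_derivative_def mult_commute_abs)
qed

text \<open>Applied to a fixed vector, each component of the exponential is a scalar power series in
  \<open>t\<close> that converges everywhere, so it can be differentiated termwise.\<close>

lemma mat_exp_has_vector_derivative:
  fixes X :: "real ^ 'n ^ 'n"
  shows "((\<lambda>t. mat_exp (t *\<^sub>R X) *v w) has_vector_derivative X *v (mat_exp (t *\<^sub>R X) *v w)) (at t)"
proof (rule has_vector_derivative_cart)
  fix i
  define c where "c k = ((((*v) X) ^^ k) w) $ i / fact k" for k
  have bl: "bounded_linear (\<lambda>v :: real ^ 'n. v $ i)" by (rule bounded_linear_vec_nth)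
  have sums: "(\<lambda>k. c k * t ^ k) sums ((mat_exp (t *\<^sub>R X) *v w) $ i)" for t
    using bounded_linear.sums[OF bl mat_exp_mult_vec_sums[of t X w]] by (simp add: c_def mult_ac)
  have "(\<lambda>k. X *v ((t ^ k / fact k) *\<^sub>R (((*v) X) ^^ k) w)) sums (X *v (mat_exp (t *\<^sub>R X) *v w))"
    by (rule bounded_linear.sums[OF matrix_vector_mul_bounded_linear mat_exp_mult_vec_sums])
  moreover have "diffs c k = (X *v ((((*v) X) ^^ k) w)) $ i / fact k" for k
    by (simp add: diffs_def c_def fact_Suc del: of_nat_Suc)
  ultimately have "(\<lambda>k. diffs c k * t ^ k) sums ((X *v (mat_exp (t *\<^sub>R X) *v w)) $ i)"
    using bounded_linear.sums[OF bl] by (fastforce simp: matrix_vector_mult_scaleR mult_ac)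
  moreover have "((\<lambda>t. \<Sum>k. c k * t ^ k) has_field_derivative (\<Sum>k. diffs c k * t ^ k)) (at t)"
    by (rule termdiffs_strong_converges_everywhere) (rule sums_summable[OF sums])
  ultimately show "((\<lambda>t. (mat_exp (t *\<^sub>R X) *v w) $ i) has_real_derivative
      (X *v (mat_exp (t *\<^sub>R X) *v w)) $ i) (at t)"
    by (simp add: sums_unique[OF sums, symmetric] sums_iff)
qed

text \<open>Energy argument: the squared norm of the difference, weighted with
  \<open>exp (- 2 * K * t)\<close> for the operator norm \<open>K\<close>, is nonincreasing and
  starts at 0. It works forward in time only.\<close>

lemma linear_ode_unique:
  fixes X :: "real ^ 'n ^ 'n"
  assumes Y: "\<And>t. (Y has_vector_derivative X *v Y t) (at t)"
    and Z: "\<And>t. (Z has_vector_derivative X *v Z t) (at t)"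
    and "Y a = Z a" "a \<le> t"
  shows "Y t = Z t"
proof -
  define D where "D t = Y t - Z t" for t
  define K where "K = onorm ((*v) X)"
  have D: "(D has_vector_derivative X *v D t) (at t)" for t
    unfolding D_def using has_vector_derivative_diff[OF Y Z] by (simp add: matrix_vector_mult_diff_distrib)
  define g where "g t = (D t \<bullet> D t) * exp (- 2 * K * t)" for t
  have "g t \<le> g a"
  proof (rule DERIV_nonpos_imp_nonincreasing[OF \<open>a \<le> t\<close>])
    fix x
    have D': "((\<lambda>t. D t \<bullet> D t) has_real_derivative (2 * (D x \<bullet> (X *v D x)))) (at x)"
      using bounded_bilinear.has_vector_derivative[OF bounded_bilinear_inner D[of x] D[of x]]
      unfolding has_real_derivative_iff_has_vector_derivative by (simp add: inner_commute)
    have "(g has_real_derivative (2 * (D x \<bullet> (X *v D x)) * exp (- 2 * K * x)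
        + (D x \<bullet> D x) * (exp (- 2 * K * x) * (- 2 * K)))) (at x)"
      unfolding g_def by (auto intro!: derivative_eq_intros D')
    moreover have "D x \<bullet> (X *v D x) \<le> K * (D x \<bullet> D x)"
    proof -
      have "D x \<bullet> (X *v D x) \<le> norm (D x) * norm (X *v D x)" by (rule norm_cauchy_schwarz)
      also have "\<dots> \<le> norm (D x) * (K * norm (D x))"
        unfolding K_def by (intro mult_left_mono onorm matrix_vector_mul_bounded_linear) auto
      finally show ?thesis by (simp add: dot_square_norm power2_eq_square mult_ac)
    qed
    then have "2 * (D x \<bullet> (X *v D x)) * exp (- 2 * K * x)
        + (D x \<bullet> D x) * (exp (- 2 * K * x) * (- 2 * K)) \<le> 0"
      using mult_right_mono[of "D x \<bullet> (X *v D x)" "K * (D x \<bullet> D x)" "2 * exp (- 2 * K * x)"]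
      by (simp add: algebra_simps)
    ultimately show "\<exists>y. (g has_real_derivative y) (at x) \<and> y \<le> 0" by blast
  qed
  moreover have "g a = 0" using assms by (simp add: g_def D_def)
  ultimately have "D t \<bullet> D t \<le> 0" unfolding g_def by (simp add: mult_le_0_iff not_le)
  then have "D t = 0" by (metis inner_ge_zero inner_eq_zero_iff order_antisym)
  then show ?thesis by (simp add: D_def)
qed

section \<open>Properties of the Lyapunov matrix\<close>

lemma sum_delta_mult: "(\<Sum>k\<in>UNIV. (if i = k then 1 else 0) * f k) = (f i :: real)"
  for i :: "'n::finite"
proof -
  have "(\<Sum>k\<in>UNIV. (if i = k then 1 else 0) * f k) = (\<Sum>k\<in>UNIV. if i = k then f k else 0)"
    by (rule sum.cong) auto
  then show ?thesis by simp
qed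

lemma sum_UNIV_prod: "(\<Sum>p\<in>UNIV. f p) = (\<Sum>a\<in>UNIV. \<Sum>b\<in>UNIV. f (a, b))"
  for f :: "'a::finite \<times> 'b::finite \<Rightarrow> real"
  by (simp add: sum.cartesian_product)

lemma kron_mat_1_right: "(transpose Y \<otimes>\<^sub>K mat 1) *v vectorize X = vectorize (X ** Y)"
  for X :: "real ^ 'n ^ 'm" and Y :: "real ^ 'p ^ 'n"
proof -
  have "((transpose Y \<otimes>\<^sub>K mat 1) *v vectorize X) $ (a, b) = vectorize (X ** Y) $ (a, b)" for a b
  proof -
    have "((transpose Y \<otimes>\<^sub>K mat 1) *v vectorize X) $ (a, b)
        = (\<Sum>c1\<in>UNIV. \<Sum>c2\<in>UNIV. Y $ c1 $ a * (if b = c2 then 1 else 0) * X $ c2 $ c1)"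
      by (simp add: matrix_vector_mult_def kron_def vectorize_def sum_UNIV_prod mat_def transpose_def)
    also have "\<dots> = (\<Sum>c1\<in>UNIV. X $ b $ c1 * Y $ c1 $ a)"
    proof (rule sum.cong)
      fix c
      show "(\<Sum>c2\<in>UNIV. Y $ c $ a * (if b = c2 then 1 else 0) * X $ c2 $ c) = X $ b $ c * Y $ c $ a"
        using sum_delta_mult[of b "\<lambda>c2. Y $ c $ a * X $ c2 $ c"] by (simp add: mult_ac)
    qed simp
    finally show ?thesis by (simp add: vectorize_def matrix_matrix_mult_def)
  qed
  then show ?thesis by (simp add: vec_eq_iff)
qed

lemma kron_mat_1_left: "(mat 1 \<otimes>\<^sub>K Y) *v vectorize X = vectorize (Y ** X)"
  for X :: "real ^ 'n ^ 'm" and Y :: "real ^ 'm ^ 'p"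
proof -
  have "((mat 1 \<otimes>\<^sub>K Y) *v vectorize X) $ (a, b) = vectorize (Y ** X) $ (a, b)" for a b
  proof -
    have "((mat 1 \<otimes>\<^sub>K Y) *v vectorize X) $ (a, b)
        = (\<Sum>c1\<in>UNIV. \<Sum>c2\<in>UNIV. (if a = c1 then 1 else 0) * Y $ b $ c2 * X $ c2 $ c1)"
      by (simp add: matrix_vector_mult_def kron_def vectorize_def sum_UNIV_prod mat_def)
    also have "\<dots> = (\<Sum>c1\<in>UNIV. (if a = c1 then 1 else 0) * (\<Sum>c2\<in>UNIV. Y $ b $ c2 * X $ c2 $ c1))"
      by (simp add: sum_distrib_left mult_ac)
    also have "\<dots> = (\<Sum>c2\<in>UNIV. Y $ b $ c2 * X $ c2 $ a)" by (rule sum_delta_mult)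
    finally show ?thesis by (simp add: vectorize_def matrix_matrix_mult_def)
  qed
  then show ?thesis by (simp add: vec_eq_iff)
qed

lemma sum_UNIV_sum: "(\<Sum>k\<in>UNIV. f k) = (\<Sum>k\<in>UNIV. f (Inl k)) + (\<Sum>k\<in>UNIV. f (Inr k))"
  for f :: "'a::finite + 'b::finite \<Rightarrow> real"
  unfolding UNIV_Plus_UNIV[symmetric] by (subst sum.Plus) auto

lemma block_mat_mult_vec:
  "block_mat X11 X12 X21 X22 *v block_vec u v = block_vec (X11 *v u + X12 *v v) (X21 *v u + X22 *v v)"
  by (simp add: vec_eq_iff block_mat_def block_vec_def matrix_vector_mult_def sum_UNIV_sum split: sum.split)

lemma upper_part_block_vec [simp]: "upper_part (block_vec u v) = u"
  and lower_part_block_vec [simp]: "lower_part (block_vec u v) = v"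
  and block_vec_parts [simp]: "block_vec (upper_part x) (lower_part x) = x"
  by (simp_all add: vec_eq_iff upper_part_def lower_part_def block_vec_def split: sum.split)

lemma vectorize_unvectorize [simp]: "vectorize (unvectorize v) = v"
  and unvectorize_vectorize [simp]: "unvectorize (vectorize X) = X"
  by (simp_all add: vec_eq_iff vectorize_def unvectorize_def)

lemma vectorize_linear:
  "vectorize (X + Y) = vectorize X + vectorize Y"
  "vectorize (X - Y) = vectorize X - vectorize Y"
  "vectorize (- X) = - vectorize X"
  "vectorize (a *\<^sub>R X) = a *\<^sub>R vectorize X"
  "vectorize 0 = 0"
  by (simp_all add: vec_eq_iff vectorize_def)

lemma block_vec_linear:
  "block_vec (u + u') (v + v') = block_vec u v + block_vec u' v'"
  "block_vec (a *\<^sub>R u) (a *\<^sub>R v) = a *\<^sub>R block_vec u v"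
  by (simp_all add: vec_eq_iff block_vec_def split: sum.split)

text \<open>Vector form of the pair of \<open>U t\<close> and \<open>U (t - h)\<close>. For this
  pair the delay equation of the Lyapunov matrix becomes an ordinary linear differential equation
  with matrix \<open>lyap_M\<close>.\<close>

definition stack :: "(real ^ 'm ^ 'm) \<times> (real ^ 'm ^ 'm) \<Rightarrow> real ^ (('m \<times> 'm) + ('m \<times> 'm))" where
  "stack = (\<lambda>(P, Q). block_vec (vectorize P) (vectorize Q))"

lemma bounded_linear_stack: "bounded_linear stack"
  by (intro linear_conv_bounded_linear[THEN iffD1] linearI)
    (auto simp: stack_def block_vec_linear vectorize_linear)

lemma bounded_linear_unvectorize_upper:
  "bounded_linear (\<lambda>x :: real ^ (('m::finite \<times> 'm) + ('m \<times> 'm)). unvectorize (upper_part x))"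
  by (intro linear_conv_bounded_linear[THEN iffD1] linearI)
    (auto simp: upper_part_def unvectorize_def vec_eq_iff)

lemma bounded_linear_unvectorize_lower:
  "bounded_linear (\<lambda>x :: real ^ (('m::finite \<times> 'm) + ('m \<times> 'm)). unvectorize (lower_part x))"
  by (intro linear_conv_bounded_linear[THEN iffD1] linearI)
    (auto simp: lower_part_def unvectorize_def vec_eq_iff)

lemma matrix_minus_mult_vec: "(- X) *v y = - (X *v y)" for X :: "real ^ 'n ^ 'm"
  by (simp add: vec_eq_iff matrix_vector_mult_def sum_negf)

lemma lyap_M_stack:
  "lyap_M A Ad *v stack (P, Q) = stack (P ** A + Q ** Ad, - (transpose Ad ** P) - transpose A ** Q)"
  by (simp add: lyap_M_def stack_def block_mat_mult_vec kron_mat_1_right kron_mat_1_left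
      vectorize_linear matrix_minus_mult_vec)

text \<open>Read as a map on initial pairs of the flow, \<open>lyap_N\<close> evaluates two boundary
  expressions: the one that must equal \<open>- mat 1\<close>, and the mismatch of the two branches
  of \<open>U\<close> at 0.\<close>

lemma lyap_N_stack:
  assumes "mat_exp (h *\<^sub>R lyap_M A Ad) *v stack (P, Q) = stack (Ph, Qh)"
  shows "lyap_N h A Ad *v stack (P, Q)
    = stack (P ** A + transpose A ** P + Q ** Ad + transpose Ad ** Ph, P - Qh)"
proof -
  have "lyap_N h A Ad *v stack (P, Q) =
     block_mat (transpose A \<otimes>\<^sub>K mat 1 + mat 1 \<otimes>\<^sub>K transpose A) (transpose Ad \<otimes>\<^sub>K mat 1) (mat 1) 0 *v stack (P, Q)
     + block_mat (mat 1 \<otimes>\<^sub>K transpose Ad) 0 0 (- mat 1) *v stack (Ph, Qh)"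
    by (simp add: lyap_N_def matrix_vector_mult_add_rdistrib matrix_vector_mul_assoc[symmetric] assms)
  then show ?thesis
    by (simp add: stack_def block_mat_mult_vec kron_mat_1_right kron_mat_1_left block_vec_linear[symmetric]
      vectorize_linear matrix_minus_mult_vec matrix_vector_mult_add_rdistrib add_ac)
qed

lemma stack_inject: "stack (P, Q) = stack (P', Q') \<longleftrightarrow> P = P' \<and> Q = Q'"
proof
  assume "stack (P, Q) = stack (P', Q')"
  then have "unvectorize (upper_part (stack (P, Q))) = unvectorize (upper_part (stack (P', Q')))"
    "unvectorize (lower_part (stack (P, Q))) = unvectorize (lower_part (stack (P', Q')))" by auto
  then show "P = P' \<and> Q = Q'" by (simp add: stack_def)
qed auto

lemma transpose_add: "transpose (X + Y) = transpose X + transpose Y" for X :: "real ^ 'n ^ 'm"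
  by (simp add: transpose_def vec_eq_iff)
lemma transpose_diff: "transpose (X - Y) = transpose X - transpose Y" for X :: "real ^ 'n ^ 'm"
  by (simp add: transpose_def vec_eq_iff)
lemma transpose_minus: "transpose (- X) = - transpose X" for X :: "real ^ 'n ^ 'm"
  by (simp add: transpose_def vec_eq_iff)

lemma matrix_inv_right: "invertible X \<Longrightarrow> X ** matrix_inv X = mat 1"
  and matrix_inv_left: "invertible X \<Longrightarrow> matrix_inv X ** X = mat 1" for X :: "real ^ 'n ^ 'n"
  unfolding invertible_def matrix_inv_def by (metis (mono_tags, lifting) someI_ex)+

locale lyapunov_delay =
  fixes h :: real and A Ad :: "real ^ 'm ^ 'm"
  assumes h_pos: "h > 0" and inv_N: "invertible (lyap_N h A Ad)"
begin

definition w where "w = matrix_inv (lyap_N h A Ad) *v stack (- mat 1, 0)"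

text \<open>The branch of \<open>U\<close> for nonnegative arguments, continued to all real
  \<open>t\<close>. It is smooth, whereas the derivative of \<open>U\<close> jumps by
  \<open>- mat 1\<close> at 0.\<close>

definition G :: "real \<Rightarrow> real ^ 'm ^ 'm" where
  "G t = unvectorize (upper_part (mat_exp (t *\<^sub>R lyap_M A Ad) *v w))"

definition H :: "real \<Rightarrow> real ^ 'm ^ 'm" where
  "H t = unvectorize (lower_part (mat_exp (t *\<^sub>R lyap_M A Ad) *v w))"

abbreviation U where "U \<equiv> lyap_U h A Ad"

lemma stack_G_H: "stack (G t, H t) = mat_exp (t *\<^sub>R lyap_M A Ad) *v w"
  by (simp add: stack_def G_def H_def)

lemma U_G_H: "U \<tau> = (if \<tau> \<ge> 0 then G \<tau> else H (h + \<tau>))"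
  by (simp add: lyap_U_def G_def H_def w_def stack_def vectorize_linear Let_def)

lemma has_vector_derivative_stack_G_H:
  "((\<lambda>t. stack (G t, H t)) has_vector_derivative
     stack (G t ** A + H t ** Ad, - (transpose Ad ** G t) - transpose A ** H t)) (at t)"
  unfolding lyap_M_stack[symmetric] stack_G_H by (rule mat_exp_has_vector_derivative)

lemma G_has_vector_derivative: "(G has_vector_derivative G t ** A + H t ** Ad) (at t)"
  using bounded_linear.has_vector_derivative[OF bounded_linear_unvectorize_upper
      has_vector_derivative_stack_G_H]
  by (simp add: stack_def)

lemma H_has_vector_derivative:
  "(H has_vector_derivative - (transpose Ad ** G t) - transpose A ** H t) (at t)"
  using bounded_linear.has_vector_derivative[OF bounded_linear_unvectorize_lower
      has_vector_derivative_stack_G_H]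
  by (simp add: stack_def)

lemma N_w: "lyap_N h A Ad *v w = stack (- mat 1, 0)"
  using inv_N by (simp add: w_def matrix_vector_mul_assoc matrix_inv_left matrix_inv_right)

lemma stack_0: "stack (G 0, H 0) = w"
  by (simp add: stack_G_H mat_exp_zero)

lemma boundary:
  "G 0 ** A + transpose A ** G 0 + H 0 ** Ad + transpose Ad ** G h = - mat 1"
  "G 0 = H h"
proof -
  have "mat_exp (h *\<^sub>R lyap_M A Ad) *v stack (G 0, H 0) = stack (G h, H h)"
    by (simp add: stack_G_H mat_exp_zero)
  from lyap_N_stack[OF this] have "stack (G 0 ** A + transpose A ** G 0 + H 0 ** Ad + transpose Ad ** G h, G 0 - H h)
    = stack (- mat 1, 0)" by (simp only: N_w stack_0)
  then have *: "G 0 ** A + transpose A ** G 0 + H 0 ** Ad + transpose Ad ** G h = - mat 1 \<and> G 0 - H h = 0"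
    by (simp only: stack_inject)
  from conjunct1[OF *] show "G 0 ** A + transpose A ** G 0 + H 0 ** Ad + transpose Ad ** G h = - mat 1" .
  from conjunct2[OF *] show "G 0 = H h" by simp
qed

text \<open>Reversing time and transposing maps solutions of the boundary value problem for
  \<open>(G, H)\<close> to solutions; nonsingularity of \<open>N\<close> makes the solution unique.\<close>

lemma H_eq: "H t = transpose (G (h - t))"
proof -
  define P where "P t = transpose (H (h - t))" for t
  define Q where "Q t = transpose (G (h - t))" for t
  have rev: "((\<lambda>t. h - t) has_vector_derivative -1) (at t)" for t :: real
    by (auto intro!: derivative_eq_intros)
  have G': "((\<lambda>t. G (h - t)) has_vector_derivative - (G (h - t) ** A + H (h - t) ** Ad)) (at t)" for t
    using vector_diff_chain_at[OF rev G_has_vector_derivative] by (simp add: o_def)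
  have H': "((\<lambda>t. H (h - t)) has_vector_derivative transpose Ad ** G (h - t) + transpose A ** H (h - t)) (at t)" for t
    using vector_diff_chain_at[OF rev H_has_vector_derivative] by (simp add: o_def add.commute)
  have P': "(P has_vector_derivative P t ** A + Q t ** Ad) (at t)" for t
    unfolding P_def Q_def using bounded_linear.has_vector_derivative[OF bounded_linear_transpose H'[of t]]
    by (simp add: transpose_add matrix_transpose_mul add_ac)
  have Q': "(Q has_vector_derivative - (transpose Ad ** P t) - transpose A ** Q t) (at t)" for t
    unfolding P_def Q_def using bounded_linear.has_vector_derivative[OF bounded_linear_transpose G'[of t]]
    by (simp add: transpose_add transpose_minus transpose_diff matrix_transpose_mul minus_diff_commute)
  have PQ: "((\<lambda>t. stack (P t, Q t)) has_vector_derivative lyap_M A Ad *v stack (P t, Q t)) (at t)" for t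
    unfolding lyap_M_stack
    by (rule bounded_linear.has_vector_derivative[OF bounded_linear_stack])
      (rule has_vector_derivative_Pair[OF P' Q'])
  have flow: "stack (P t, Q t) = mat_exp (t *\<^sub>R lyap_M A Ad) *v stack (P 0, Q 0)" if "t \<ge> 0" for t
    by (rule linear_ode_unique[OF PQ mat_exp_has_vector_derivative _ that]) (simp add: mat_exp_zero)
  have "lyap_N h A Ad *v stack (P 0, Q 0)
    = stack (P 0 ** A + transpose A ** P 0 + Q 0 ** Ad + transpose Ad ** P h, P 0 - Q h)"
    by (rule lyap_N_stack) (use flow[of h] h_pos in simp)
  also have "P 0 - Q h = 0" using boundary(2) by (simp add: P_def Q_def)
  also have "P 0 ** A + transpose A ** P 0 + Q 0 ** Ad + transpose Ad ** P h
     = transpose (G 0 ** A + transpose A ** G 0 + H 0 ** Ad + transpose Ad ** G h)"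
    using boundary(2) by (simp add: P_def Q_def transpose_add matrix_transpose_mul add_ac)
  also have "\<dots> = - mat 1" by (simp add: boundary(1) transpose_minus transpose_mat)
  finally have "lyap_N h A Ad *v stack (P 0, Q 0) = lyap_N h A Ad *v w" by (simp add: N_w)
  then have "matrix_inv (lyap_N h A Ad) *v (lyap_N h A Ad *v stack (P 0, Q 0))
     = matrix_inv (lyap_N h A Ad) *v (lyap_N h A Ad *v w)" by simp
  then have PQ0: "stack (P 0, Q 0) = w"
    using inv_N by (simp add: matrix_vector_mul_assoc matrix_inv_left matrix_inv_right)
  have *: "H t = transpose (G (h - t))" if "t \<ge> 0" for t
    using flow[OF that] unfolding PQ0 stack_G_H[symmetric] by (simp add: stack_inject Q_def)
  have **: "G t = transpose (H (h - t))" if "t \<ge> 0" for t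
    using flow[OF that] unfolding PQ0 stack_G_H[symmetric] by (simp add: stack_inject P_def)
  show ?thesis
  proof (cases "t \<ge> 0")
    case False
    \<comment> \<open>Uniqueness was shown forward in time only. As \<open>t\<close> is negative
      here, the companion identity for \<open>G\<close> is used at \<open>h - t\<close>, which is
      positive.\<close>
    then have "G (h - t) = transpose (H (h - (h - t)))" using h_pos by (intro **) auto
    then show ?thesis by simp
  qed (rule *)
qed

lemma G_0_symmetric: "transpose (G 0) = G 0"
  using boundary(2) H_eq[of h] by simp

lemma U_nonneg: "\<tau> \<ge> 0 \<Longrightarrow> U \<tau> = G \<tau>"
  by (simp add: U_G_H)

lemma U_nonpos: "\<tau> \<le> 0 \<Longrightarrow> U \<tau> = transpose (G (- \<tau>))"
  by (cases "\<tau> = 0") (simp_all add: U_G_H G_0_symmetric H_eq)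

lemma U_minus: "U (- \<tau>) = transpose (U \<tau>)"
  by (cases "\<tau> \<ge> 0") (simp_all add: U_nonneg U_nonpos)

lemma G_deriv: "(G has_vector_derivative G t ** A + transpose (G (h - t)) ** Ad) (at t)"
  using G_has_vector_derivative by (simp add: H_eq)

lemma algebraic_property:
  "G 0 ** A + transpose A ** G 0 + transpose (G h) ** Ad + transpose Ad ** G h = - mat 1"
  using boundary(1) by (simp add: H_eq)

lemma continuous_on_G: "continuous_on S G"
  using G_deriv by (meson continuous_at_imp_continuous_on has_vector_derivative_continuous)

lemma continuous_on_U: "continuous_on S U"
proof -
  have "continuous_on ({0..} \<union> {..0}) U"
  proof (rule continuous_on_closed_Un)
    show "continuous_on {0..} U"
      by (rule continuous_on_eq[OF continuous_on_G]) (simp add: U_nonneg)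
    have "continuous_on {..0} (\<lambda>\<tau>. transpose (G (- \<tau>)))"
      by (intro bounded_linear.continuous_on[OF bounded_linear_transpose]
        continuous_on_compose2[OF continuous_on_G[of UNIV]] continuous_intros) auto
    then show "continuous_on {..0} U"
      by (rule continuous_on_eq) (simp add: U_nonpos)
  qed auto
  moreover have "{0..} \<union> {..0} = (UNIV :: real set)" by auto
  ultimately show ?thesis by (metis continuous_on_subset subset_UNIV)
qed

end

section \<open>Legendre polynomials\<close>

text \<open>Pascal's rule splits off one application of the difference operator, so that alternating
  binomial sums can be treated by induction on their order.\<close>

lemma alternating_binomial_Suc:
  fixes f :: "nat \<Rightarrow> 'a::comm_ring_1"
  shows "(\<Sum>j\<le>Suc k. (-1) ^ j * of_nat (Suc k choose j) * f j)
    = (\<Sum>j\<le>k. (-1) ^ j * of_nat (k choose j) * (f j - f (Suc j)))"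
proof -
  have "(\<Sum>j\<le>Suc k. (-1) ^ j * of_nat (Suc k choose j) * f j)
     = f 0 + (\<Sum>j\<le>k. (-1) ^ Suc j * of_nat (Suc k choose Suc j) * f (Suc j))"
    by (subst sum.atMost_Suc_shift) simp
  also have "\<dots> = (f 0 + (\<Sum>j\<le>k. (-1) ^ Suc j * of_nat (k choose Suc j) * f (Suc j)))
       - (\<Sum>j\<le>k. (-1) ^ j * of_nat (k choose j) * f (Suc j))"
    by (simp add: algebra_simps sum.distrib sum_subtractf sum_negf)
  also have "f 0 + (\<Sum>j\<le>k. (-1) ^ Suc j * of_nat (k choose Suc j) * f (Suc j))
     = (\<Sum>j\<le>Suc k. (-1) ^ j * of_nat (k choose j) * f j)"
    by (subst sum.atMost_Suc_shift) simp
  also have "\<dots> = (\<Sum>j\<le>k. (-1) ^ j * of_nat (k choose j) * f j)" by (simp add: binomial_eq_0)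
  finally show ?thesis by (simp add: algebra_simps sum_subtractf)
qed

text \<open>Up to sign the sum is a difference of order \<open>k\<close>. Each difference step
  lowers the degree, since \<open>p\<close> and its shift share the leading coefficient.\<close>

lemma alternating_binomial_poly:
  fixes p :: "real poly"
  assumes "degree p < k"
  shows "(\<Sum>j\<le>k. (-1) ^ j * real (k choose j) * poly p (real j)) = 0"
  using assms
proof (induction k arbitrary: p)
  case (Suc k)
  define q where "q = p - pcompose p [:1, 1:]"
  have eq: "poly p (real j) - poly p (real (Suc j)) = poly q (real j)" for j
    by (simp add: q_def poly_pcompose add.commute)
  have "q = 0 \<or> degree q < k"
  proof (cases "degree p = 0")
    case True
    then obtain a where "p = [:a:]" by (auto elim: degree_eq_zeroE)
    then show ?thesis by (simp add: q_def)
  next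
    case False
    have le: "degree q \<le> degree p" unfolding q_def by (intro degree_diff_le) (auto simp: degree_pcompose)
    have "lead_coeff (pcompose p [:1, 1:]) = lead_coeff p" by (subst lead_coeff_comp) auto
    then have "coeff q (degree p) = 0" by (simp add: q_def degree_pcompose)
    then have "q = 0 \<or> degree q < degree p" using le
      by (metis le_neq_implies_less leading_coeff_0_iff)
    then show ?thesis using Suc.prems by auto
  qed
  then show ?case unfolding alternating_binomial_Suc eq using Suc.IH[of q] by auto
qed simp

text \<open>By Pascal's rule each difference step lowers the lower index by one and changes the
  sign. With \<open>a = k\<close> and \<open>b = 0\<close> this evaluates the Legendre polynomial at
  the right end point.\<close>

lemma alternating_binomial_choose:
  "(\<Sum>j\<le>k. (-1) ^ j * real (k choose j) * real ((a + j) choose (b + k))) = (-1) ^ k * real (a choose b)"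
proof (induction k arbitrary: a b)
  case (Suc k)
  have "real ((a + j) choose (b + Suc k)) - real ((a + Suc j) choose (b + Suc k))
      = - real ((a + j) choose (b + k))" for j by simp
  then have "(\<Sum>j\<le>Suc k. (-1) ^ j * real (Suc k choose j) * real ((a + j) choose (b + Suc k)))
      = (\<Sum>j\<le>k. (-1) ^ j * real (k choose j) * - real ((a + j) choose (b + k)))"
    unfolding alternating_binomial_Suc by simp
  also have "\<dots> = - (\<Sum>j\<le>k. (-1) ^ j * real (k choose j) * real ((a + j) choose (b + k)))"
    by (simp add: sum_negf)
  finally show ?case by (simp add: Suc.IH)
qed simp

definition leg_coeff :: "nat \<Rightarrow> nat \<Rightarrow> real" where
  "leg_coeff k j = (-1) ^ k * ((-1) ^ j * real (k choose j) * real ((k + j) choose j))"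

lemma legendre_eq: "legendre h k \<tau> = (\<Sum>j\<le>k. leg_coeff k j * ((\<tau> + h) / h) ^ j)"
  by (simp add: legendre_def leg_coeff_def sum_distrib_left mult_ac)

lemma continuous_on_legendre [continuous_intros]:
  "h \<noteq> 0 \<Longrightarrow> continuous_on S f \<Longrightarrow> continuous_on S (\<lambda>x. legendre h k (f x))"
  unfolding legendre_eq by (intro continuous_intros) auto

lemma legendre_0: "h > 0 \<Longrightarrow> legendre h k 0 = 1"
proof -
  assume "h > 0"
  moreover have "(k + j) choose j = (k + j) choose (0 + k)" for j
    using binomial_symmetric[of j "k + j"] by simp
  ultimately have "legendre h k 0 = (-1) ^ k * (\<Sum>j\<le>k. (-1) ^ j * real (k choose j) * real ((k + j) choose (0 + k)))"
    unfolding legendre_def by simp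
  also have "\<dots> = (-1) ^ k * ((-1) ^ k * real (k choose 0))"
    by (subst alternating_binomial_choose) simp
  finally show ?thesis by (simp flip: power_mult_distrib)
qed

lemma moment_has_integral:
  assumes "h > 0"
  shows "((\<lambda>\<tau>. ((\<tau> + h) / h) ^ i) has_integral h / (real i + 1)) {-h..0}"
proof -
  have "((\<lambda>\<tau>. ((\<tau> + h) / h) ^ i) has_integral
      h / (real i + 1) * ((0 + h) / h) ^ Suc i - h / (real i + 1) * ((-h + h) / h) ^ Suc i) {-h..0}"
  proof (rule fundamental_theorem_of_calculus)
    fix x
    have "((\<lambda>\<tau>. h / (real i + 1) * ((\<tau> + h) / h) ^ Suc i) has_real_derivative
       h / (real i + 1) * (real (Suc i) * (1 / h * ((x + h) / h) ^ (Suc i - Suc 0)))) (at x within {-h..0})"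
      using assms by (intro DERIV_cmult DERIV_power) (auto intro!: derivative_eq_intros)
    moreover have "h / (real i + 1) * (real (Suc i) * (1 / h * ((x + h) / h) ^ (Suc i - Suc 0))) = ((x + h) / h) ^ i"
      using assms by (simp add: add.commute)
    ultimately show "((\<lambda>\<tau>. h / (real i + 1) * ((\<tau> + h) / h) ^ Suc i) has_vector_derivative
        ((x + h) / h) ^ i) (at x within {-h..0})"
      by (simp add: has_real_derivative_iff_has_vector_derivative)
  qed (use assms in auto)
  then show ?thesis using assms by simp
qed

text \<open>Integrating the powers leaves an alternating sum of \<open>(k + j) choose j\<close>
  divided by \<open>i + j + 1\<close>. The binomial is the product of \<open>j + l\<close> for
  \<open>l\<close> from 1 to \<open>k\<close>, divided by \<open>fact k\<close>; as
  \<open>i < k\<close>, the denominator is one of these factors. What remains is a polynomial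
  \<open>q\<close> in \<open>j\<close> of degree \<open>k - 1\<close>, which the alternating sum
  annihilates.\<close>

lemma legendre_orthogonal_power:
  assumes "h > 0" "i < k"
  shows "((\<lambda>\<tau>. ((\<tau> + h) / h) ^ i * legendre h k \<tau>) has_integral 0) {-h..0}"
proof -
  have "((\<lambda>\<tau>. \<Sum>j\<le>k. leg_coeff k j * ((\<tau> + h) / h) ^ (i + j)) has_integral
     (\<Sum>j\<le>k. leg_coeff k j * (h / (real (i + j) + 1)))) {-h..0}"
    by (intro has_integral_sum has_integral_mult_right moment_has_integral assms) auto
  moreover have "(\<Sum>j\<le>k. leg_coeff k j * (h / (real (i + j) + 1))) = 0"
  proof -
    define q where "q = smult (1 / fact k) (\<Prod>l\<in>{1..k} - {i + 1}. [:real l, 1:])"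
    have "degree (\<Prod>l\<in>{1..k} - {i + 1}. [:real l, 1:]) \<le> (\<Sum>l\<in>{1..k} - {i + 1}. degree [:real l, 1:])"
      using degree_prod_sum_le[of "{1..k} - {i + 1}" "\<lambda>l. [:real l, 1:]"] by (simp add: o_def)
    also have "\<dots> = k - 1" using assms by (simp add: card_Diff_singleton)
    finally have deg: "degree q < k" using assms unfolding q_def
      by (metis (no_types, lifting) One_nat_def Suc_pred degree_smult_le le_imp_less_Suc le_trans less_nat_zero_code not_gr0)
    have "real ((k + j) choose j) / (real (i + j) + 1) = poly q (real j)" for j
    proof -
      have "real ((k + j) choose j) * fact k = pochhammer (real j + 1) k"
      proof -
        have "real ((k + j) choose j) = fact (k + j) / (fact j * fact k)"
          by (subst binomial_fact) auto
        moreover have "pochhammer (1::real) (j + k) = pochhammer 1 j * pochhammer (1 + real j) k"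
          by (rule pochhammer_product')
        ultimately show ?thesis by (simp add: pochhammer_fact[symmetric] field_simps add.commute)
      qed
      also have "\<dots> = (\<Prod>l=1..k. real j + real l)"
        unfolding pochhammer_prod by (rule prod.reindex_bij_witness[of _ "\<lambda>l. l - 1" Suc]) auto
      also have "\<dots> = (real j + real (i + 1)) * (\<Prod>l\<in>{1..k} - {i + 1}. real j + real l)"
        using assms by (intro prod.remove) auto
      also have "(\<Prod>l\<in>{1..k} - {i + 1}. real j + real l) = fact k * poly q (real j)"
        by (simp add: q_def poly_prod add.commute)
      finally have "fact k * real ((k + j) choose j) = fact k * ((real (i + j) + 1) * poly q (real j))"
        by (simp add: algebra_simps)
      then have "real ((k + j) choose j) = (real (i + j) + 1) * poly q (real j)"
        by (metis fact_nonzero mult_cancel_left)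
      moreover have "real (i + j) + 1 \<noteq> 0" by linarith
      ultimately show ?thesis by simp
    qed
    moreover have "leg_coeff k j * (h / (real (i + j) + 1))
      = h * (-1) ^ k * ((-1) ^ j * real (k choose j) * (real ((k + j) choose j) / (real (i + j) + 1)))" for j
      unfolding leg_coeff_def by simp
    ultimately have "leg_coeff k j * (h / (real (i + j) + 1))
      = h * (-1) ^ k * ((-1) ^ j * real (k choose j) * poly q (real j))" for j
      by simp
    then have "(\<Sum>j\<le>k. leg_coeff k j * (h / (real (i + j) + 1)))
      = h * (-1) ^ k * (\<Sum>j\<le>k. (-1) ^ j * real (k choose j) * poly q (real j))"
      by (simp only: sum_distrib_left)
    then show ?thesis using alternating_binomial_poly[OF deg] by simp
  qed
  moreover have "(\<Sum>j\<le>k. leg_coeff k j * ((\<tau> + h) / h) ^ (i + j)) = ((\<tau> + h) / h) ^ i * legendre h k \<tau>" for \<tau>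
    unfolding legendre_eq sum_distrib_left power_add by (simp add: mult_ac)
  ultimately show ?thesis by simp
qed

lemma legendre_orthogonal_less:
  assumes "h > 0" "j < k"
  shows "((\<lambda>\<tau>. legendre h j \<tau> * legendre h k \<tau>) has_integral 0) {-h..0}"
proof -
  have "((\<lambda>\<tau>. \<Sum>i\<le>j. leg_coeff j i * (((\<tau> + h) / h) ^ i * legendre h k \<tau>)) has_integral
     (\<Sum>i\<le>j. leg_coeff j i * 0)) {-h..0}"
    using assms by (intro has_integral_sum has_integral_mult_right legendre_orthogonal_power) auto
  moreover have "(\<Sum>i\<le>j. leg_coeff j i * (((\<tau> + h) / h) ^ i * legendre h k \<tau>)) = legendre h j \<tau> * legendre h k \<tau>" for \<tau>
    by (subst (2) legendre_eq) (simp add: sum_distrib_right mult.assoc)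
  ultimately show ?thesis by simp
qed

text \<open>The value \<open>h / (2 k + 1)\<close> comes from integrating the derivative of
  \<open>(\<tau> + h) / h * (legendre h k \<tau>)\<^sup>2\<close>: up to terms of lower degree, which are orthogonal
  to \<open>legendre h k\<close>, the operator \<open>(\<tau> + h) d/d\<tau>\<close> acts on it as multiplication by \<open>k\<close>.\<close>

lemma legendre_square:
  assumes h: "h > 0"
  shows "((\<lambda>\<tau>. legendre h k \<tau> * legendre h k \<tau>) has_integral h / (2 * real k + 1)) {-h..0}"
proof -
  define l where "l = legendre h k"
  define dl where "dl \<tau> = (\<Sum>j\<le>k. leg_coeff k j * (real j * ((\<tau> + h) / h) ^ (j - 1) * (1 / h)))" for \<tau>
  define I where "I = integral {-h..0} (\<lambda>\<tau>. l \<tau> * l \<tau>)"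
  have cl: "continuous_on {-h..0} l" unfolding l_def using h by (intro continuous_intros) auto
  have I: "((\<lambda>\<tau>. l \<tau> * l \<tau>) has_integral I) {-h..0}"
    unfolding I_def by (intro integrable_integral integrable_continuous_real continuous_intros cl)
  have dl: "(l has_real_derivative dl \<tau>) (at \<tau> within {-h..0})" for \<tau>
  proof -
    have "((\<lambda>\<tau>. \<Sum>j\<le>k. leg_coeff k j * ((\<tau> + h) / h) ^ j) has_real_derivative
       (\<Sum>j\<le>k. leg_coeff k j * (real j * (1 / h * ((\<tau> + h) / h) ^ (j - Suc 0))))) (at \<tau> within {-h..0})"
      using h by (intro DERIV_sum DERIV_cmult DERIV_power) (auto intro!: derivative_eq_intros)
    then show ?thesis by (simp add: l_def legendre_eq[abs_def] dl_def mult_ac)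
  qed
  have "((\<lambda>\<tau>. 1 / h * (l \<tau> * l \<tau>) + (\<tau> + h) / h * (2 * l \<tau> * dl \<tau>)) has_integral
     (0 + h) / h * (l 0 * l 0) - (-h + h) / h * (l (-h) * l (-h))) {-h..0}"
  proof (rule fundamental_theorem_of_calculus)
    fix x
    show "((\<lambda>\<tau>. (\<tau> + h) / h * (l \<tau> * l \<tau>)) has_vector_derivative
       1 / h * (l x * l x) + (x + h) / h * (2 * l x * dl x)) (at x within {-h..0})"
      unfolding has_real_derivative_iff_has_vector_derivative[symmetric]
      using h by (auto intro!: derivative_eq_intros dl simp: field_simps)
  qed (use h in auto)
  then have 1: "((\<lambda>\<tau>. 1 / h * (l \<tau> * l \<tau>) + (\<tau> + h) / h * (2 * l \<tau> * dl \<tau>)) has_integral 1) {-h..0}"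
    using h by (simp add: l_def legendre_0)
  have split: "(\<tau> + h) * dl \<tau> = real k * l \<tau> + (\<Sum>j<k. ((real j - real k) * leg_coeff k j) * ((\<tau> + h) / h) ^ j)" for \<tau>
  proof -
    have "(\<tau> + h) * dl \<tau> = (\<Sum>j\<le>k. real j * (leg_coeff k j * ((\<tau> + h) / h) ^ j))"
      unfolding dl_def sum_distrib_left
    proof (rule sum.cong)
      fix j
      show "(\<tau> + h) * (leg_coeff k j * (real j * ((\<tau> + h) / h) ^ (j - 1) * (1 / h)))
         = real j * (leg_coeff k j * ((\<tau> + h) / h) ^ j)"
        by (cases j) simp_all
    qed simp
    also have "\<dots> = (\<Sum>j\<le>k. real k * (leg_coeff k j * ((\<tau> + h) / h) ^ j))
       + (\<Sum>j\<le>k. ((real j - real k) * leg_coeff k j) * ((\<tau> + h) / h) ^ j)"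
      by (simp add: sum.distrib[symmetric] algebra_simps)
    also have "(\<Sum>j\<le>k. ((real j - real k) * leg_coeff k j) * ((\<tau> + h) / h) ^ j)
       = (\<Sum>j<k. ((real j - real k) * leg_coeff k j) * ((\<tau> + h) / h) ^ j)"
      by (simp add: lessThan_Suc_atMost[symmetric])
    finally show ?thesis by (simp add: l_def legendre_eq sum_distrib_left)
  qed
  have low: "((\<lambda>\<tau>. \<Sum>j<k. ((real j - real k) * leg_coeff k j) * (((\<tau> + h) / h) ^ j * l \<tau>)) has_integral
      (\<Sum>j<k. ((real j - real k) * leg_coeff k j) * 0)) {-h..0}"
    unfolding l_def using h by (intro has_integral_sum has_integral_mult_right legendre_orthogonal_power) auto
  have "((\<lambda>\<tau>. 1 / h * (l \<tau> * l \<tau>) + 2 / h * (real k * (l \<tau> * l \<tau>) +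
      (\<Sum>j<k. ((real j - real k) * leg_coeff k j) * (((\<tau> + h) / h) ^ j * l \<tau>)))) has_integral
      1 / h * I + 2 / h * (real k * I + (\<Sum>j<k. ((real j - real k) * leg_coeff k j) * 0))) {-h..0}"
    by (intro has_integral_add has_integral_mult_right I low)
  moreover have "1 / h * (l \<tau> * l \<tau>) + 2 / h * (real k * (l \<tau> * l \<tau>) +
      (\<Sum>j<k. ((real j - real k) * leg_coeff k j) * (((\<tau> + h) / h) ^ j * l \<tau>)))
     = 1 / h * (l \<tau> * l \<tau>) + (\<tau> + h) / h * (2 * l \<tau> * dl \<tau>)" for \<tau>
  proof -
    have "real k * (l \<tau> * l \<tau>) +
      (\<Sum>j<k. ((real j - real k) * leg_coeff k j) * (((\<tau> + h) / h) ^ j * l \<tau>)) = l \<tau> * ((\<tau> + h) * dl \<tau>)"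
      unfolding split by (simp add: distrib_left sum_distrib_left mult_ac)
    then show ?thesis by simp
  qed
  ultimately have "((\<lambda>\<tau>. 1 / h * (l \<tau> * l \<tau>) + (\<tau> + h) / h * (2 * l \<tau> * dl \<tau>)) has_integral
     1 / h * I + 2 / h * (real k * I)) {-h..0}"
    by (simp only: mult_zero_right sum.neutral_const add_0_right)
  from has_integral_unique[OF this 1] have "I = h / (2 * real k + 1)"
    using h by (simp add: field_simps)
  then show ?thesis using I by (simp add: l_def)
qed

lemma legendre_orthogonal:
  assumes "h > 0"
  shows "((\<lambda>\<tau>. legendre h j \<tau> * legendre h k \<tau>) has_integral
    (if j = k then h / (2 * real k + 1) else 0)) {-h..0}"
proof (cases j k rule: linorder_cases)
  case equal
  then show ?thesis using legendre_square[OF assms, of k] by simp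
next
  case greater
  then show ?thesis using legendre_orthogonal_less[OF assms greater] by (simp add: mult.commute[of "legendre h j _"])
qed (use legendre_orthogonal_less[OF assms, of j k] in simp)

text \<open>Interpolation produces powers, the matrix refers to Legendre coefficients. The leading
  coefficient of \<open>legendre h n\<close> is nonzero, so the top power can be exchanged for it;
  the correction is absorbed in the lower coefficients \<open>d'\<close>.\<close>

lemma legendre_span:
  fixes d :: "nat \<Rightarrow> 'a::real_vector"
  assumes "h > 0"
  shows "\<exists>c. \<forall>\<tau>. (\<Sum>i<n. ((\<tau> + h) / h) ^ i *\<^sub>R d i) = (\<Sum>k<n. legendre h k \<tau> *\<^sub>R c k)"
proof (induction n arbitrary: d)
  case (Suc n)
  define a where "a = leg_coeff n n"
  have a: "a \<noteq> 0" by (simp add: a_def leg_coeff_def)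
  define d' where "d' i = d i - (leg_coeff n i / a) *\<^sub>R d n" for i
  obtain c where c: "\<And>\<tau>. (\<Sum>i<n. ((\<tau> + h) / h) ^ i *\<^sub>R d' i) = (\<Sum>k<n. legendre h k \<tau> *\<^sub>R c k)"
    using Suc.IH[of d'] by blast
  have "(\<Sum>i<Suc n. ((\<tau> + h) / h) ^ i *\<^sub>R d i) = (\<Sum>k<Suc n. legendre h k \<tau> *\<^sub>R (c(n := (1 / a) *\<^sub>R d n)) k)" for \<tau>
  proof -
    let ?s = "(\<tau> + h) / h"
    have "legendre h n \<tau> = (\<Sum>i<n. leg_coeff n i * ?s ^ i) + a * ?s ^ n"
      unfolding legendre_eq a_def lessThan_Suc_atMost[symmetric] by simp
    then have sn: "?s ^ n = (1 / a) * legendre h n \<tau> - (\<Sum>i<n. (leg_coeff n i / a) * ?s ^ i)"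
      using a by (simp add: field_simps sum_distrib_left sum_divide_distrib)
    have "(\<Sum>i<n. ?s ^ i *\<^sub>R d' i) = (\<Sum>i<n. ?s ^ i *\<^sub>R d i) - (\<Sum>i<n. (leg_coeff n i / a) * ?s ^ i) *\<^sub>R d n"
      by (simp add: d'_def algebra_simps sum_subtractf scaleR_sum_left)
    then have "(\<Sum>i<Suc n. ?s ^ i *\<^sub>R d i) = (\<Sum>i<n. ?s ^ i *\<^sub>R d' i) + (1 / a * legendre h n \<tau>) *\<^sub>R d n"
      by (simp add: sn algebra_simps)
    also have "\<dots> = (\<Sum>k<n. legendre h k \<tau> *\<^sub>R c k) + legendre h n \<tau> *\<^sub>R ((1 / a) *\<^sub>R d n)"
      by (simp add: c mult.commute)
    finally show ?thesis by simp
  qed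
  then show ?case by blast
qed simp

lemma legendre_integrable:
  fixes f :: "real \<Rightarrow> 'a::banach"
  assumes "h > 0" "continuous_on {-h..0} f"
  shows "(\<lambda>\<tau>. legendre h k \<tau> *\<^sub>R f \<tau>) integrable_on {-h..0}"
  using assms by (intro integrable_continuous_real continuous_intros) auto

definition leg_sum :: "real \<Rightarrow> nat \<Rightarrow> (nat \<Rightarrow> 'a::real_vector) \<Rightarrow> real \<Rightarrow> 'a" where
  "leg_sum h n c \<tau> = (\<Sum>k<n. legendre h k \<tau> *\<^sub>R c k)"

lemma continuous_on_leg_sum:
  fixes c :: "nat \<Rightarrow> 'a::real_normed_vector"
  shows "h > 0 \<Longrightarrow> continuous_on S (leg_sum h n c)"
  unfolding leg_sum_def[abs_def] by (intro continuous_intros) auto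

lemma leg_sum_orthogonal:
  fixes f :: "real \<Rightarrow> 'a::euclidean_space"
  assumes h: "h > 0" and f: "continuous_on {-h..0} f"
  shows "((\<lambda>\<tau>. leg_sum h n c \<tau> \<bullet> f \<tau>) has_integral
    (\<Sum>k<n. c k \<bullet> integral {-h..0} (\<lambda>\<tau>. legendre h k \<tau> *\<^sub>R f \<tau>))) {-h..0}"
proof -
  have "((\<lambda>\<tau>. \<Sum>k<n. c k \<bullet> (legendre h k \<tau> *\<^sub>R f \<tau>)) has_integral
    (\<Sum>k<n. c k \<bullet> integral {-h..0} (\<lambda>\<tau>. legendre h k \<tau> *\<^sub>R f \<tau>))) {-h..0}"
    by (intro has_integral_sum has_integral_linear[OF _ bounded_linear_inner_right, unfolded o_def]
      integrable_integral legendre_integrable assms) auto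
  then show ?thesis by (simp add: leg_sum_def inner_sum_left)
qed

lemma legendre_leg_sum_integral:
  fixes c :: "nat \<Rightarrow> 'a::euclidean_space"
  assumes "h > 0" "k < n"
  shows "((\<lambda>\<tau>. legendre h k \<tau> *\<^sub>R leg_sum h n c \<tau>) has_integral (h / (2 * real k + 1)) *\<^sub>R c k) {-h..0}"
proof -
  have "((\<lambda>\<tau>. \<Sum>j<n. (legendre h k \<tau> * legendre h j \<tau>) *\<^sub>R c j) has_integral
     (\<Sum>j<n. (if k = j then h / (2 * real j + 1) else 0) *\<^sub>R c j)) {-h..0}"
    by (intro has_integral_sum has_integral_scaleR_left legendre_orthogonal assms) auto
  moreover have "(\<Sum>j<n. (if k = j then h / (2 * real j + 1) else 0) *\<^sub>R c j)
      = (\<Sum>j<n. if k = j then (h / (2 * real j + 1)) *\<^sub>R c j else 0)"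
    by (rule sum.cong) auto
  ultimately show ?thesis using assms by (simp add: leg_sum_def scaleR_sum_right)
qed

lemma leg_sum_norm_square:
  fixes c :: "nat \<Rightarrow> 'a::euclidean_space"
  assumes "h > 0"
  shows "((\<lambda>\<tau>. leg_sum h n c \<tau> \<bullet> leg_sum h n c \<tau>) has_integral
    (\<Sum>k<n. h / (2 * real k + 1) * (c k \<bullet> c k))) {-h..0}"
proof -
  have "(\<Sum>k<n. c k \<bullet> integral {-h..0} (\<lambda>\<tau>. legendre h k \<tau> *\<^sub>R leg_sum h n c \<tau>))
     = (\<Sum>k<n. h / (2 * real k + 1) * (c k \<bullet> c k))"
    by (rule sum.cong) (use assms in \<open>auto simp: integral_unique[OF legendre_leg_sum_integral]\<close>)
  then show ?thesis using leg_sum_orthogonal[OF assms continuous_on_leg_sum[OF assms], of n c n c] by simp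
qed

lemma leg_sum_diff: "leg_sum h n (\<lambda>k. c k - d k) \<tau> = leg_sum h n c \<tau> - leg_sum h n d \<tau>"
  by (simp add: leg_sum_def scaleR_diff_right sum_subtractf)

text \<open>The three properties serve the three parts of the functional that depend on the segment:
  orthogonality the single integral, the Pythagorean identity the squared norm, minimality the
  comparison with an interpolant. The last two are instances of one decomposition
  \<open>pyth\<close>.\<close>

lemma legendre_projection:
  fixes f :: "real \<Rightarrow> 'a::euclidean_space"
  assumes h: "h > 0" and f: "continuous_on {-h..0} f"
  obtains c where
    "\<And>d. ((\<lambda>\<tau>. leg_sum h n d \<tau> \<bullet> (f \<tau> - leg_sum h n c \<tau>)) has_integral 0) {-h..0}"
    "integral {-h..0} (\<lambda>\<tau>. f \<tau> \<bullet> f \<tau>) = integral {-h..0} (\<lambda>\<tau>. leg_sum h n c \<tau> \<bullet> leg_sum h n c \<tau>)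
       + integral {-h..0} (\<lambda>\<tau>. (f \<tau> - leg_sum h n c \<tau>) \<bullet> (f \<tau> - leg_sum h n c \<tau>))"
    "\<And>d. integral {-h..0} (\<lambda>\<tau>. (f \<tau> - leg_sum h n c \<tau>) \<bullet> (f \<tau> - leg_sum h n c \<tau>))
       \<le> integral {-h..0} (\<lambda>\<tau>. (f \<tau> - leg_sum h n d \<tau>) \<bullet> (f \<tau> - leg_sum h n d \<tau>))"
proof -
  \<comment> \<open>Legendre coefficients of \<open>f\<close>: the normalization is the inverse of
    the squared norm \<open>h / (2 * real k + 1)\<close> of \<open>legendre h k\<close>.\<close>
  define c where "c k = ((2 * real k + 1) / h) *\<^sub>R integral {-h..0} (\<lambda>\<tau>. legendre h k \<tau> *\<^sub>R f \<tau>)" for k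
  define g where "g \<tau> = f \<tau> - leg_sum h n c \<tau>" for \<tau>
  have g: "continuous_on {-h..0} g"
    unfolding g_def by (intro continuous_intros f continuous_on_leg_sum h)
  have orth: "integral {-h..0} (\<lambda>\<tau>. legendre h k \<tau> *\<^sub>R g \<tau>) = 0" if "k < n" for k
  proof -
    have "((\<lambda>\<tau>. legendre h k \<tau> *\<^sub>R f \<tau> - legendre h k \<tau> *\<^sub>R leg_sum h n c \<tau>) has_integral
       integral {-h..0} (\<lambda>\<tau>. legendre h k \<tau> *\<^sub>R f \<tau>) - (h / (2 * real k + 1)) *\<^sub>R c k) {-h..0}"
      by (intro has_integral_diff legendre_leg_sum_integral integrable_integral legendre_integrable h f that)
    moreover have "integral {-h..0} (\<lambda>\<tau>. legendre h k \<tau> *\<^sub>R f \<tau>) - (h / (2 * real k + 1)) *\<^sub>R c k = 0"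
    proof -
      have "2 * real k + 1 \<noteq> 0" using of_nat_0_le_iff[of k] by linarith
      then have "h / (2 * real k + 1) * ((2 * real k + 1) / h) = 1" using h by simp
      then show ?thesis unfolding c_def by (simp only: scaleR_scaleR) simp
    qed
    ultimately show ?thesis by (simp add: g_def scaleR_diff_right integral_unique)
  qed
  have orth': "((\<lambda>\<tau>. leg_sum h n d \<tau> \<bullet> g \<tau>) has_integral 0) {-h..0}" for d
    using leg_sum_orthogonal[OF h g, of n d] orth by simp
  have int: "((\<lambda>\<tau>. (u \<tau> \<bullet> v \<tau> :: real)) has_integral integral {-h..0} (\<lambda>\<tau>. u \<tau> \<bullet> v \<tau>)) {-h..0}"
    if "continuous_on {-h..0} u" "continuous_on {-h..0} v" for u v :: "real \<Rightarrow> 'a"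
    by (intro integrable_integral integrable_continuous_real continuous_intros that)
  have pyth: "integral {-h..0} (\<lambda>\<tau>. (f \<tau> - leg_sum h n d \<tau>) \<bullet> (f \<tau> - leg_sum h n d \<tau>))
    = integral {-h..0} (\<lambda>\<tau>. leg_sum h n (\<lambda>k. c k - d k) \<tau> \<bullet> leg_sum h n (\<lambda>k. c k - d k) \<tau>)
       + integral {-h..0} (\<lambda>\<tau>. g \<tau> \<bullet> g \<tau>)" for d
  proof -
    let ?e = "leg_sum h n (\<lambda>k. c k - d k)"
    have "((\<lambda>\<tau>. ?e \<tau> \<bullet> ?e \<tau> + g \<tau> \<bullet> g \<tau> + 2 * (?e \<tau> \<bullet> g \<tau>)) has_integral
       integral {-h..0} (\<lambda>\<tau>. ?e \<tau> \<bullet> ?e \<tau>) + integral {-h..0} (\<lambda>\<tau>. g \<tau> \<bullet> g \<tau>) + 2 * 0) {-h..0}"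
      by (intro has_integral_add has_integral_mult_right int orth' g continuous_on_leg_sum h)
    moreover have "?e \<tau> \<bullet> ?e \<tau> + g \<tau> \<bullet> g \<tau> + 2 * (?e \<tau> \<bullet> g \<tau>) = (f \<tau> - leg_sum h n d \<tau>) \<bullet> (f \<tau> - leg_sum h n d \<tau>)" for \<tau>
    proof -
      have "f \<tau> - leg_sum h n d \<tau> = ?e \<tau> + g \<tau>" by (simp add: g_def leg_sum_diff)
      then show ?thesis by (simp add: inner_add inner_commute)
    qed
    ultimately show ?thesis by (simp add: integral_unique)
  qed
  show thesis
  proof
    show "((\<lambda>\<tau>. leg_sum h n d \<tau> \<bullet> (f \<tau> - leg_sum h n c \<tau>)) has_integral 0) {-h..0}" for d
      using orth'[of d] by (simp add: g_def)
    show "integral {-h..0} (\<lambda>\<tau>. f \<tau> \<bullet> f \<tau>) = integral {-h..0} (\<lambda>\<tau>. leg_sum h n c \<tau> \<bullet> leg_sum h n c \<tau>)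
       + integral {-h..0} (\<lambda>\<tau>. (f \<tau> - leg_sum h n c \<tau>) \<bullet> (f \<tau> - leg_sum h n c \<tau>))"
      using pyth[of "\<lambda>_. 0"] by (simp add: leg_sum_def g_def)
    show "integral {-h..0} (\<lambda>\<tau>. (f \<tau> - leg_sum h n c \<tau>) \<bullet> (f \<tau> - leg_sum h n c \<tau>))
       \<le> integral {-h..0} (\<lambda>\<tau>. (f \<tau> - leg_sum h n d \<tau>) \<bullet> (f \<tau> - leg_sum h n d \<tau>))" for d
      unfolding pyth[of d] g_def[symmetric]
      by (simp add: integral_nonneg integrable_continuous_real continuous_intros continuous_on_leg_sum h)
  qed
qed

section \<open>Polynomial interpolation\<close>

text \<open>\<open>F k\<close> plays the role of the \<open>k\<close>-th derivative. The values are
  vectors, so the remainder formula with an intermediate point fails; instead the nodes are split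
  off one at a time, each contributing a factor \<open>s - a i\<close>, and the difference quotient
  is written as an integral.\<close>

lemma newton_interpolation:
  fixes F :: "nat \<Rightarrow> real \<Rightarrow> 'a::banach"
  assumes "\<And>k s. k < n \<Longrightarrow> s \<in> {0..1} \<Longrightarrow> (F k has_vector_derivative F (Suc k) s) (at s within {0..1})"
    and "continuous_on {0..1} (F n)" and "\<And>s. s \<in> {0..1} \<Longrightarrow> norm (F n s) \<le> B"
    and "\<And>i. i < n \<Longrightarrow> a i \<in> {0..1}"
  shows "\<exists>d. \<forall>s\<in>{0..1}. norm (F 0 s - (\<Sum>i<n. s ^ i *\<^sub>R d i)) \<le> B / fact n * \<bar>\<Prod>i<n. s - a i\<bar>"
  using assms
proof (induction n arbitrary: F B)
  case (Suc n)
  note der = Suc.prems(1) and bound = Suc.prems(3)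
  define c where "c = a n"
  have c: "c \<in> {0..1}" unfolding c_def using Suc.prems(4)[of n] by simp
  have mem: "c + u * (s - c) \<in> {0..1}" if "u \<in> {0..1}" "s \<in> {0..1}" for u s
  proof -
    have "c + u * (s - c) = (1 - u) * c + u * s" by (simp add: algebra_simps)
    moreover have "(1 - u) * c + u * s \<le> (1 - u) * 1 + u * 1"
      using that c by (intro add_mono mult_left_mono) auto
    ultimately show ?thesis using that c by auto
  qed
  have cont: "continuous_on {0..1} (F k)" if "k \<le> Suc n" for k
  proof (cases "k = Suc n")
    case False
    then show ?thesis using that der[of k]
      by (intro continuous_on_vector_derivative) auto
  qed (use Suc.prems(2) in auto)
  have cont2: "continuous_on ({0..1} \<times> {0..1}) (\<lambda>(s, u). u ^ j *\<^sub>R F k (c + u * (s - c)))" if "k \<le> Suc n" for j k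
    unfolding case_prod_beta
    by (intro continuous_intros continuous_on_compose2[OF cont[OF that]])
      (use mem in \<open>auto intro!: continuous_intros\<close>)
  have cont1: "continuous_on {0..1} (\<lambda>u. u ^ j *\<^sub>R F k (c + u * (s - c)))" if "k \<le> Suc n" "s \<in> {0..1}" for j k s
    by (intro continuous_intros continuous_on_compose2[OF cont[OF that(1)]])
      (use mem that in \<open>auto intro!: continuous_intros\<close>)
  \<comment> \<open>\<open>D 0\<close> is the difference quotient of \<open>F 0\<close> at the node
    \<open>c\<close>, as the mean of \<open>F 1\<close> over the segment from \<open>c\<close> to
    \<open>s\<close>; \<open>D k\<close> is its \<open>k\<close>-th derivative, with
    \<open>u ^ k\<close> coming from the chain rule.\<close>
  define D where "D k s = integral {0..1} (\<lambda>u. u ^ k *\<^sub>R F (Suc k) (c + u * (s - c)))" for k s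
  have "\<exists>d. \<forall>s\<in>{0..1}. norm (D 0 s - (\<Sum>i<n. s ^ i *\<^sub>R d i)) \<le> (B / (real n + 1)) / fact n * \<bar>\<Prod>i<n. s - a i\<bar>"
  proof (rule Suc.IH)
    fix k s assume k: "k < n" and s: "s \<in> {0..1::real}"
    have "((\<lambda>s. integral (cbox 0 1) (\<lambda>u. u ^ k *\<^sub>R F (Suc k) (c + u * (s - c)))) has_vector_derivative
       integral (cbox 0 1) (\<lambda>u. u ^ Suc k *\<^sub>R F (Suc (Suc k)) (c + u * (s - c)))) (at s within {0..1})"
    proof (rule leibniz_rule_vector_derivative)
      fix s u :: real assume s: "s \<in> {0..1}" and u: "u \<in> cbox 0 1"
      have 1: "((\<lambda>s. c + u * (s - c)) has_vector_derivative u) (at s within {0..1})"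
        unfolding has_real_derivative_iff_has_vector_derivative[symmetric]
        by (auto intro!: derivative_eq_intros)
      have 2: "(F (Suc k) has_vector_derivative F (Suc (Suc k)) (c + u * (s - c)))
          (at (c + u * (s - c)) within (\<lambda>s. c + u * (s - c)) ` {0..1})"
        by (rule has_vector_derivative_within_subset[OF der]) (use k mem u s in \<open>auto simp del: atLeastAtMost_iff\<close>)
      have "((\<lambda>s. F (Suc k) (c + u * (s - c))) has_vector_derivative u *\<^sub>R F (Suc (Suc k)) (c + u * (s - c)))
          (at s within {0..1})"
        using vector_diff_chain_within[OF 1 2] by (simp add: o_def)
      from has_vector_derivative_scaleR[OF DERIV_const this, of "u ^ k"]
      show "((\<lambda>s. u ^ k *\<^sub>R F (Suc k) (c + u * (s - c))) has_vector_derivative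
         u ^ Suc k *\<^sub>R F (Suc (Suc k)) (c + u * (s - c))) (at s within {0..1})" by (simp add: mult.commute)
    next
      show "(\<lambda>u. u ^ k *\<^sub>R F (Suc k) (c + u * (s - c))) integrable_on cbox 0 1" if "s \<in> {0..1}" for s
        using cont1[of "Suc k" s k] k that by (simp add: integrable_continuous_real)
      show "continuous_on ({0..1} \<times> cbox 0 1) (\<lambda>(s, u). u ^ Suc k *\<^sub>R F (Suc (Suc k)) (c + u * (s - c)))"
        using cont2[of "Suc (Suc k)" "Suc k"] k by simp
    qed (use s in auto)
    then show "(D k has_vector_derivative D (Suc k) s) (at s within {0..1})"
      unfolding D_def[abs_def] by simp
  next
    show "continuous_on {0..1} (D n)"
      unfolding D_def[abs_def] using integral_continuous_on_param[of "{0..1}" 0 1 "\<lambda>s u. u ^ n *\<^sub>R F (Suc n) (c + u * (s - c))"] cont2[of "Suc n" n] by simp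
  next
    fix s :: real assume s: "s \<in> {0..1}"
    \<comment> \<open>The integral of \<open>u ^ n\<close> lowers the derivative bound to
      \<open>B / (n + 1)\<close>, which turns \<open>fact n\<close> into
      \<open>fact (Suc n)\<close>.\<close>
    have "((\<lambda>u::real. u ^ n) has_integral 1 ^ Suc n / (real n + 1) - 0 ^ Suc n / (real n + 1)) {0..1}"
    proof (rule fundamental_theorem_of_calculus)
      fix u :: real
      have "((\<lambda>u. u ^ Suc n / (real n + 1)) has_real_derivative real (Suc n) * (1 * u ^ (Suc n - Suc 0)) / (real n + 1)) (at u within {0..1})"
        by (intro DERIV_cdivide DERIV_power DERIV_ident)
      moreover have "real (Suc n) * (1 * u ^ (Suc n - Suc 0)) / (real n + 1) = u ^ n" by (simp add: add.commute)
      ultimately show "((\<lambda>u. u ^ Suc n / (real n + 1)) has_vector_derivative u ^ n) (at u within {0..1})"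
        by (simp add: has_real_derivative_iff_has_vector_derivative)
    qed simp
    from has_integral_mult_left[OF this, of B]
    have "((\<lambda>u::real. u ^ n * B) has_integral (1 / (real n + 1)) * B) {0..1}" by simp
    note int_B = this
    have "norm (D n s) \<le> integral {0..1} (\<lambda>u. u ^ n * B)"
      unfolding D_def
    proof (rule integral_norm_bound_integral)
      show "(\<lambda>u. u ^ n *\<^sub>R F (Suc n) (c + u * (s - c))) integrable_on {0..1}"
        using cont1[of "Suc n" s n] s by (simp add: integrable_continuous_real)
      show "norm (u ^ n *\<^sub>R F (Suc n) (c + u * (s - c))) \<le> u ^ n * B" if "u \<in> {0..1}" for u
        using bound[OF mem[OF that s]] that by (simp add: mult_left_mono)
    qed (use int_B in \<open>auto simp: has_integral_iff\<close>)
    then show "norm (D n s) \<le> B / (real n + 1)" unfolding integral_unique[OF int_B] by simp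
  next
    show "a i \<in> {0..1}" if "i < n" for i using Suc.prems(4)[of i] that by simp
  qed
  then obtain d where d: "\<And>s. s \<in> {0..1} \<Longrightarrow>
     norm (D 0 s - (\<Sum>i<n. s ^ i *\<^sub>R d i)) \<le> (B / (real n + 1)) / fact n * \<bar>\<Prod>i<n. s - a i\<bar>"
    by blast
  \<comment> \<open>Power coefficients of the polynomial \<open>F 0 c + (s - c) * p\<close>, where
    \<open>p\<close> has the coefficients \<open>d\<close>.\<close>
  define e where "e i = (if i = 0 then F 0 c else d (i - 1)) - (if i < n then c *\<^sub>R d i else 0)" for i
  have F0: "F 0 s = F 0 c + (s - c) *\<^sub>R D 0 s" if s: "s \<in> {0..1}" for s
  proof -
    have "((\<lambda>u. (s - c) *\<^sub>R F 1 (c + u * (s - c))) has_integral F 0 (c + 1 * (s - c)) - F 0 (c + 0 * (s - c))) {0..1}"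
    proof (rule fundamental_theorem_of_calculus)
      fix u :: real assume u: "u \<in> {0..1}"
      have 1: "((\<lambda>u. c + u * (s - c)) has_vector_derivative (s - c)) (at u within {0..1})"
        unfolding has_real_derivative_iff_has_vector_derivative[symmetric]
        by (auto intro!: derivative_eq_intros)
      have 2: "(F 0 has_vector_derivative F 1 (c + u * (s - c)))
          (at (c + u * (s - c)) within (\<lambda>u. c + u * (s - c)) ` {0..1})"
        unfolding One_nat_def by (rule has_vector_derivative_within_subset[OF der])
          (use mem u s in \<open>auto simp del: atLeastAtMost_iff\<close>)
      show "((\<lambda>u. F 0 (c + u * (s - c))) has_vector_derivative (s - c) *\<^sub>R F 1 (c + u * (s - c))) (at u within {0..1})"
        using vector_diff_chain_within[OF 1 2] by (simp add: o_def)
    qed auto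
    then have "integral {0..1} (\<lambda>u. (s - c) *\<^sub>R F 1 (c + u * (s - c))) = F 0 s - F 0 c"
      by (intro integral_unique) simp
    then show ?thesis by (simp add: D_def)
  qed
  have e: "(\<Sum>i<Suc n. s ^ i *\<^sub>R e i) = F 0 c + (s - c) *\<^sub>R (\<Sum>i<n. s ^ i *\<^sub>R d i)" for s
  proof -
    have "(\<Sum>i<Suc n. s ^ i *\<^sub>R e i) = (\<Sum>i<Suc n. s ^ i *\<^sub>R (if i = 0 then F 0 c else d (i - 1)))
       - (\<Sum>i<Suc n. s ^ i *\<^sub>R (if i < n then c *\<^sub>R d i else 0))"
      by (simp add: e_def algebra_simps sum_subtractf)
    also have "(\<Sum>i<Suc n. s ^ i *\<^sub>R (if i = 0 then F 0 c else d (i - 1))) = F 0 c + s *\<^sub>R (\<Sum>i<n. s ^ i *\<^sub>R d i)"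
      by (subst sum.lessThan_Suc_shift) (simp add: scaleR_sum_right)
    also have "(\<Sum>i<Suc n. s ^ i *\<^sub>R (if i < n then c *\<^sub>R d i else 0)) = c *\<^sub>R (\<Sum>i<n. s ^ i *\<^sub>R d i)"
      by (simp add: scaleR_sum_right mult.commute)
    finally show ?thesis by (simp add: algebra_simps)
  qed
  have "norm (F 0 s - (\<Sum>i<Suc n. s ^ i *\<^sub>R e i)) \<le> B / fact (Suc n) * \<bar>\<Prod>i<Suc n. s - a i\<bar>" if s: "s \<in> {0..1}" for s
  proof -
    have "F 0 s - (\<Sum>i<Suc n. s ^ i *\<^sub>R e i) = (s - c) *\<^sub>R (D 0 s - (\<Sum>i<n. s ^ i *\<^sub>R d i))"
      unfolding e F0[OF s] by (simp add: algebra_simps)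
    then have "norm (F 0 s - (\<Sum>i<Suc n. s ^ i *\<^sub>R e i)) = \<bar>s - c\<bar> * norm (D 0 s - (\<Sum>i<n. s ^ i *\<^sub>R d i))"
      by (simp only: norm_scaleR)
    also have "\<dots> \<le> \<bar>s - c\<bar> * ((B / (real n + 1)) / fact n * \<bar>\<Prod>i<n. s - a i\<bar>)"
      by (rule mult_left_mono[OF d[OF s] abs_ge_zero])
    also have "\<dots> = B / fact (Suc n) * \<bar>\<Prod>i<Suc n. s - a i\<bar>"
      by (simp add: c_def abs_mult add.commute mult_ac)
    finally show ?thesis .
  qed
  then show ?case by blast
qed simp

section \<open>Chebyshev polynomials and their zeros as interpolation nodes\<close>

fun cheb :: "nat \<Rightarrow> real poly" where
  "cheb 0 = 1"
| "cheb (Suc 0) = [:0, 1:]"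
| "cheb (Suc (Suc n)) = [:0, 2:] * cheb (Suc n) - cheb n"

lemma poly_cheb_cos: "poly (cheb n) (cos t) = cos (real n * t)"
proof (induction n rule: cheb.induct)
  case (3 n)
  have "cos (real (Suc n) * t + t) + cos (real (Suc n) * t - t) = 2 * cos (real (Suc n) * t) * cos t"
    by (simp add: cos_add cos_diff)
  moreover have "real (Suc n) * t + t = real (Suc (Suc n)) * t" "real (Suc n) * t - t = real n * t"
    by (simp_all add: algebra_simps)
  ultimately show ?case using 3 by (simp add: algebra_simps)
qed auto

lemma degree_cheb_le: "degree (cheb n) \<le> n"
proof (induction n rule: cheb.induct)
  case (3 n)
  have "degree ([:0, 2:] * cheb (Suc n)) \<le> Suc (Suc n)"
    using degree_mult_le[of "[:0, 2::real:]" "cheb (Suc n)"] 3 by simp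
  then show ?case using 3 by (auto intro!: degree_diff_le)
qed auto

lemma coeff_cheb: "coeff (cheb (Suc n)) (Suc n) = 2 ^ n"
proof (induction n)
  case (Suc n)
  have "coeff (cheb n) (Suc (Suc n)) = 0" using degree_cheb_le[of n] by (intro coeff_eq_0) simp
  then show ?case using Suc by simp
qed simp

text \<open>The nodes are the zeros of the Chebyshev polynomial of degree \<open>n\<close>, moved to \<open>[0, 1]\<close>.\<close>

lemma chebyshev_nodes:
  assumes n: "n > 0"
  shows "\<exists>a. (\<forall>i<n. a i \<in> {0..1}) \<and> (\<forall>s\<in>{0..1}. \<bar>\<Prod>i<n. s - a i\<bar> \<le> 2 * (1 / 4 :: real) ^ n)"
proof -
  define \<theta> where "\<theta> i = (2 * real i + 1) * pi / (2 * real n)" for i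
  define x where "x i = cos (\<theta> i)" for i
  have \<theta>: "0 \<le> \<theta> i \<and> \<theta> i \<le> pi" if "i < n" for i
  proof -
    have "(2 * real i + 1) * pi \<le> (2 * real n) * pi" using that by (intro mult_right_mono) auto
    then show ?thesis using n by (simp add: \<theta>_def field_simps)
  qed
  have inj: "inj_on x {..<n}"
  proof (rule inj_onI)
    fix i j assume ij: "i \<in> {..<n}" "j \<in> {..<n}" "x i = x j"
    then have "\<theta> i = \<theta> j" using \<theta>[of i] \<theta>[of j] cos_inj_pi[of "\<theta> i" "\<theta> j"] by (auto simp: x_def)
    then show "i = j" using n by (simp add: \<theta>_def)
  qed
  define P where "P = (\<Prod>i<n. [:- x i, 1:])"
  obtain m where m: "n = Suc m" using n by (cases n) auto
  have degP: "degree P = n" unfolding P_def by (subst degree_prod_eq_sum_degree) auto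
  have leadP: "coeff P n = 1" using lead_coeff_prod[of "\<lambda>i. [:- x i, 1:]" "{..<n}"] degP by (simp add: P_def)
  define q where "q = cheb n - smult (2 ^ m) P"
  have root: "poly q (x i) = 0" if "i < n" for i
  proof -
    have "real n * \<theta> i = pi / 2 + real i * pi" using n by (simp add: \<theta>_def field_simps)
    then have "poly (cheb n) (x i) = 0" by (simp add: x_def poly_cheb_cos cos_add)
    moreover have "poly P (x i) = 0" unfolding P_def poly_prod using that by auto
    ultimately show ?thesis by (simp add: q_def)
  qed
  \<comment> \<open>The leading terms cancel, so \<open>q\<close> would have degree less than
    \<open>n\<close> but vanishes at the \<open>n\<close> distinct points
    \<open>x i\<close>.\<close>
  have "q = 0"
  proof (rule ccontr)
    assume "q \<noteq> 0"
    have "degree q \<le> n" unfolding q_def using degree_cheb_le[of n] degP by (intro degree_diff_le) auto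
    moreover have "coeff q n = 0" using leadP coeff_cheb[of m] by (simp add: q_def m)
    ultimately have "degree q < n" using \<open>q \<noteq> 0\<close> by (metis le_neq_implies_less leading_coeff_0_iff)
    moreover have "n = card (x ` {..<n})" using card_image[OF inj] by simp
    moreover have "card (x ` {..<n}) \<le> card {y. poly q y = 0}"
      using root poly_roots_finite[OF \<open>q \<noteq> 0\<close>] by (intro card_mono) auto
    moreover have "card {y. poly q y = 0} \<le> degree q" by (rule card_poly_roots_bound[OF \<open>q \<noteq> 0\<close>])
    ultimately show False by simp
  qed
  then have cheb_eq: "cheb n = smult (2 ^ m) P" by (simp add: q_def)
  define a where "a i = (1 + x i) / 2" for i
  have "a i \<in> {0..1}" for i
  proof -
    have "\<bar>x i\<bar> \<le> 1" unfolding x_def by (rule abs_cos_le_one)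
    then have "- 1 \<le> x i" "x i \<le> 1" by linarith+
    then show ?thesis by (auto simp: a_def)
  qed
  moreover have "\<bar>\<Prod>i<n. s - a i\<bar> \<le> 2 * (1 / 4 :: real) ^ n" if s: "s \<in> {0..1}" for s
  proof -
    have "\<bar>2 * s - 1\<bar> \<le> 1" using s by auto
    then obtain t where t: "2 * s - 1 = cos t" by (metis cos_arccos_abs)
    \<comment> \<open>Halving the interval contributes \<open>(1 / 2) ^ n\<close>, and the monic
      multiple of the Chebyshev polynomial is bounded by \<open>(1 / 2) ^ m\<close>, with
      \<open>n = Suc m\<close>.\<close>
    have "(\<Prod>i<n. s - a i) = (\<Prod>i<n. (1 / 2) * (cos t - x i))"
      using t by (intro prod.cong) (auto simp: a_def field_simps)
    also have "\<dots> = (1 / 2) ^ n * poly P (cos t)"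
      unfolding prod.distrib P_def poly_prod by simp
    finally have *: "(\<Prod>i<n. s - a i) = (1 / 2) ^ n * poly P (cos t)" .
    have "2 ^ m * \<bar>poly P (cos t)\<bar> = \<bar>poly (cheb n) (cos t)\<bar>" by (simp add: cheb_eq abs_mult)
    also have "\<dots> \<le> 1" by (simp add: poly_cheb_cos)
    finally have "\<bar>poly P (cos t)\<bar> \<le> (1 / 2) ^ m" by (simp add: field_simps power_one_over)
    then have "\<bar>\<Prod>i<n. s - a i\<bar> \<le> (1 / 2) ^ n * (1 / 2) ^ m" by (simp add: * abs_mult mult_left_mono)
    also have "\<dots> = 2 * ((1 / 2) * (1 / 2)) ^ n" unfolding power_mult_distrib by (simp add: m)
    finally show ?thesis by simp
  qed
  ultimately show ?thesis by blast
qed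

text \<open>Rescaling to \<open>[0, 1]\<close> multiplies the \<open>n\<close>-th derivative by
  \<open>h ^ n\<close>, and the Chebyshev nodes give \<open>2 * (1 / 4) ^ n\<close>. With
  \<open>B = 2 * r ^ n\<close> the bound reads \<open>4 * (\<mu> / 2) ^ n / fact n\<close>.\<close>

lemma polynomial_approximation:
  fixes F :: "nat \<Rightarrow> real \<Rightarrow> 'a::banach"
  assumes n: "n > 0" and h: "h > 0"
    and der: "\<And>k \<tau>. k < n \<Longrightarrow> \<tau> \<in> {-h..0} \<Longrightarrow> (F k has_vector_derivative F (Suc k) \<tau>) (at \<tau> within {-h..0})"
    and cont: "continuous_on {-h..0} (F n)" and bound: "\<And>\<tau>. \<tau> \<in> {-h..0} \<Longrightarrow> norm (F n \<tau>) \<le> B"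
  shows "\<exists>d. \<forall>\<tau>\<in>{-h..0}. norm (F 0 \<tau> - (\<Sum>i<n. ((\<tau> + h) / h) ^ i *\<^sub>R d i)) \<le> 2 * B * (h / 4) ^ n / fact n"
proof -
  obtain a where a: "\<And>i. i < n \<Longrightarrow> a i \<in> {0..1}"
      "\<And>s. s \<in> {0..1} \<Longrightarrow> \<bar>\<Prod>i<n. s - a i\<bar> \<le> 2 * (1 / 4 :: real) ^ n"
    using chebyshev_nodes[OF n] by blast
  have mem: "h * s - h \<in> {-h..0}" if "s \<in> {0..1}" for s
    using that h mult_left_le[of s h] by auto
  define E where "E k s = h ^ k *\<^sub>R F k (h * s - h)" for k s
  have "\<exists>d. \<forall>s\<in>{0..1}. norm (E 0 s - (\<Sum>i<n. s ^ i *\<^sub>R d i)) \<le> (h ^ n * B) / fact n * \<bar>\<Prod>i<n. s - a i\<bar>"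
  proof (rule newton_interpolation)
    fix k s assume k: "k < n" and s: "s \<in> {0..1::real}"
    have 1: "((\<lambda>s. h * s - h) has_vector_derivative h) (at s within {0..1})"
      unfolding has_real_derivative_iff_has_vector_derivative[symmetric] by (auto intro!: derivative_eq_intros)
    have 2: "(F k has_vector_derivative F (Suc k) (h * s - h)) (at (h * s - h) within (\<lambda>s. h * s - h) ` {0..1})"
      by (rule has_vector_derivative_within_subset[OF der]) (use k mem s in \<open>auto simp del: atLeastAtMost_iff\<close>)
    have "((\<lambda>s. F k (h * s - h)) has_vector_derivative h *\<^sub>R F (Suc k) (h * s - h)) (at s within {0..1})"
      using vector_diff_chain_within[OF 1 2] by (simp add: o_def)
    from has_vector_derivative_scaleR[OF DERIV_const this, of "h ^ k"]
    show "(E k has_vector_derivative E (Suc k) s) (at s within {0..1})"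
      unfolding E_def[abs_def] by (simp add: mult.commute)
  next
    show "continuous_on {0..1} (E n)" unfolding E_def[abs_def]
      by (intro continuous_intros continuous_on_compose2[OF cont]) (use mem in \<open>auto intro!: continuous_intros\<close>)
    show "norm (E n s) \<le> h ^ n * B" if "s \<in> {0..1}" for s
      using bound[OF mem[OF that]] h by (simp add: E_def mult_left_mono)
  qed (use a in auto)
  then obtain d where d: "\<And>s. s \<in> {0..1} \<Longrightarrow>
     norm (E 0 s - (\<Sum>i<n. s ^ i *\<^sub>R d i)) \<le> (h ^ n * B) / fact n * \<bar>\<Prod>i<n. s - a i\<bar>" by blast
  have B: "B \<ge> 0" using order_trans[OF norm_ge_zero bound[of 0]] h by simp
  have "norm (F 0 \<tau> - (\<Sum>i<n. ((\<tau> + h) / h) ^ i *\<^sub>R d i)) \<le> 2 * B * (h / 4) ^ n / fact n" if \<tau>: "\<tau> \<in> {-h..0}" for \<tau>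
  proof -
    have s: "(\<tau> + h) / h \<in> {0..1}" using \<tau> h by (auto simp: field_simps)
    have "E 0 ((\<tau> + h) / h) = F 0 \<tau>" using h by (simp add: E_def)
    then have "norm (F 0 \<tau> - (\<Sum>i<n. ((\<tau> + h) / h) ^ i *\<^sub>R d i)) \<le> (h ^ n * B) / fact n * \<bar>\<Prod>i<n. (\<tau> + h) / h - a i\<bar>"
      using d[OF s] by simp
    also have "\<dots> \<le> (h ^ n * B) / fact n * (2 * (1 / 4) ^ n)"
      using a(2)[OF s] h B by (intro mult_left_mono) auto
    also have "\<dots> = 2 * B * (h / 4) ^ n / fact n" by (simp add: power_divide mult_ac)
    finally show ?thesis .
  qed
  then show ?thesis by blast
qed

section \<open>Parametric integrals\<close>

lemma continuous_on_swap_args: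
  assumes "continuous_on (S \<times> T) (\<lambda>(s, t). F s t)"
  shows "continuous_on (T \<times> S) (\<lambda>(t, s). F s t)"
proof -
  have "continuous_on (T \<times> S) (\<lambda>p. (\<lambda>(s, t). F s t) (snd p, fst p))"
    by (rule continuous_on_compose2[OF assms]) (auto intro!: continuous_intros)
  then show ?thesis by (simp add: case_prod_beta)
qed

text \<open>Limit and parameter are first treated as independent variables. The function of two
  variables is differentiable, as one partial derivative exists and the other is continuous; then it
  is restricted to the diagonal.\<close>

lemma leibniz_variable_upper:
  fixes F F' :: "real \<Rightarrow> real \<Rightarrow> 'a::banach"
  assumes F: "continuous_on ({a..b} \<times> {a..b}) (\<lambda>(s, t). F s t)"
    and der: "\<And>s t. s \<in> {a..b} \<Longrightarrow> t \<in> {a..b} \<Longrightarrow> ((\<lambda>t. F s t) has_vector_derivative F' s t) (at t within {a..b})"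
    and F': "continuous_on ({a..b} \<times> {a..b}) (\<lambda>(s, t). F' s t)"
    and t: "t \<in> {a..b}"
  shows "((\<lambda>t. integral {a..t} (\<lambda>s. F s t)) has_vector_derivative
      (F t t + integral {a..t} (\<lambda>s. F' s t))) (at t within {a..b})"
proof -
  have Fs: "continuous_on {a..b} (\<lambda>s. F s t)" if "t \<in> {a..b}" for t
    using that by (intro continuous_on_compose2[OF F, of _ "\<lambda>s. (s, t)", simplified]) (auto intro!: continuous_intros)
  have swapc: "continuous_on ({a..b} \<times> {a..b}) (\<lambda>(t, s). F s t)" "continuous_on ({a..b} \<times> {a..b}) (\<lambda>(t, s). F' s t)"
    by (rule continuous_on_swap_args[OF F] continuous_on_swap_args[OF F'])+
  define f where "f t y = integral {a..y} (\<lambda>s. F s t)" for t y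
  have "((\<lambda>(t, y). f t y) has_derivative
      (\<lambda>(tx, ty). tx *\<^sub>R integral {a..t} (\<lambda>s. F' s t) + blinfun_apply (blinfun_scaleR_left (F t t)) ty))
      (at (t, t) within {a..b} \<times> {a..b})"
  proof (rule has_derivative_partialsI[where fy = "\<lambda>x y. blinfun_scaleR_left (F y x)"])
    have "((\<lambda>x. integral (cbox a t) (\<lambda>s. F s x)) has_vector_derivative integral (cbox a t) (\<lambda>s. F' s t)) (at t within {a..b})"
    proof (rule leibniz_rule_vector_derivative)
      show "((\<lambda>x. F s x) has_vector_derivative F' s x) (at x within {a..b})"
        if "x \<in> {a..b}" "s \<in> cbox a t" for x s using der that t by auto
      show "(\<lambda>s. F s x) integrable_on cbox a t" if "x \<in> {a..b}" for x
        using Fs[OF that] t by (auto intro!: integrable_continuous_real continuous_on_subset[of "{a..b}"])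
      show "continuous_on ({a..b} \<times> cbox a t) (\<lambda>(x, s). F' s x)"
        by (rule continuous_on_subset[OF swapc(2)]) (use t in auto)
    qed (use t in auto)
    then show "((\<lambda>x. f x t) has_derivative (\<lambda>tx. tx *\<^sub>R integral {a..t} (\<lambda>s. F' s t))) (at t within {a..b})"
      by (simp add: f_def has_vector_derivative_def)
  next
    fix x y assume x: "x \<in> {a..b}" and y: "y \<in> {a..b}"
    show "((\<lambda>y. f x y) has_derivative blinfun_apply (blinfun_scaleR_left (F y x))) (at y within {a..b})"
      unfolding f_def has_vector_derivative_eq_has_derivative_blinfun[symmetric]
      by (rule integral_has_vector_derivative[OF Fs[OF x] y])
  next
    show "continuous (at (t, t) within {a..b} \<times> {a..b}) (\<lambda>(x, y). blinfun_scaleR_left (F y x))"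
      using bounded_linear.continuous_on[OF bounded_linear_blinfun_scaleR_left swapc(1)] t
      by (auto simp: continuous_on_eq_continuous_within case_prod_unfold)
  qed (use t in auto)
  then have "((\<lambda>(t, y). f t y) has_derivative
      (\<lambda>(tx, ty). tx *\<^sub>R integral {a..t} (\<lambda>s. F' s t) + ty *\<^sub>R F t t))
      (at (t, t) within {a..b} \<times> {a..b})"
    by (simp add: blinfun_scaleR_left.rep_eq)
  then have D: "((\<lambda>(t, y). f t y) has_derivative
      (\<lambda>(tx, ty). tx *\<^sub>R integral {a..t} (\<lambda>s. F' s t) + ty *\<^sub>R F t t))
      (at (t, t) within (\<lambda>t. (t, t)) ` {a..b})"
    by (rule has_derivative_subset) auto
  have "((\<lambda>t. (t, t)) has_derivative (\<lambda>x. (x, x))) (at t within {a..b})"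
    by (intro has_derivative_Pair has_derivative_ident)
  from diff_chain_within[OF this D]
  show ?thesis by (simp add: has_vector_derivative_def f_def o_def algebra_simps)
qed

text \<open>Difference of an integral with fixed limits and the case of a variable upper
  limit.\<close>

lemma leibniz_variable_lower:
  fixes F F' :: "real \<Rightarrow> real \<Rightarrow> 'a::banach"
  assumes F: "continuous_on ({a..b} \<times> {a..b}) (\<lambda>(s, t). F s t)"
    and der: "\<And>s t. s \<in> {a..b} \<Longrightarrow> t \<in> {a..b} \<Longrightarrow> ((\<lambda>t. F s t) has_vector_derivative F' s t) (at t within {a..b})"
    and F': "continuous_on ({a..b} \<times> {a..b}) (\<lambda>(s, t). F' s t)"
    and t: "t \<in> {a..b}"
  shows "((\<lambda>t. integral {t..b} (\<lambda>s. F s t)) has_vector_derivative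
      (- F t t + integral {t..b} (\<lambda>s. F' s t))) (at t within {a..b})"
proof -
  have Fs: "continuous_on {a..b} (\<lambda>s. F s t)" if "t \<in> {a..b}" for t
    using that by (intro continuous_on_compose2[OF F, of _ "\<lambda>s. (s, t)", simplified]) (auto intro!: continuous_intros)
  have F's: "continuous_on {a..b} (\<lambda>s. F' s t)" if "t \<in> {a..b}" for t
    using that by (intro continuous_on_compose2[OF F', of _ "\<lambda>s. (s, t)", simplified]) (auto intro!: continuous_intros)
  have swapc: "continuous_on ({a..b} \<times> {a..b}) (\<lambda>(t, s). F' s t)"
    by (rule continuous_on_swap_args[OF F'])
  have "((\<lambda>x. integral (cbox a b) (\<lambda>s. F s x)) has_vector_derivative integral (cbox a b) (\<lambda>s. F' s t)) (at t within {a..b})"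
    by (rule leibniz_rule_vector_derivative) (use der Fs swapc t in \<open>auto intro!: integrable_continuous_real\<close>)
  from has_vector_derivative_diff[OF this[simplified] leibniz_variable_upper[OF F der F' t]]
  have "((\<lambda>x. integral {a..b} (\<lambda>s. F s x) - integral {a..x} (\<lambda>s. F s x)) has_vector_derivative
    integral {a..b} (\<lambda>s. F' s t) - (F t t + integral {a..t} (\<lambda>s. F' s t))) (at t within {a..b})" by simp
  moreover have "integral {a..b} (\<lambda>s. F' s t) - (F t t + integral {a..t} (\<lambda>s. F' s t))
     = - F t t + integral {t..b} (\<lambda>s. F' s t)"
    using Henstock_Kurzweil_Integration.integral_combine[where a = a and c = t and b = b and f = "\<lambda>s. F' s t"] t F's[OF t] by (simp add: integrable_continuous_real algebra_simps)
  moreover have "integral {x..b} (\<lambda>s. F s x) = integral {a..b} (\<lambda>s. F s x) - integral {a..x} (\<lambda>s. F s x)"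
    if "x \<in> {a..b}" for x
    using Henstock_Kurzweil_Integration.integral_combine[where a = a and c = x and b = b and f = "\<lambda>s. F s x"] that Fs[OF that] by (simp add: integrable_continuous_real algebra_simps)
  ultimately show ?thesis using t by (auto intro: has_vector_derivative_transform)
qed

text \<open>The integral is Lipschitz in the limit \<open>t\<close>, uniformly in \<open>s\<close>,
  and continuous in \<open>s\<close> for fixed \<open>t\<close>.\<close>

lemma continuous_on_integral_upper:
  fixes k :: "real \<Rightarrow> real \<Rightarrow> 'a::banach"
  assumes k: "continuous_on ({a..b} \<times> {a..b}) (\<lambda>(s, u). k s u)"
  shows "continuous_on ({a..b} \<times> {a..b}) (\<lambda>(s, t). integral {a..t} (k s))"
proof -
  have ks: "continuous_on {a..b} (k s)" if "s \<in> {a..b}" for s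
    using that by (intro continuous_on_compose2[OF k, of _ "\<lambda>u. (s, u)", simplified]) (auto intro!: continuous_intros)
  have "compact ((\<lambda>(s, u). k s u) ` ({a..b} \<times> {a..b}))"
    by (intro compact_continuous_image k compact_Times) auto
  then obtain B where B: "\<And>s u. s \<in> {a..b} \<Longrightarrow> u \<in> {a..b} \<Longrightarrow> norm (k s u) \<le> B"
    by (force dest!: compact_imp_bounded simp: bounded_iff)
  have lip1: "norm (integral {a..t} (k s) - integral {a..t'} (k s)) \<le> B * (t - t')"
    if "s \<in> {a..b}" "t \<in> {a..b}" "t' \<in> {a..b}" "t' \<le> t" for s t t'
  proof -
    have "integral {a..t} (k s) - integral {a..t'} (k s) = integral {t'..t} (k s)"
      using Henstock_Kurzweil_Integration.integral_combine[where a = a and c = t' and b = t and f = "k s"] that continuous_on_subset[OF ks[OF that(1)], of "{a..t}"]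
      by (simp add: integrable_continuous_real algebra_simps)
    moreover have "norm (integral {t'..t} (k s)) \<le> B * (t - t')"
      using that continuous_on_subset[OF ks[OF that(1)], of "{t'..t}"] B
      by (intro integral_bound) auto
    ultimately show ?thesis by simp
  qed
  have lip: "norm (integral {a..t} (k s) - integral {a..t'} (k s)) \<le> B * \<bar>t - t'\<bar>"
    if "s \<in> {a..b}" "t \<in> {a..b}" "t' \<in> {a..b}" for s t t'
    using lip1[of s t t'] lip1[of s t' t] that by (cases "t' \<le> t") (auto simp: norm_minus_commute)
  show ?thesis
    unfolding continuous_on_def
  proof (rule ballI)
    fix p assume "p \<in> {a..b} \<times> {a..b}"
    then obtain s0 t0 where p: "p = (s0, t0)" and st: "s0 \<in> {a..b}" "t0 \<in> {a..b}" by auto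
    let ?F = "at (s0, t0) within {a..b} \<times> {a..b}"
    have "continuous_on {a..b} (\<lambda>s. integral (cbox a t0) (k s))"
      by (rule integral_continuous_on_param) (rule continuous_on_subset[OF k], use st in auto)
    then have "continuous_on ({a..b} \<times> {a..b}) (\<lambda>p. integral {a..t0} (k (fst p)))"
      by (intro continuous_on_compose2[of "{a..b}" "\<lambda>s. integral {a..t0} (k s)" _ fst]) (auto intro!: continuous_intros)
    then have 1: "((\<lambda>p. integral {a..t0} (k (fst p))) \<longlongrightarrow> integral {a..t0} (k s0)) ?F"
      using st by (auto simp: continuous_on_def dest!: bspec[of _ _ "(s0, t0)"])
    have 2: "((\<lambda>p. integral {a..snd p} (k (fst p)) - integral {a..t0} (k (fst p))) \<longlongrightarrow> 0) ?F"
    proof (rule Lim_null_comparison)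
      show "\<forall>\<^sub>F p in ?F. norm (integral {a..snd p} (k (fst p)) - integral {a..t0} (k (fst p))) \<le> B * \<bar>snd p - t0\<bar>"
        unfolding eventually_at_filter using lip st by (auto intro!: always_eventually)
      have "((\<lambda>p. B * \<bar>snd p - t0\<bar>) \<longlongrightarrow> B * \<bar>snd (s0, t0) - t0\<bar>) ?F"
        by (intro tendsto_intros)
      then show "((\<lambda>p. B * \<bar>snd p - t0\<bar>) \<longlongrightarrow> 0) ?F" by simp
    qed
    from tendsto_add[OF 2 1]
    show "((\<lambda>(s, t). integral {a..t} (k s)) \<longlongrightarrow> (case p of (s, t) \<Rightarrow> integral {a..t} (k s)))
        (at p within {a..b} \<times> {a..b})"
      by (simp add: case_prod_unfold p)
  qed
qed

lemma continuous_on_integral_lower: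
  fixes k :: "real \<Rightarrow> real \<Rightarrow> 'a::banach"
  assumes k: "continuous_on ({a..b} \<times> {a..b}) (\<lambda>(s, u). k s u)"
  shows "continuous_on ({a..b} \<times> {a..b}) (\<lambda>(s, t). integral {t..b} (k s))"
proof -
  have ks: "continuous_on {a..b} (k s)" if "s \<in> {a..b}" for s
    using that by (intro continuous_on_compose2[OF k, of _ "\<lambda>u. (s, u)", simplified]) (auto intro!: continuous_intros)
  have "continuous_on {a..b} (\<lambda>s. integral (cbox a b) (k s))"
    by (rule integral_continuous_on_param) (use k in auto)
  then have "continuous_on ({a..b} \<times> {a..b}) (\<lambda>p. integral {a..b} (k (fst p)))"
    by (intro continuous_on_compose2[of "{a..b}" "\<lambda>s. integral {a..b} (k s)" _ fst]) (auto intro!: continuous_intros)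
  from continuous_on_diff[OF this continuous_on_integral_upper[OF k]]
  show ?thesis
  proof (rule continuous_on_eq)
    fix p assume p: "p \<in> {a..b} \<times> {a..b}"
    then obtain s t where "p = (s, t)" "s \<in> {a..b}" "t \<in> {a..b}" by auto
    then show "integral {a..b} (k (fst p)) - (case p of (s, t) \<Rightarrow> integral {a..t} (k s)) = (case p of (s, t) \<Rightarrow> integral {t..b} (k s))"
      using Henstock_Kurzweil_Integration.integral_combine[where a = a and c = t and b = b and f = "k s"] ks[of s] by (auto simp: integrable_continuous_real algebra_simps)
  qed
qed

text \<open>This and the next two lemmas treat the parts into which the double integral of the
  functional splits when the state consists of an old and a new piece: both arguments new, both old,
  one of each. Only the limits depend on \<open>t\<close>, so continuity of the kernel is
  enough.\<close>

lemma double_integral_upper_derivative: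
  fixes k :: "real \<Rightarrow> real \<Rightarrow> 'a::banach"
  assumes k: "continuous_on ({a..b} \<times> {a..b}) (\<lambda>(s, u). k s u)" and t: "t \<in> {a..b}"
  shows "((\<lambda>t. integral {a..t} (\<lambda>s. integral {a..t} (k s))) has_vector_derivative
     integral {a..t} (k t) + integral {a..t} (\<lambda>s. k s t)) (at t within {a..b})"
proof (rule leibniz_variable_upper[OF continuous_on_integral_upper[OF k] _ k t])
  fix s t assume s: "s \<in> {a..b}" and t: "t \<in> {a..b}"
  have "continuous_on {a..b} (k s)"
    using s by (intro continuous_on_compose2[OF k, of _ "\<lambda>u. (s, u)", simplified]) (auto intro!: continuous_intros)
  from integral_has_vector_derivative[OF this t]
  show "((\<lambda>t. integral {a..t} (k s)) has_vector_derivative k s t) (at t within {a..b})" .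
qed

lemma double_integral_lower_derivative:
  fixes k :: "real \<Rightarrow> real \<Rightarrow> 'a::banach"
  assumes k: "continuous_on ({a..b} \<times> {a..b}) (\<lambda>(s, u). k s u)" and t: "t \<in> {a..b}"
  shows "((\<lambda>t. integral {t..b} (\<lambda>s. integral {t..b} (k s))) has_vector_derivative
     - integral {t..b} (k t) + integral {t..b} (\<lambda>s. - k s t)) (at t within {a..b})"
proof (rule leibniz_variable_lower[OF continuous_on_integral_lower[OF k] _ _ t])
  fix s t assume s: "s \<in> {a..b}" and t: "t \<in> {a..b}"
  have "continuous_on {a..b} (k s)"
    using s by (intro continuous_on_compose2[OF k, of _ "\<lambda>u. (s, u)", simplified]) (auto intro!: continuous_intros)
  from integral_has_vector_derivative'[OF this t]
  show "((\<lambda>t. integral {t..b} (k s)) has_vector_derivative - k s t) (at t within {a..b})" .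
next
  show "continuous_on ({a..b} \<times> {a..b}) (\<lambda>(s, t). - k s t)"
    using continuous_on_minus[OF k] by (simp add: case_prod_beta)
qed

lemma double_integral_mixed_derivative:
  fixes k :: "real \<Rightarrow> real \<Rightarrow> 'a::banach"
  assumes k: "continuous_on ({a..b} \<times> {a..b}) (\<lambda>(s, u). k s u)" and t: "t \<in> {a..b}"
  shows "((\<lambda>t. integral {t..b} (\<lambda>s. integral {a..t} (k s))) has_vector_derivative
     - integral {a..t} (k t) + integral {t..b} (\<lambda>s. k s t)) (at t within {a..b})"
proof (rule leibniz_variable_lower[OF continuous_on_integral_upper[OF k] _ k t])
  fix s t assume s: "s \<in> {a..b}" and t: "t \<in> {a..b}"
  have "continuous_on {a..b} (k s)"
    using s by (intro continuous_on_compose2[OF k, of _ "\<lambda>u. (s, u)", simplified]) (auto intro!: continuous_intros)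
  from integral_has_vector_derivative[OF this t]
  show "((\<lambda>t. integral {a..t} (k s)) has_vector_derivative k s t) (at t within {a..b})" .
qed

section \<open>The Lyapunov-Krasovskii functional\<close>

lemma bounded_bilinear_matrix_vector:
  "bounded_bilinear ((*v) :: real ^ 'n ^ 'm \<Rightarrow> real ^ 'n \<Rightarrow> real ^ 'm)"
  unfolding bilinear_conv_bounded_bilinear[symmetric] bilinear_def
  by (auto intro!: linearI simp: matrix_vector_mult_add_rdistrib matrix_vector_right_distrib
      matrix_vector_mult_scaleR scaleR_matrix_vector_assoc)

lemmas continuous_on_matrix_vector [continuous_intros] =
  bounded_bilinear.continuous_on[OF bounded_bilinear_matrix_vector]

lemma inner_transpose_left: "(transpose X *v x) \<bullet> y = x \<bullet> (X *v y)" for X :: "real ^ 'n ^ 'm"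
  by (simp add: transpose_matrix_vector dot_lmul_matrix)

lemma inner_transpose_right: "x \<bullet> (transpose X *v y) = (X *v x) \<bullet> y" for X :: "real ^ 'n ^ 'm"
  by (metis inner_transpose_left inner_commute)

context lyapunov_delay
begin

declare transpose_matrix_vector [simp del]

lemma continuous_on_U_compose [continuous_intros]:
  "continuous_on S f \<Longrightarrow> continuous_on S (\<lambda>x. U (f x))"
  by (rule continuous_on_compose2[OF continuous_on_U[of UNIV]]) auto

lemma continuous_on_G_compose [continuous_intros]:
  "continuous_on S f \<Longrightarrow> continuous_on S (\<lambda>x. G (f x))"
  by (rule continuous_on_compose2[OF continuous_on_G[of UNIV]]) auto

text \<open>The present value \<open>x\<close> is independent of the segment \<open>f\<close> and
  may differ from \<open>f 0\<close>, because the quadratic form of the matrix varies its first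
  block and the Legendre coefficients independently.\<close>

definition lk :: "real ^ 'm \<Rightarrow> (real \<Rightarrow> real ^ 'm) \<Rightarrow> real" where
  "lk x f = x \<bullet> (U 0 *v x) + 2 * integral {-h..0} (\<lambda>\<tau>. (U (h + \<tau>) *v x) \<bullet> (Ad *v f \<tau>))
     + integral {-h..0} (\<lambda>\<tau>2. integral {-h..0} (\<lambda>\<tau>1. (Ad *v f \<tau>1) \<bullet> (U (\<tau>1 - \<tau>2) *v (Ad *v f \<tau>2))))
     + integral {-h..0} (\<lambda>\<tau>. f \<tau> \<bullet> f \<tau>)"

text \<open>The state at time \<open>t + h\<close> of the solution that continues \<open>f\<close> by \<open>g\<close>
  consists of \<open>f\<close> on \<open>[t, 0]\<close> and of \<open>g\<close> on \<open>[-h, t]\<close>. The derivative of the functional along it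
  is the negative squared norm of the oldest value, \<open>f t\<close>.\<close>

lemma lk_step:
  assumes f: "continuous_on {-h..0} f"
    and g': "\<And>t. t \<in> {-h..0} \<Longrightarrow> (g has_vector_derivative A *v g t + Ad *v f t) (at t within {-h..0})"
  shows "lk (g 0) g = lk (g (-h)) f - integral {-h..0} (\<lambda>\<tau>. f \<tau> \<bullet> f \<tau>)"
proof -
  let ?I = "{-h..0}"
  define p where "p t = Ad *v g t" for t
  define q where "q t = Ad *v f t" for t
  have g: "continuous_on ?I g" using g' by (rule continuous_on_vector_derivative)
  have f2 [continuous_intros]: "continuous_on S (\<lambda>x. f (u x))" if "continuous_on S u" "u ` S \<subseteq> ?I" for u :: "real \<times> real \<Rightarrow> real" and S
    by (rule continuous_on_compose2[OF f that])
  have g2 [continuous_intros]: "continuous_on S (\<lambda>x. g (u x))" if "continuous_on S u" "u ` S \<subseteq> ?I" for u :: "real \<times> real \<Rightarrow> real" and S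
    by (rule continuous_on_compose2[OF g that])
  have f1: "continuous_on S f" if "S \<subseteq> ?I" for S using continuous_on_subset[OF f that] .
  have g1: "continuous_on S g" if "S \<subseteq> ?I" for S using continuous_on_subset[OF g that] .
  define G' where "G' u = G u ** A + transpose (G (h - u)) ** Ad" for u
  have G': "(G has_vector_derivative G' u) (at u)" for u
    unfolding G'_def by (rule G_deriv)
  have G'_vec: "G' u *v x = G u *v (A *v x) + transpose (G (h - u)) *v (Ad *v x)" for u x
    by (simp add: G'_def matrix_vector_mult_add_rdistrib matrix_vector_mul_assoc)
  define g1' where "g1' t = A *v g t + q t" for t
  have gder: "(g has_vector_derivative g1' t) (at t within ?I)" if "t \<in> ?I" for t
    using g'[OF that] by (simp add: g1'_def q_def)
  \<comment> \<open>In the intermediate state the old value \<open>f s\<close> sits at argument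
    \<open>s - t - h\<close> and the new value \<open>g s\<close> at \<open>s - t\<close>. Hence
    \<open>U (h + \<tau>)\<close> becomes \<open>G (s - t)\<close> for old and
    \<open>G (h + s - t)\<close> for new values, and the kernel \<open>kc\<close> between an old and
    a new value has the nonnegative argument \<open>h + b - s\<close>.\<close>
  define F1 where "F1 s t = (G (s - t) *v g t) \<bullet> q s" for s t
  define F1' where "F1' s t = (- (G' (s - t) *v g t) + G (s - t) *v g1' t) \<bullet> q s" for s t
  define F2 where "F2 s t = (G (h + s - t) *v g t) \<bullet> p s" for s t
  define F2' where "F2' s t = (- (G' (h + s - t) *v g t) + G (h + s - t) *v g1' t) \<bullet> p s" for s t
  define kff where "kff s b = q b \<bullet> (U (b - s) *v q s)" for s b
  define kgg where "kgg s b = p b \<bullet> (U (b - s) *v p s)" for s b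
  define kc where "kc s b = (G (h + b - s) *v q s) \<bullet> p b" for s b
  have cG': "continuous_on S (\<lambda>x. G' (u x))" if "continuous_on S u" for u :: "real \<times> real \<Rightarrow> real" and S
    unfolding G'_def
    by (intro continuous_intros that bounded_linear.continuous_on[OF bounded_linear_transpose]
      bounded_linear.continuous_on[OF bounded_linear_matrix_mult_left])
  have cF1: "continuous_on (?I \<times> ?I) (\<lambda>(s, t). F1 s t)"
    unfolding case_prod_beta F1_def q_def by (intro continuous_intros) auto
  have cF2: "continuous_on (?I \<times> ?I) (\<lambda>(s, t). F2 s t)"
    unfolding case_prod_beta F2_def p_def by (intro continuous_intros) auto
  have cF1': "continuous_on (?I \<times> ?I) (\<lambda>(s, t). F1' s t)"
    unfolding case_prod_beta F1'_def g1'_def q_def by (intro continuous_intros cG') auto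
  have cF2': "continuous_on (?I \<times> ?I) (\<lambda>(s, t). F2' s t)"
    unfolding case_prod_beta F2'_def g1'_def p_def q_def by (intro continuous_intros cG') auto
  have ckff: "continuous_on (?I \<times> ?I) (\<lambda>(s, t). kff s t)"
    unfolding case_prod_beta kff_def q_def by (intro continuous_intros) auto
  have ckgg: "continuous_on (?I \<times> ?I) (\<lambda>(s, t). kgg s t)"
    unfolding case_prod_beta kgg_def p_def by (intro continuous_intros) auto
  have ckc: "continuous_on (?I \<times> ?I) (\<lambda>(s, t). kc s t)"
    unfolding case_prod_beta kc_def p_def q_def by (intro continuous_intros) auto
  have dGc: "((\<lambda>t. G (c - t)) has_vector_derivative - G' (c - t)) (at t within ?I)" for c t
  proof -
    have "((\<lambda>t. c - t) has_vector_derivative -1) (at t)"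
      by (auto intro!: derivative_eq_intros)
    from vector_diff_chain_at[OF this G'] show ?thesis
      by (auto simp: o_def intro: has_vector_derivative_at_within)
  qed
  have dGg: "((\<lambda>t. (G (c - t) *v g t) \<bullet> v) has_vector_derivative
      (- (G' (c - t) *v g t) + G (c - t) *v g1' t) \<bullet> v) (at t within ?I)" if "t \<in> ?I" for c t v
    using bounded_linear.has_vector_derivative[OF bounded_linear_inner_left
      bounded_bilinear.has_vector_derivative[OF bounded_bilinear_matrix_vector dGc[of c t] gder[OF that]], of v]
    by (simp add: matrix_minus_mult_vec add.commute)
  have dF1: "((\<lambda>t. F1 s t) has_vector_derivative F1' s t) (at t within ?I)" if "t \<in> ?I" for s t
    unfolding F1_def F1'_def by (rule dGg[OF that])
  have dF2: "((\<lambda>t. F2 s t) has_vector_derivative F2' s t) (at t within ?I)" if "t \<in> ?I" for s t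
    unfolding F2_def F2'_def by (rule dGg[OF that])
  \<comment> \<open>The functional at the intermediate state, with old and new parts separated. The
    two mixed double integrals coincide by the symmetry \<open>U_minus\<close>, hence the factor
    2.\<close>
  define V where "V t = g t \<bullet> (G 0 *v g t) + 2 * (integral {t..0} (\<lambda>s. F1 s t) + integral {-h..t} (\<lambda>s. F2 s t))
      + integral {t..0} (\<lambda>s. integral {t..0} (kff s)) + integral {-h..t} (\<lambda>s. integral {-h..t} (kgg s))
      + 2 * integral {t..0} (\<lambda>s. integral {-h..t} (kc s))
      + integral {t..0} (\<lambda>s. f s \<bullet> f s) + integral {-h..t} (\<lambda>s. g s \<bullet> g s)" for t
  have dV: "(V has_vector_derivative - (f t \<bullet> f t)) (at t within ?I)" if t: "t \<in> ?I" for t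
  proof -
    have d1: "((\<lambda>t. g t \<bullet> (G 0 *v g t)) has_vector_derivative g t \<bullet> (G 0 *v g1' t) + g1' t \<bullet> (G 0 *v g t)) (at t within ?I)"
      by (rule bounded_bilinear.has_vector_derivative[OF bounded_bilinear_inner gder[OF t]
        bounded_linear.has_vector_derivative[OF matrix_vector_mul_bounded_linear gder[OF t]]])
    have d2: "((\<lambda>t. integral {t..0} (\<lambda>s. F1 s t)) has_vector_derivative - F1 t t + integral {t..0} (\<lambda>s. F1' s t)) (at t within ?I)"
      by (rule leibniz_variable_lower[OF cF1 dF1 cF1' t])
    have d3: "((\<lambda>t. integral {-h..t} (\<lambda>s. F2 s t)) has_vector_derivative F2 t t + integral {-h..t} (\<lambda>s. F2' s t)) (at t within ?I)"
      by (rule leibniz_variable_upper[OF cF2 dF2 cF2' t])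
    have d7: "((\<lambda>t. integral {t..0} (\<lambda>s. f s \<bullet> f s)) has_vector_derivative - (f t \<bullet> f t)) (at t within ?I)"
      by (intro integral_has_vector_derivative' continuous_intros f t)
    have d8: "((\<lambda>t. integral {-h..t} (\<lambda>s. g s \<bullet> g s)) has_vector_derivative (g t \<bullet> g t)) (at t within ?I)"
      by (intro integral_has_vector_derivative continuous_intros g t)
    have dm: "((\<lambda>t. 2 * u t) has_vector_derivative 2 * u') (at t within ?I)"
      if "(u has_vector_derivative u') (at t within ?I)" for u :: "real \<Rightarrow> real" and u'
      using bounded_linear.has_vector_derivative[OF bounded_linear_mult_right that] .
    have dV: "(V has_vector_derivative
        (g t \<bullet> (G 0 *v g1' t) + g1' t \<bullet> (G 0 *v g t))
        + 2 * ((- F1 t t + integral {t..0} (\<lambda>s. F1' s t)) + (F2 t t + integral {-h..t} (\<lambda>s. F2' s t)))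
        + (- integral {t..0} (kff t) + integral {t..0} (\<lambda>s. - kff s t))
        + (integral {-h..t} (kgg t) + integral {-h..t} (\<lambda>s. kgg s t))
        + 2 * (- integral {-h..t} (kc t) + integral {t..0} (\<lambda>s. kc s t))
        + - (f t \<bullet> f t) + g t \<bullet> g t) (at t within ?I)"
      unfolding V_def
      by (intro has_vector_derivative_add dm d1 d2 d3 d7 d8 double_integral_lower_derivative[OF ckff t]
        double_integral_upper_derivative[OF ckgg t] double_integral_mixed_derivative[OF ckc t])
    have ints: "(\<lambda>s. kff t s) integrable_on {t..0}" "(\<lambda>s. kgg t s) integrable_on {-h..t}"
       "(\<lambda>s. kc t s) integrable_on {-h..t}" "(\<lambda>s. kc s t) integrable_on {t..0}"
      unfolding kff_def kgg_def kc_def p_def q_def using t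
      by (auto intro!: integrable_continuous_real continuous_intros f1 g1)
    have kff_sym: "kff s b = kff b s" for s b
    proof -
      have "U (s - b) = transpose (U (b - s))" using U_minus[of "b - s"] by simp
      then show ?thesis unfolding kff_def by (simp only: inner_transpose_right) (rule inner_commute)
    qed
    have kgg_sym: "kgg s b = kgg b s" for s b
    proof -
      have "U (s - b) = transpose (U (b - s))" using U_minus[of "b - s"] by simp
      then show ?thesis unfolding kgg_def by (simp only: inner_transpose_right) (rule inner_commute)
    qed
    \<comment> \<open>By the differential equation of \<open>G\<close> the terms with
      \<open>A *v g t\<close> cancel; what is left matches the boundary terms of the double
      integrals. The same happens in \<open>e2\<close>.\<close>
    have e1: "integral {t..0} (\<lambda>s. F1' s t) = integral {t..0} (kff t) - integral {t..0} (\<lambda>s. kc s t)"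
    proof -
      have "integral {t..0} (\<lambda>s. F1' s t) = integral {t..0} (\<lambda>s. kff t s - kc s t)"
      proof (rule integral_cong)
        fix s assume s: "s \<in> {t..0}"
        have "F1' s t = (G (s - t) *v q t) \<bullet> q s - (transpose (G (h - (s - t))) *v p t) \<bullet> q s"
          unfolding F1'_def g1'_def G'_vec p_def
          by (simp add: matrix_vector_right_distrib inner_diff_left inner_add_left)
        also have "(transpose (G (h - (s - t))) *v p t) \<bullet> q s = kc s t"
          unfolding kc_def inner_transpose_left by (simp add: inner_commute algebra_simps)
        also have "(G (s - t) *v q t) \<bullet> q s = kff t s"
          using s by (simp add: kff_def U_nonneg inner_commute)
        finally show "F1' s t = kff t s - kc s t" .
      qed
      then show ?thesis using integral_diff[OF ints(1) ints(4)] by simp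
    qed
    have e2: "integral {-h..t} (\<lambda>s. F2' s t) = integral {-h..t} (kc t) - integral {-h..t} (kgg t)"
    proof -
      have "integral {-h..t} (\<lambda>s. F2' s t) = integral {-h..t} (\<lambda>s. kc t s - kgg t s)"
      proof (rule integral_cong)
        fix s assume s: "s \<in> {-h..t}"
        have "F2' s t = (G (h + s - t) *v q t) \<bullet> p s - (transpose (G (h - (h + s - t))) *v p t) \<bullet> p s"
          unfolding F2'_def g1'_def G'_vec p_def
          by (simp add: matrix_vector_right_distrib inner_diff_left inner_add_left)
        also have "(transpose (G (h - (h + s - t))) *v p t) \<bullet> p s = kgg s t"
          using s by (simp add: kgg_def inner_transpose_left U_nonneg)
        also have "kgg s t = kgg t s" by (rule kgg_sym)
        finally show "F2' s t = kc t s - kgg t s" by (simp add: kc_def)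
      qed
      then show ?thesis using integral_diff[OF ints(3) ints(2)] by simp
    qed
    have e3: "integral {t..0} (\<lambda>s. kff s t) = integral {t..0} (kff t)"
      "integral {-h..t} (\<lambda>s. kgg s t) = integral {-h..t} (kgg t)"
      using kff_sym[of _ t] kgg_sym[of _ t] by simp_all
    \<comment> \<open>The terms outside the integrals form the quadratic form in
      \<open>algebraic_property\<close>, that is \<open>- mat 1\<close>, and cancel the derivative
      \<open>g t \<bullet> g t\<close> of the last integral.\<close>
    have e4: "(g t \<bullet> (G 0 *v g1' t) + g1' t \<bullet> (G 0 *v g t)) + 2 * (- F1 t t + F2 t t) = - (g t \<bullet> g t)"
    proof -
      have sym: "(G 0 *v x) \<bullet> y = x \<bullet> (G 0 *v y)" for x y
        using inner_transpose_left[of "G 0" x y] by (simp add: G_0_symmetric)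
      have s1: "(A *v g t) \<bullet> (G 0 *v g t) = g t \<bullet> (G 0 *v (A *v g t))"
        by (metis sym inner_commute)
      have "- (g t \<bullet> g t) = g t \<bullet> ((G 0 ** A + transpose A ** G 0 + transpose (G h) ** Ad + transpose Ad ** G h) *v g t)"
        by (simp add: algebraic_property matrix_minus_mult_vec)
      also have "\<dots> = 2 * (g t \<bullet> (G 0 *v (A *v g t))) + 2 * ((G h *v g t) \<bullet> p t)"
        by (simp add: matrix_vector_mult_add_rdistrib matrix_vector_mul_assoc[symmetric] inner_add_right
          inner_transpose_right p_def s1 inner_commute[of "Ad *v g t"])
      finally have "- (g t \<bullet> g t) = 2 * (g t \<bullet> (G 0 *v (A *v g t))) + 2 * ((G h *v g t) \<bullet> p t)" .
      moreover have "(A *v g t) \<bullet> (G 0 *v g t) = g t \<bullet> (G 0 *v (A *v g t))" "q t \<bullet> (G 0 *v g t) = g t \<bullet> (G 0 *v q t)"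
        "(G 0 *v g t) \<bullet> q t = g t \<bullet> (G 0 *v q t)"
        by (metis sym inner_commute)+
      ultimately show ?thesis
        by (simp add: g1'_def F1_def F2_def matrix_vector_right_distrib inner_add_left inner_add_right)
    qed
    show ?thesis
      using dV e4 by (simp add: e1 e2 e3 algebra_simps)
  qed
  have "((\<lambda>t. - (f t \<bullet> f t)) has_integral V 0 - V (-h)) ?I"
    by (rule fundamental_theorem_of_calculus[OF _ dV]) (use h_pos in auto)
  then have "V 0 - V (-h) = - integral ?I (\<lambda>t. f t \<bullet> f t)"
    by (simp add: has_integral_iff)
  moreover have "V 0 = lk (g 0) g"
  proof -
    have "integral ?I (\<lambda>s. (G (h + s) *v g 0) \<bullet> p s) = integral ?I (\<lambda>\<tau>. (U (h + \<tau>) *v g 0) \<bullet> (Ad *v g \<tau>))"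
      by (rule integral_cong) (simp add: U_nonneg p_def)
    then show ?thesis by (simp add: V_def lk_def F2_def kgg_def[abs_def] p_def U_nonneg)
  qed
  moreover have "V (-h) = lk (g (-h)) f"
  proof -
    have "integral ?I (\<lambda>s. (G (s + h) *v g (-h)) \<bullet> q s) = integral ?I (\<lambda>\<tau>. (U (h + \<tau>) *v g (-h)) \<bullet> (Ad *v f \<tau>))"
      by (rule integral_cong) (simp add: U_nonneg q_def add.commute)
    then show ?thesis by (simp add: V_def lk_def F1_def kff_def[abs_def] q_def U_nonneg)
  qed
  ultimately show ?thesis by simp
qed

end

section \<open>The constants\<close>

lemma lambert_W:
  assumes "z \<ge> 0"
  shows "lambert_W z \<ge> 0 \<and> lambert_W z * exp (lambert_W z) = z"
proof -
  have mono: "y * exp y < y' * exp y'" if "0 \<le> y" "y < y'" for y y' :: real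
    using that by (intro mult_strict_mono) auto
  have "\<exists>y\<ge>0. y \<le> z \<and> y * exp y = z"
    by (rule IVT') (use assms in \<open>auto intro!: continuous_intros simp: mult_le_cancel_left1\<close>)
  then obtain y where y: "y \<ge> 0" "y * exp y = z" by blast
  have "(THE y. y \<ge> 0 \<and> y * exp y = z) = y"
  proof (rule the_equality)
    fix y' assume "y' \<ge> 0 \<and> y' * exp y' = z"
    then show "y' = y" using y mono[of y y'] mono[of y' y] by (cases y y' rule: linorder_cases) auto
  qed (use y in auto)
  then show ?thesis using y assms by (simp add: lambert_W_def)
qed

text \<open>The defining function increases strictly on \<open>[0, pi / 2]\<close> and has the
  positive value \<open>(pi / 2)\<^sup>2\<close> at the right end, so its root lies strictly before
  \<open>pi / 2\<close>.\<close>

lemma cos_b0_pos: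
  assumes "h * r_const A Ad > 0"
  shows "cos (b0_const h A Ad) > 0"
proof -
  define c where "c = (h * r_const A Ad)\<^sup>2"
  have c: "c > 0" using assms by (auto simp: c_def)
  define g where "g b = (sin b) ^ 4 * (c + b\<^sup>2) - c" for b :: real
  have mono: "g b < g b'" if "0 \<le> b" "b < b'" "b' \<le> pi / 2" for b b'
  proof -
    have "sin b < sin b'" using that by (intro sin_monotone_2pi) auto
    moreover have "0 \<le> sin b" using that by (intro sin_ge_zero) auto
    ultimately have "(sin b) ^ 4 < (sin b') ^ 4" by (intro power_strict_mono) auto
    moreover have "c + b\<^sup>2 < c + b'\<^sup>2" using that by (simp add: power_strict_mono)
    ultimately have "(sin b) ^ 4 * (c + b\<^sup>2) < (sin b') ^ 4 * (c + b'\<^sup>2)"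
      using c by (intro mult_strict_mono) (auto simp: add_pos_nonneg)
    then show ?thesis by (simp add: g_def)
  qed
  have "\<exists>b\<ge>0. b \<le> pi / 2 \<and> g b = 0"
    by (rule IVT') (use c in \<open>auto intro!: continuous_intros simp: g_def\<close>)
  then obtain b where b: "b \<ge> 0" "b \<le> pi / 2" "g b = 0" by blast
  have "b0_const h A Ad = b"
    unfolding b0_const_def c_def[symmetric] g_def[symmetric]
  proof (rule the_equality)
    fix b' assume "0 \<le> b' \<and> b' \<le> pi / 2 \<and> g b' = 0"
    then show "b' = b" using b mono[of b b'] mono[of b' b] by (cases b b' rule: linorder_cases) auto
  qed (use b in auto)
  moreover have "g (pi / 2) = (pi / 2)\<^sup>2" by (simp add: g_def)
  then have "b \<noteq> pi / 2" using b(3) pi_gt_zero by (metis less_irrefl zero_less_power half_gt_zero)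
  ultimately show ?thesis using b by (intro cos_gt_zero_pi) auto
qed

text \<open>Positivity makes \<open>E_fun\<close> positive. The upper bound compares
  \<open>eta0_const\<close> with the amount by which the functional is negative at an unstable
  history.\<close>

lemma eta0_bounds:
  assumes "h > 0" "r_const A Ad > 0"
  shows "eta0_const h A Ad > 0" "eta0_const h A Ad \<le> exp (- 2 * r_const A Ad * h) / (4 * r_const A Ad)"
proof -
  have "cos (b0_const h A Ad) > 0" using assms by (intro cos_b0_pos) simp
  then show "eta0_const h A Ad > 0" using assms unfolding eta0_const_def by simp
  have "(cos (b0_const h A Ad))\<^sup>2 \<le> 1" by (simp add: abs_square_le_1)
  then show "eta0_const h A Ad \<le> exp (- 2 * r_const A Ad * h) / (4 * r_const A Ad)"
    using assms unfolding eta0_const_def by (intro mult_left_le) auto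
qed

text \<open>\<open>E_fun\<close> is the positive root of the quadratic equation with linear
  coefficient \<open>2 * q\<close> and constant term \<open>- d\<close>; multiplying by
  \<open>\<kappa>2 + 1\<close> clears the denominators.\<close>

lemma E_fun:
  assumes "h > 0" "\<eta> > 0" "kappa1_const h A Ad \<ge> 0" "kappa2_const h A Ad \<ge> 0"
  shows "E_fun h A Ad \<eta> > 0"
    "(kappa2_const h A Ad + 1) * (E_fun h A Ad \<eta>)\<^sup>2
      + 2 * (kappa1_const h A Ad + kappa2_const h A Ad) * E_fun h A Ad \<eta> = \<eta> / h"
proof -
  let ?k1 = "kappa1_const h A Ad" and ?k2 = "kappa2_const h A Ad"
  define q where "q = (?k1 + ?k2) / (?k2 + 1)"
  define d where "d = \<eta> / (h * (?k2 + 1))"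
  have d: "d > 0" unfolding d_def using assms by (intro divide_pos_pos mult_pos_pos) auto
  have E: "E_fun h A Ad \<eta> = - q + sqrt (q\<^sup>2 + d)"
    by (simp add: E_fun_def Let_def q_def d_def)
  have "\<bar>q\<bar> < sqrt (q\<^sup>2 + d)" using d by (intro real_less_rsqrt) simp
  then show "E_fun h A Ad \<eta> > 0" unfolding E by linarith
  have "(sqrt (q\<^sup>2 + d))\<^sup>2 = q\<^sup>2 + d" using d by (intro real_sqrt_pow2) (simp add: add_nonneg_pos less_imp_le)
  then have "(E_fun h A Ad \<eta>)\<^sup>2 + 2 * q * E_fun h A Ad \<eta> = d"
    unfolding E by (simp add: power2_eq_square algebra_simps)
  then have "(?k2 + 1) * ((E_fun h A Ad \<eta>)\<^sup>2 + 2 * q * E_fun h A Ad \<eta>) = (?k2 + 1) * d" by simp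
  moreover have "(?k2 + 1) * ((E_fun h A Ad \<eta>)\<^sup>2 + 2 * q * E_fun h A Ad \<eta>)
    = (?k2 + 1) * (E_fun h A Ad \<eta>)\<^sup>2 + 2 * ((?k2 + 1) * q) * E_fun h A Ad \<eta>" by (simp add: algebra_simps)
  moreover have "(?k2 + 1) * q = ?k1 + ?k2" "(?k2 + 1) * d = \<eta> / h"
    using assms by (simp_all add: q_def d_def)
  ultimately show "(?k2 + 1) * (E_fun h A Ad \<eta>)\<^sup>2 + 2 * (?k1 + ?k2) * E_fun h A Ad \<eta> = \<eta> / h"
    by (simp only:)
qed

text \<open>The term of order \<open>n\<close> in the series of \<open>exp n\<close> is at most the
  whole sum.\<close>

lemma fact_ge_power_exp: "(real n / exp 1) ^ n \<le> fact n"
proof -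
  have "real n ^ n / fact n \<le> exp (real n)"
  proof -
    have "(\<Sum>k\<in>{n}. real n ^ k /\<^sub>R fact k) \<le> (\<Sum>k. real n ^ k /\<^sub>R fact k)"
      by (rule sum_le_suminf) (auto intro: summable_exp)
    then show ?thesis by (simp add: exp_def divide_inverse mult.commute)
  qed
  then show ?thesis by (simp add: power_divide exp_of_nat_mult[symmetric] field_simps)
qed

lemma exp_1_bounds: "exp 1 \<ge> (5 / 2 :: real)" "exp 1 \<le> (2.72 :: real)"
proof -
  have "1 + 1 + (1::real) / 2 \<le> exp 1" using exp_lower_Taylor_quadratic[of 1] by simp
  then show "exp 1 \<ge> (5 / 2 :: real)" by simp
  show "exp 1 \<le> (2.72 :: real)" using e_less_272 by simp
qed

text \<open>After raising to the fifth power this is \<open>exp 2 \<le> (3 / 2) ^ 5\<close>, about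
  7.39 against 7.59. The rate \<open>2 / 5\<close> is the reciprocal of the lower bound
  \<open>5 / 2\<close> for \<open>exp 1\<close>, which bounds \<mu> in terms of
  \<open>n\<close>.\<close>

lemma exp_le_three_halves_power: "exp (2 / 5 * real k) \<le> (3 / 2) ^ k"
proof -
  have "exp (2 / 5 :: real) ^ 5 = exp 1 ^ 2"
    by (simp add: exp_of_nat_mult[symmetric])
  also have "\<dots> \<le> 2.72 ^ 2" using exp_1_bounds by (intro power_mono) auto
  also have "\<dots> \<le> (3 / 2 :: real) ^ 5" by (simp add: power2_eq_square eval_nat_numeral)
  finally have "exp (2 / 5 :: real) \<le> 3 / 2" using power_mono_iff[of "exp (2 / 5 :: real)" "3 / 2" 5] by simp
  then have "exp (2 / 5 :: real) ^ k \<le> (3 / 2) ^ k" by (intro power_mono) auto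
  then show ?thesis by (simp add: exp_of_nat_mult[symmetric] mult.commute)
qed

text \<open>As a function of \<open>s\<close> the left side is largest at \<open>s = \<mu>\<close>;
  this is the inequality \<open>ln u \<le> u - 1\<close> at \<open>u = \<mu> / s\<close>.\<close>

lemma powr_self_le_exp:
  assumes "\<mu> > 0" "s > 0"
  shows "(\<mu> * exp 1 / s) powr s \<le> exp (\<mu> :: real)"
proof -
  have "ln (\<mu> / s) \<le> \<mu> / s - 1" using assms by (intro ln_le_minus_one) auto
  then have "s * (ln (\<mu> / s) + 1) \<le> \<mu>" using assms by (simp add: field_simps)
  moreover have "(\<mu> * exp 1 / s) powr s = exp (s * (ln (\<mu> / s) + 1))"
    using assms by (simp add: powr_def ln_mult ln_div)
  ultimately show ?thesis by simp
qed

lemma powr_three_halves: "x \<ge> 0 \<Longrightarrow> x powr (3 / 2) = x * sqrt (x :: real)"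
proof -
  assume x: "x \<ge> 0"
  have "x powr (1 + 1 / 2) = x powr 1 * x powr (1 / 2)" by (rule powr_add)
  then show ?thesis using x by (simp add: powr_half_sqrt)
qed

text \<open>The spare factor \<open>(1 / 2) ^ n\<close> must beat everything else. For \<mu> above
  1, with \<open>n = Suc m\<close>, the power in \<rho> is at most
  \<open>exp \<mu> \<le> (3 / 2) ^ m\<close>, and the term with \<open>exp (2 * \<mu>)\<close> is at
  most \<open>(9 / 8) ^ m\<close>; the products \<open>3 / 4\<close> and \<open>27 / 32\<close> are
  below 1, and the finitely many constants are checked at \<open>n = 5\<close>. For smaller \<mu> a
  direct estimate with \<open>n \<ge> 4\<close> suffices.\<close>

lemma rho_bound:
  fixes \<mu> :: real
  assumes \<mu>: "\<mu> > 0" and n: "n \<ge> (4::nat)" "real n \<ge> 3 / 2 + \<mu> * exp 1"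
    and \<rho>: "\<rho> = sqrt (2 * c / pi ^ 3) * (1 / \<mu>\<^sup>2) * (\<mu> * exp 1 / (c + 1 / 2)) powr (c + 1 / 2)"
    and c: "c = real_of_int \<lceil>\<mu>\<rceil>"
  shows "4 * (1 / 2) ^ n * (\<mu> * exp 1 / real n) powr (3 / 2) * \<rho> * (2 * (1 / 2) ^ n * exp (2 * \<mu>) + 17 / 4 * \<mu>) \<le> 1"
proof -
  define S where "S = (\<mu> * exp 1 / (c + 1 / 2)) powr (c + 1 / 2)"
  define e where "e = (exp 1 :: real)"
  have e: "5 / 2 \<le> e" "e \<le> 2.72" using exp_1_bounds by (simp_all add: e_def)
  have c1: "c \<ge> 1" using \<mu> by (simp add: c one_le_ceiling)
  have n0: "real n > 0" using n by simp
  have pi3: "pi ^ 3 \<ge> 27" using power_mono[of 3 pi 3] pi_gt3 by simp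
  have S0: "S \<ge> 0" by (simp add: S_def)
  have n15: "(\<mu> * e / real n) powr (3 / 2) = (\<mu> * e) * sqrt (\<mu> * e) / (real n * sqrt (real n))"
    using \<mu> e n0 by (simp add: powr_three_halves real_sqrt_divide)
  \<comment> \<open>The power \<open>3 / 2\<close> of \<open>\<mu> * e\<close> absorbs most of
    \<open>1 / \<mu>\<^sup>2\<close>. The remaining \<open>1 / \<mu>\<close> is compensated by the
    root together with \<open>S\<close> if \<open>\<mu> \<le> 1\<close>, and by the root alone
    otherwise.\<close>
  have \<rho>': "(\<mu> * e) * sqrt (\<mu> * e) * \<rho> = sqrt (2 * c * \<mu> * e / pi ^ 3) * (e / \<mu>) * S"
  proof -
    have "sqrt (2 * c * \<mu> * e / pi ^ 3) = sqrt (2 * c / pi ^ 3) * sqrt (\<mu> * e)"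
      by (simp add: real_sqrt_mult[symmetric] mult_ac)
    then show ?thesis using \<mu> by (simp add: \<rho> S_def e_def power2_eq_square field_simps)
  qed
  define B where "B = 2 * (1 / 2) ^ n * exp (2 * \<mu>)"
  have B0: "B \<ge> 0" by (simp add: B_def)
  have key: "4 * (1 / 2) ^ n * (\<mu> * e / real n) powr (3 / 2) * \<rho> * (B + 17 / 4 * \<mu>)
     = 4 * (1 / 2) ^ n * (sqrt (2 * c * \<mu> * e / pi ^ 3) * (e / \<mu>) * S) * (B + 17 / 4 * \<mu>) / (real n * sqrt (real n))"
    unfolding n15 \<rho>'[symmetric] by simp
  show ?thesis
  proof (cases "\<mu> \<le> 1")
    case True
    then have "\<lceil>\<mu>\<rceil> = 1" using \<mu> by (intro ceiling_unique) auto
    then have c: "c = 1" by (simp add: c)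
    have SS: "S = (\<mu> * e * 2 / 3) * sqrt (\<mu> * e * 2 / 3)"
      using powr_three_halves[of "\<mu> * e * 2 / 3"] \<mu> e by (simp add: S_def c e_def)
    then have "sqrt (2 * c * \<mu> * e / pi ^ 3) * (e / \<mu>) * S
       = (sqrt (2 * \<mu> * e / pi ^ 3) * sqrt (\<mu> * e * 2 / 3)) * (e / \<mu>) * (\<mu> * e * 2 / 3)"
      unfolding SS c by (simp add: mult_ac)
    also have "sqrt (2 * \<mu> * e / pi ^ 3) * sqrt (\<mu> * e * 2 / 3) \<le> 2 / 9 * (\<mu> * e)"
    proof -
      have "sqrt (2 * \<mu> * e / pi ^ 3) * sqrt (\<mu> * e * 2 / 3) = sqrt ((4 / 3) * (\<mu> * e)\<^sup>2 / pi ^ 3)"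
        by (simp add: real_sqrt_mult[symmetric] power2_eq_square)
      also have "\<dots> \<le> sqrt ((4 / 3) * (\<mu> * e)\<^sup>2 / 27)"
        using pi3 by (intro real_sqrt_le_mono divide_left_mono) auto
      also have "(4 / 3) * (\<mu> * e)\<^sup>2 / 27 = (2 / 9 * (\<mu> * e))\<^sup>2" by (simp add: power2_eq_square)
      also have "sqrt \<dots> = 2 / 9 * (\<mu> * e)" using \<mu> e by simp
      finally show ?thesis .
    qed
    also have "2 / 9 * (\<mu> * e) * (e / \<mu>) * (\<mu> * e * 2 / 3) = 4 / 27 * \<mu> * e ^ 3"
      using \<mu> by (simp add: power3_eq_cube)
    also have "\<dots> \<le> 4 / 27 * 1 * 2.72 ^ 3"
      using True \<mu> e by (intro mult_mono power_mono) auto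
    also have "\<dots> \<le> 3" by (simp add: power3_eq_cube)
    finally have A: "sqrt (2 * c * \<mu> * e / pi ^ 3) * (e / \<mu>) * S \<le> 3"
      using \<mu> e by (simp add: mult_right_mono)
    have "(1 / 2 :: real) ^ n \<le> (1 / 2) ^ 4" using n by (intro power_decreasing) auto
    then have B: "4 * (1 / 2 :: real) ^ n \<le> 1 / 4" by (simp add: power_divide eval_nat_numeral)
    have "exp (2 * \<mu>) \<le> exp (1 + 1)" using True by simp
    also have "\<dots> = e * e" by (simp only: exp_add e_def)
    also have "\<dots> \<le> 2.72 * 2.72" using e by (intro mult_mono) auto
    finally have "exp (2 * \<mu>) \<le> 8" by simp
    then have "B \<le> 2 * (1 / 16) * 8" unfolding B_def using B by (intro mult_mono) auto
    then have B1: "B \<le> 1" by simp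
    have "2 \<le> sqrt (real n)" by (rule real_le_rsqrt) (use n in simp)
    then have "4 * 2 \<le> real n * sqrt (real n)" using n by (intro mult_mono) auto
    then have D: "real n * sqrt (real n) \<ge> 8" by simp
    have "4 * (1 / 2) ^ n * (sqrt (2 * c * \<mu> * e / pi ^ 3) * (e / \<mu>) * S) * (B + 17 / 4 * \<mu>)
      \<le> 1 / 4 * 3 * (1 + 17 / 4 * 1)"
      using A B B1 B0 True \<mu> c1 e S0 by (intro mult_mono add_mono) auto
    also have "\<dots> \<le> real n * sqrt (real n)" using D by simp
    finally have fin: "4 * (1 / 2) ^ n * (sqrt (2 * c * \<mu> * e / pi ^ 3) * (e / \<mu>) * S) * (B + 17 / 4 * \<mu>)
      \<le> real n * sqrt (real n)" .
    show ?thesis unfolding e_def[symmetric] B_def[symmetric] key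
      by (rule divide_le_eq_1_pos[THEN iffD2, OF _ fin]) (use D in linarith)
  next
    case False
    have "c \<le> 2 * \<mu>" using False ceiling_correct[of \<mu>] by (simp add: c) 
    have A: "sqrt (2 * c * \<mu> * e / pi ^ 3) * (e / \<mu>) \<le> 7 / 4"
    proof -
      have "2 * c * \<mu> * e / pi ^ 3 \<le> 2 * (2 * \<mu>) * \<mu> * 2.72 / 27"
        using \<open>c \<le> 2 * \<mu>\<close> \<mu> c1 e pi3 by (intro frac_le mult_mono) auto
      also have "\<dots> \<le> (0.64 * \<mu>)\<^sup>2" using \<mu> by (simp add: power2_eq_square)
      finally have "sqrt (2 * c * \<mu> * e / pi ^ 3) \<le> 0.64 * \<mu>" using \<mu> by (intro real_le_lsqrt) auto
      then have "sqrt (2 * c * \<mu> * e / pi ^ 3) * (e / \<mu>) \<le> 0.64 * \<mu> * (2.72 / \<mu>)"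
        using \<mu> e by (intro mult_mono divide_right_mono) auto
      also have "\<dots> \<le> 7 / 4" using \<mu> by simp
      finally show ?thesis .
    qed
    have "\<mu> * (5 / 2) \<le> \<mu> * e" using \<mu> e by (intro mult_left_mono) auto
    then have n': "real n \<ge> 3 / 2 + 5 / 2 * \<mu>" using n by (simp add: e_def)
    have "n \<ge> 5"
    proof -
      have "1 * (5 / 2) < \<mu> * e" using False e by (intro mult_less_le_imp_less) auto
      then have "real n > 4" using n by (simp add: e_def)
      then show ?thesis by linarith
    qed
    obtain m where m: "n = Suc m" using \<open>n \<ge> 5\<close> by (cases n) auto
    have "exp \<mu> \<le> exp (2 / 5 * real m)" using n' by (simp add: m)
    also have "\<dots> \<le> (3 / 2) ^ m" by (rule exp_le_three_halves_power)
    finally have exp\<mu>: "exp \<mu> \<le> (3 / 2) ^ m" .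
    then have "S \<le> (3 / 2) ^ m"
      unfolding S_def using powr_self_le_exp[OF \<mu>, of "c + 1 / 2"] c1 by simp
    then have SS: "S \<le> 2 / 3 * (3 / 2) ^ n" by (simp add: m)
    have "exp (2 * \<mu>) = exp \<mu> * exp \<mu>" by (simp add: exp_add[symmetric])
    also have "\<dots> \<le> (3 / 2) ^ m * (3 / 2) ^ m" using exp\<mu> by (intro mult_mono) auto
    finally have "B \<le> 2 * (1 / 2) ^ n * ((3 / 2) ^ m * (3 / 2) ^ m)"
      unfolding B_def by (intro mult_left_mono) auto
    also have "\<dots> = (1 / 2 * (3 / 2) * (3 / 2)) ^ m" unfolding power_mult_distrib by (simp add: m)
    finally have BB: "B \<le> (9 / 8) ^ m" by simp
    have L: "17 / 4 * \<mu> \<le> 17 / 10 * (real n - 3 / 2)" using n' by simp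
    have "4 * (1 / 2) ^ n * (sqrt (2 * c * \<mu> * e / pi ^ 3) * (e / \<mu>) * S) * (B + 17 / 4 * \<mu>)
      \<le> 4 * (1 / 2) ^ n * (7 / 4 * (2 / 3 * (3 / 2) ^ n)) * ((9 / 8) ^ m + 17 / 10 * (real n - 3 / 2))"
      using A SS B0 \<mu> c1 e S0 by (intro mult_mono add_mono[OF BB L]) auto
    also have "\<dots> = 14 / 3 * (1 / 2 * (3 / 2)) ^ n * ((9 / 8) ^ m + 17 / 10 * (real n - 3 / 2))"
      unfolding power_mult_distrib by simp
    also have "(1 / 2 * (3 / 2) :: real) = 3 / 4" by simp
    also have "14 / 3 * (3 / 4) ^ n * ((9 / 8) ^ m + 17 / 10 * (real n - 3 / 2)) = 7 / 2 * (3 / 4 * (9 / 8)) ^ m + 119 / 15 * (3 / 4) ^ n * (real n - 3 / 2)"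
      unfolding power_mult_distrib by (simp add: m field_simps)
    \<comment> \<open>Both geometric factors decrease, so they are evaluated at \<open>m = 4\<close>
      and \<open>n = 5\<close>; only the linear factor in \<open>n\<close> is kept.\<close>
    also have "\<dots> \<le> 7 / 2 * (3 / 4 * (9 / 8)) ^ 4 + 119 / 15 * (3 / 4) ^ 5 * (real n - 3 / 2)"
      using \<open>n \<ge> 5\<close> m by (intro add_mono mult_left_mono mult_right_mono power_decreasing) auto
    also have "\<dots> \<le> 2 * real n"
      using n0 by (simp add: eval_nat_numeral field_simps)
    also have "2 * real n \<le> real n * sqrt (real n)"
      using real_le_rsqrt[of 2 "real n"] n by (simp add: mult.commute mult_left_mono)
    finally have fin: "4 * (1 / 2) ^ n * (sqrt (2 * c * \<mu> * e / pi ^ 3) * (e / \<mu>) * S) * (B + 17 / 4 * \<mu>)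
       \<le> real n * sqrt (real n)" by (simp add: mult_right_mono)
    have "real n * sqrt (real n) > 0" using n0 by simp
    then show ?thesis unfolding e_def[symmetric] B_def[symmetric] key by (rule divide_le_eq_1_pos[THEN iffD2, OF _ fin])
  qed
qed

text \<open>\<delta> is the approximation error of a history, and the left side bounds the loss
  under projection divided by \<open>2 * h * \<kappa>1\<close>. With
  \<open>y = \<mu> * exp 1\<close> and \<open>x = n - 3 / 2\<close>, the Lambert function is chosen
  such that \<open>x * ln (x / y) \<ge> - ln (\<rho> * \<epsilon>)\<close>, that is
  \<open>(y / x) powr x \<le> \<rho> * \<epsilon>\<close>. The exponent \<open>3 / 2\<close> by
  which \<open>n\<close> exceeds \<open>x\<close> is left to \<open>rho_bound\<close>.\<close>

lemma N_fun_sufficient: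
  assumes h: "h > 0" and r: "r_const A Ad > 0" and \<epsilon>: "\<epsilon> > 0"
  defines "\<mu> \<equiv> mu_const h A Ad" and "n \<equiv> N_fun h A Ad \<epsilon>"
  defines "\<delta> \<equiv> 4 * (\<mu> / 2) ^ n / fact n"
  shows "\<delta> * (exp (2 * \<mu>) * (\<delta> / 2) + 4 * \<mu> + \<mu> * \<delta>) \<le> \<epsilon>" "n \<ge> 4"
proof -
  define \<rho> where "\<rho> = rho_const h A Ad"
  define W where "W = lambert_W (- ln (\<rho> * \<epsilon>) / (\<mu> * exp 1))"
  define y where "y = \<mu> * exp 1"
  define x where "x = real n - 3 / 2"
  have \<mu>: "\<mu> > 0" using h r by (simp add: \<mu>_def mu_const_def)
  have y: "y > 0" using \<mu> by (simp add: y_def)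
  have \<rho>_eq: "\<rho> = sqrt (2 * real_of_int \<lceil>\<mu>\<rceil> / pi ^ 3) * (1 / \<mu>\<^sup>2)
      * (\<mu> * exp 1 / (real_of_int \<lceil>\<mu>\<rceil> + 1 / 2)) powr (real_of_int \<lceil>\<mu>\<rceil> + 1 / 2)"
    by (simp add: \<rho>_def rho_const_def Let_def \<mu>_def)
  have \<rho>: "\<rho> > 0"
  proof -
    have "real_of_int \<lceil>\<mu>\<rceil> > 0" using \<mu> by simp
    moreover from this have "real_of_int \<lceil>\<mu>\<rceil> + 1 / 2 \<noteq> 0" by linarith
    ultimately show ?thesis unfolding \<rho>_eq using \<mu> by (intro mult_pos_pos) auto
  qed
  define k where "k = max 4 \<lceil>3 / 2 + \<mu> * exp (1 + W)\<rceil>"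
  have "n = nat k" by (simp add: n_def N_fun_def Let_def \<mu>_def \<rho>_def W_def k_def)
  moreover have k: "4 \<le> k" "\<lceil>3 / 2 + \<mu> * exp (1 + W)\<rceil> \<le> k" by (simp_all add: k_def)
  ultimately have "real n = real_of_int k" by simp
  then have n: "real n \<ge> 4" "real n \<ge> 3 / 2 + \<mu> * exp (1 + W)"
    using k by (simp, simp add: ceiling_le_iff)
  then show n4: "n \<ge> 4" by simp
  have W0: "W \<ge> 0"
    unfolding W_def using lambert_W by (cases "- ln (\<rho> * \<epsilon>) / (\<mu> * exp 1) \<ge> 0") (auto simp: lambert_W_def)
  have x: "x \<ge> y * exp W" using n(2) by (simp add: x_def y_def exp_add)
  have "y * 1 \<le> y * exp W" using W0 y by (intro mult_left_mono) auto
  then have xy: "x \<ge> y" using x by simp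
  have x0: "x > 0" using xy y by simp
  define L where "L = ln (x / y)"
  have LW: "L \<ge> W" using x y x0 unfolding L_def by (subst ln_ge_iff) (auto simp: field_simps)
  have "- ln (\<rho> * \<epsilon>) \<le> x * L"
  proof (cases "- ln (\<rho> * \<epsilon>) / (\<mu> * exp 1) \<ge> 0")
    case True
    then have "W * exp W = - ln (\<rho> * \<epsilon>) / y" using lambert_W by (simp add: W_def y_def)
    then have "- ln (\<rho> * \<epsilon>) = (y * exp W) * W" using y by (simp add: field_simps)
    also have "\<dots> \<le> x * L" using x LW W0 x0 y by (intro mult_mono) auto
    finally show ?thesis .
  next
    \<comment> \<open>Now \<open>\<rho> * \<epsilon> > 1\<close> and \<open>W = 0\<close> by
      convention. The bound \<open>x \<ge> y\<close> still holds and makes the right side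
      nonnegative.\<close>
    case False
    then have "- ln (\<rho> * \<epsilon>) < 0" using y by (simp add: y_def[symmetric] zero_le_divide_iff zero_less_divide_iff not_le)
    also have "0 \<le> x * L" using x0 LW W0 by simp
    finally show ?thesis by simp
  qed
  moreover have "ln ((y / x) powr x) = - (x * L)"
    using y x0 by (simp add: ln_powr L_def ln_div algebra_simps)
  ultimately have "ln ((y / x) powr x) \<le> ln (\<rho> * \<epsilon>)" by simp
  then have 1: "(y / x) powr x \<le> \<rho> * \<epsilon>"
    using \<rho> \<epsilon> y x0 by (subst (asm) ln_le_cancel_iff) auto
  have xn: "x < real n" by (simp add: x_def)
  have 2: "(y / real n) ^ n \<le> (y / x) powr x * (y / real n) powr (3 / 2)"
  proof -
    have "(y / real n) ^ n = (y / real n) powr (x + 3 / 2)"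
      using n4 y by (simp add: powr_realpow[symmetric] x_def)
    also have "\<dots> = (y / real n) powr x * (y / real n) powr (3 / 2)" by (rule powr_add)
    also have "\<dots> \<le> (y / x) powr x * (y / real n) powr (3 / 2)"
      using xn x0 y by (intro mult_right_mono powr_mono2 divide_left_mono) auto
    finally show ?thesis .
  qed
  have \<delta>1: "\<delta> \<le> 4 * (1 / 2) ^ n * (y / real n) ^ n"
  proof -
    have "\<delta> \<le> 4 * (\<mu> / 2) ^ n / (real n / exp 1) ^ n"
      unfolding \<delta>_def using fact_ge_power_exp[of n] n4 \<mu> by (intro divide_left_mono) auto
    also have "\<dots> = 4 * (1 / 2) ^ n * (y / real n) ^ n"
      by (simp add: y_def power_divide power_mult_distrib)
    finally show ?thesis .
  qed
  have \<delta>0: "\<delta> \<ge> 0" using \<mu> by (simp add: \<delta>_def)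
  define B where "B = 2 * (1 / 2) ^ n * exp (2 * \<mu>)"
  \<comment> \<open>Inside the bracket the crude bound \<open>\<delta> \<le> 4 * (1 / 2) ^ n\<close>
    suffices; the sharp bound is spent on the outer factor \<delta>. With \<open>n \<ge> 4\<close>
    this gives \<open>\<delta> \<le> 1 / 4\<close>, whence \<open>17 / 4\<close> for
    \<open>4 + \<delta>\<close>.\<close>
  have "y / real n \<le> 1" using xy xn n4 by simp
  then have yn: "(y / real n) ^ n \<le> 1" using y by (intro power_le_one) auto
  have "4 * (1 / 2) ^ n * (y / real n) ^ n \<le> 4 * (1 / 2) ^ n * 1" using yn by (intro mult_left_mono) auto
  from order_trans[OF \<delta>1 this] have \<delta>2: "\<delta> \<le> 4 * (1 / 2) ^ n" by simp
  moreover have "(1 / 2 :: real) ^ n \<le> 1 / 16"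
    using power_decreasing[of 4 n "1 / 2 :: real"] n4 by (simp add: power_divide)
  ultimately have "\<delta> \<le> 1 / 4" by linarith
  then have "\<mu> * \<delta> \<le> 1 / 4 * \<mu>" using mult_left_mono[of \<delta> "1 / 4" \<mu>] \<mu> by simp
  moreover have "exp (2 * \<mu>) * (\<delta> / 2) \<le> B" using \<delta>2 mult_left_mono[of "\<delta> / 2" "2 * (1 / 2) ^ n" "exp (2 * \<mu>)"]
    by (simp add: B_def mult.commute)
  ultimately have "exp (2 * \<mu>) * (\<delta> / 2) + 4 * \<mu> + \<mu> * \<delta> \<le> B + 17 / 4 * \<mu>" by simp
  then have "\<delta> * (exp (2 * \<mu>) * (\<delta> / 2) + 4 * \<mu> + \<mu> * \<delta>) \<le> \<delta> * (B + 17 / 4 * \<mu>)"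
    using \<delta>0 by (intro mult_left_mono)
  also have "\<dots> \<le> (4 * (1 / 2) ^ n * ((\<rho> * \<epsilon>) * (y / real n) powr (3 / 2))) * (B + 17 / 4 * \<mu>)"
  proof (rule mult_right_mono)
    have "\<delta> \<le> 4 * (1 / 2) ^ n * ((y / x) powr x * (y / real n) powr (3 / 2))"
      using order_trans[OF \<delta>1 mult_left_mono[OF 2, of "4 * (1 / 2) ^ n"]] by simp
    also have "\<dots> \<le> 4 * (1 / 2) ^ n * ((\<rho> * \<epsilon>) * (y / real n) powr (3 / 2))"
      using 1 by (intro mult_left_mono mult_right_mono) auto
    finally show "\<delta> \<le> 4 * (1 / 2) ^ n * ((\<rho> * \<epsilon>) * (y / real n) powr (3 / 2))" .
  qed (use \<mu> in \<open>simp add: B_def\<close>)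
  also have "\<dots> = (4 * (1 / 2) ^ n * (y / real n) powr (3 / 2) * \<rho> * (B + 17 / 4 * \<mu>)) * \<epsilon>" by simp
  also have "\<dots> \<le> 1 * \<epsilon>"
  proof (rule mult_right_mono)
    show "4 * (1 / 2) ^ n * (y / real n) powr (3 / 2) * \<rho> * (B + 17 / 4 * \<mu>) \<le> 1"
      unfolding y_def B_def using xy by (intro rho_bound[OF \<mu> n4 _ \<rho>_eq refl]) (simp add: x_def y_def)
  qed (use \<epsilon> in simp)
  finally show "\<delta> * (exp (2 * \<mu>) * (\<delta> / 2) + 4 * \<mu> + \<mu> * \<delta>) \<le> \<epsilon>" by simp
qed

section \<open>The matrix as a restriction of the functional\<close>

lemma bounded_bilinear_matrix_matrix:
  "bounded_bilinear ((**) :: real ^ 'n ^ 'm \<Rightarrow> real ^ 'p ^ 'n \<Rightarrow> real ^ 'p ^ 'm)"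
  unfolding bilinear_conv_bounded_bilinear[symmetric] bilinear_def
  using bounded_linear.linear[OF bounded_linear_matrix_mult_right] bounded_linear.linear[OF bounded_linear_matrix_mult_left]
  by auto

lemmas continuous_on_matrix_matrix [continuous_intros] =
  bounded_bilinear.continuous_on[OF bounded_bilinear_matrix_matrix]

lemmas continuous_on_transpose [continuous_intros] =
  bounded_linear.continuous_on[OF bounded_linear_transpose]

lemmas scaleR_matrix_mult =
  bounded_bilinear.scaleR_left[OF bounded_bilinear_matrix_matrix]
  bounded_bilinear.scaleR_right[OF bounded_bilinear_matrix_matrix]

lemma leg_block_left: "leg_block h k \<tau> ** X = legendre h k \<tau> *\<^sub>R X" for X :: "real ^ 'm ^ 'm"
  by (simp add: leg_block_def scaleR_matrix_mult)

lemma leg_block_right: "X ** transpose (leg_block h k \<tau>) = legendre h k \<tau> *\<^sub>R X" for X :: "real ^ 'm ^ 'm"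
  by (simp add: leg_block_def transpose_scalar scaleR_matrix_mult transpose_mat)

lemma inner_matrix_vector: "x \<bullet> (M *v y) = (\<Sum>a\<in>UNIV. \<Sum>b\<in>UNIV. x $ a * M $ a $ b * y $ b)"
  for M :: "real ^ 'n ^ 'm"
  by (simp add: inner_vec_def matrix_vector_mult_def sum_distrib_left mult.assoc)

lemma bounded_linear_inner_matrix_vector: "bounded_linear (\<lambda>M :: real ^ 'n ^ 'm. x \<bullet> (M *v y))"
  using bounded_linear_compose[OF bounded_linear_inner_right bounded_linear_matrix_vector_left] .

lemma sum_P_index: "(\<Sum>i\<in>P_index n. f i) = (\<Sum>a\<in>UNIV. f (Inl a)) + (\<Sum>k<n. \<Sum>a\<in>UNIV. f (Inr (k, a)))"
  for f :: "('m::finite) + nat \<times> 'm \<Rightarrow> real"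
  unfolding P_index_def by (subst sum.Plus) (auto simp: sum.cartesian_product)

context lyapunov_delay
begin

lemma Q_block_eq: "Q_block h A Ad k = integral {-h..0} (\<lambda>\<tau>. legendre h k \<tau> *\<^sub>R (transpose (U (h + \<tau>)) ** Ad))"
  by (simp add: Q_block_def leg_block_right)

lemma Q_block_inner:
  "((\<lambda>\<tau>. legendre h k \<tau> * ((U (h + \<tau>) *v x) \<bullet> (Ad *v c))) has_integral x \<bullet> (Q_block h A Ad k *v c)) {-h..0}"
proof -
  have "(\<lambda>\<tau>. legendre h k \<tau> *\<^sub>R (transpose (U (h + \<tau>)) ** Ad)) integrable_on {-h..0}"
    using h_pos by (intro integrable_continuous_real continuous_intros) auto
  from has_integral_linear[OF integrable_integral[OF this] bounded_linear_inner_matrix_vector[of x c]]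
  show ?thesis
    by (simp add: Q_block_eq o_def scaleR_matrix_vector_assoc[symmetric] matrix_vector_mul_assoc[symmetric]
      inner_transpose_right)
qed

lemma T_block_eq: "T_block h A Ad j k = integral {-h..0} (\<lambda>\<tau>2. integral {-h..0} (\<lambda>\<tau>1.
    (legendre h j \<tau>1 * legendre h k \<tau>2) *\<^sub>R (transpose Ad ** U (\<tau>1 - \<tau>2) ** Ad)))"
  by (simp add: T_block_def leg_block_left leg_block_right scaleR_matrix_mult mult.commute)

lemma T_block_inner:
  "x \<bullet> (T_block h A Ad j k *v y) = integral {-h..0} (\<lambda>\<tau>2. integral {-h..0} (\<lambda>\<tau>1.
    (legendre h j \<tau>1 * legendre h k \<tau>2) * ((Ad *v x) \<bullet> (U (\<tau>1 - \<tau>2) *v (Ad *v y)))))"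
proof -
  define M where "M \<tau>2 \<tau>1 = (legendre h j \<tau>1 * legendre h k \<tau>2) *\<^sub>R (transpose Ad ** U (\<tau>1 - \<tau>2) ** Ad)" for \<tau>2 \<tau>1
  have cM: "continuous_on ({-h..0} \<times> cbox (-h) 0) (\<lambda>(t, s). M t s)"
    unfolding M_def case_prod_unfold using h_pos by (intro continuous_intros) auto
  have 1: "(\<lambda>\<tau>2. integral {-h..0} (M \<tau>2)) integrable_on {-h..0}"
    using integral_continuous_on_param[OF cM] by (intro integrable_continuous_real) simp
  have 2: "M \<tau>2 integrable_on {-h..0}" for \<tau>2
    unfolding M_def using h_pos by (intro integrable_continuous_real continuous_intros) auto
  have L: "x \<bullet> (integral {-h..0} g *v y) = integral {-h..0} (\<lambda>\<tau>. x \<bullet> (g \<tau> *v y))" if "g integrable_on {-h..0}"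
    for g :: "real \<Rightarrow> real ^ 'm ^ 'm"
    using integral_linear[OF that bounded_linear_inner_matrix_vector[of x y]] by (simp add: o_def)
  have "x \<bullet> (T_block h A Ad j k *v y) = integral {-h..0} (\<lambda>\<tau>2. integral {-h..0} (\<lambda>\<tau>1. x \<bullet> (M \<tau>2 \<tau>1 *v y)))"
    unfolding T_block_eq M_def[symmetric] L[OF 1] L[OF 2] ..
  then show ?thesis
    by (simp add: M_def scaleR_matrix_vector_assoc[symmetric] matrix_vector_mul_assoc[symmetric] inner_transpose_right)
qed

text \<open>Transposing the integrand reflects the argument of \<open>U\<close>, which exchanges the
  two variables; the order of integration is then exchanged by continuity.\<close>

lemma T_block_transpose: "T_block h A Ad k j = transpose (T_block h A Ad j k)"
proof -
  define M where "M k j \<tau>2 \<tau>1 = (legendre h j \<tau>1 * legendre h k \<tau>2) *\<^sub>R (transpose Ad ** U (\<tau>1 - \<tau>2) ** Ad)" for \<tau>2 \<tau>1 k j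
  have cM: "continuous_on ({-h..0} \<times> cbox (-h) 0) (\<lambda>(t, s). M k j t s)" for j k
    unfolding M_def case_prod_unfold using h_pos by (intro continuous_intros) auto
  have 1: "(\<lambda>\<tau>2. integral {-h..0} (M k j \<tau>2)) integrable_on {-h..0}" for j k
    using integral_continuous_on_param[OF cM] by (intro integrable_continuous_real) simp
  have 2: "M k j \<tau>2 integrable_on {-h..0}" for \<tau>2 j k
    unfolding M_def using h_pos by (intro integrable_continuous_real continuous_intros) auto
  have tr: "transpose (M k j s t) = M j k t s" for s t j k
    using U_minus[of "t - s"]
    by (simp add: M_def transpose_scalar matrix_transpose_mul matrix_mul_assoc mult.commute)
  have L: "transpose (integral {-h..0} g) = integral {-h..0} (\<lambda>\<tau>. transpose (g \<tau>))" if "g integrable_on {-h..0}"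
    for g :: "real \<Rightarrow> real ^ 'm ^ 'm"
    using integral_linear[OF that bounded_linear_transpose] by (simp add: o_def)
  have "transpose (T_block h A Ad j k) = integral {-h..0} (\<lambda>s. integral {-h..0} (\<lambda>t. M j k t s))"
    unfolding T_block_eq M_def[symmetric] L[OF 1] L[OF 2] tr ..
  also have "\<dots> = integral {-h..0} (\<lambda>t. integral {-h..0} (\<lambda>s. M j k t s))"
  proof -
    have "continuous_on (cbox (-h, -h) (0, 0)) (\<lambda>(s, t). M j k t s)"
      using continuous_on_swap_args[OF cM[of j k]] by (simp add: cbox_Pair_eq)
    from integral_swap_continuous[OF this] show ?thesis by simp
  qed
  also have "\<dots> = T_block h A Ad k j" by (simp add: T_block_eq M_def)
  finally show ?thesis ..
qed

lemma P_mat_symmetric: "P_mat h A Ad i j = P_mat h A Ad j i"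
proof (cases i; cases j)
  fix a b assume "i = Inl a" "j = Inl b"
  moreover have "U 0 $ a $ b = transpose (U 0) $ b $ a" by (simp add: transpose_def)
  moreover have "transpose (U 0) = U 0" by (simp add: U_nonneg G_0_symmetric)
  ultimately show ?thesis by simp
next
  fix a p assume "i = Inl a" "j = Inr p"
  then show ?thesis by (cases p) (simp add: transpose_def)
next
  fix a p assume "i = Inr p" "j = Inl a"
  then show ?thesis by (cases p) (simp add: transpose_def)
next
  fix p q assume "i = Inr p" "j = Inr q"
  moreover obtain k a where p: "p = (k, a)" by (cases p)
  moreover obtain l b where q: "q = (l, b)" by (cases q)
  moreover have "T_block h A Ad l k $ b $ a = T_block h A Ad k l $ a $ b"
    by (subst T_block_transpose) (simp add: transpose_def)
  moreover have "I_inv_block h l k $ b $ a = I_inv_block h k l $ a $ b"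
    by (simp add: I_inv_block_def mat_def)
  ultimately show ?thesis by simp
qed

text \<open>Orthogonality of the Legendre polynomials turns the contribution of
  \<open>I_inv_block\<close> into the squared norm of the polynomial segment. The other blocks
  reproduce the remaining terms by bilinearity.\<close>

lemma P_mat_quadratic_form:
  fixes v :: "'m + nat \<times> 'm \<Rightarrow> real"
  defines "x \<equiv> \<chi> a. v (Inl a)" and "c \<equiv> \<lambda>k. \<chi> a. v (Inr (k, a))"
  shows "(\<Sum>i\<in>P_index n. \<Sum>j\<in>P_index n. v i * P_mat h A Ad i j * v j) = lk x (leg_sum h n c)"
proof -
  let ?f = "leg_sum h n c"
  have x: "v (Inl a) = x $ a" and c: "v (Inr (k, a)) = c k $ a" for a k
    by (simp_all add: x_def c_def)
  have q1: "(\<Sum>a\<in>UNIV. \<Sum>k<n. \<Sum>b\<in>UNIV. x $ a * Q_block h A Ad k $ a $ b * c k $ b)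
      = (\<Sum>k<n. x \<bullet> (Q_block h A Ad k *v c k))"
    by (subst sum.swap) (simp add: inner_matrix_vector)
  have q2: "(\<Sum>k<n. \<Sum>b\<in>UNIV. \<Sum>a\<in>UNIV. c k $ b * transpose (Q_block h A Ad k) $ b $ a * x $ a)
      = (\<Sum>k<n. x \<bullet> (Q_block h A Ad k *v c k))"
  proof (rule sum.cong)
    fix k
    have "(\<Sum>b\<in>UNIV. \<Sum>a\<in>UNIV. c k $ b * transpose (Q_block h A Ad k) $ b $ a * x $ a)
      = c k \<bullet> (transpose (Q_block h A Ad k) *v x)" by (simp only: inner_matrix_vector)
    also have "\<dots> = x \<bullet> (Q_block h A Ad k *v c k)" by (simp only: inner_transpose_right) (rule inner_commute)
    finally show "(\<Sum>b\<in>UNIV. \<Sum>a\<in>UNIV. c k $ b * transpose (Q_block h A Ad k) $ b $ a * x $ a)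
      = x \<bullet> (Q_block h A Ad k *v c k)" .
  qed simp
  have t1: "(\<Sum>j<n. \<Sum>a\<in>UNIV. \<Sum>k<n. \<Sum>b\<in>UNIV. c j $ a * (T_block h A Ad j k + I_inv_block h j k) $ a $ b * c k $ b)
    = (\<Sum>j<n. \<Sum>k<n. c j \<bullet> (T_block h A Ad j k *v c k)) + (\<Sum>j<n. \<Sum>k<n. c j \<bullet> (I_inv_block h j k *v c k))"
  proof -
    have "(\<Sum>a\<in>UNIV. \<Sum>k<n. \<Sum>b\<in>UNIV. c j $ a * (T_block h A Ad j k + I_inv_block h j k) $ a $ b * c k $ b)
       = (\<Sum>k<n. c j \<bullet> ((T_block h A Ad j k + I_inv_block h j k) *v c k))" for j
      by (subst sum.swap) (simp only: inner_matrix_vector)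
    then show ?thesis by (simp only: matrix_vector_mult_add_rdistrib inner_add_right sum.distrib)
  qed
  have "(\<Sum>j<n. \<Sum>k<n. c j \<bullet> (I_inv_block h j k *v c k)) = (\<Sum>j<n. \<Sum>k<n. if j = k then h / (2 * real k + 1) * (c k \<bullet> c k) else 0)"
    by (intro sum.cong) (auto simp: I_inv_block_def scaleR_matrix_vector_assoc[symmetric])
  also have "\<dots> = (\<Sum>k<n. h / (2 * real k + 1) * (c k \<bullet> c k))"
    by (intro sum.cong) auto
  also have "\<dots> = integral {-h..0} (\<lambda>\<tau>. ?f \<tau> \<bullet> ?f \<tau>)"
    using leg_sum_norm_square[OF h_pos, of n c] by (simp add: has_integral_iff)
  finally have I: "(\<Sum>j<n. \<Sum>k<n. c j \<bullet> (I_inv_block h j k *v c k)) = integral {-h..0} (\<lambda>\<tau>. ?f \<tau> \<bullet> ?f \<tau>)" .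
  have Adf: "Ad *v ?f \<tau> = (\<Sum>k<n. legendre h k \<tau> *\<^sub>R (Ad *v c k))" for \<tau>
    unfolding leg_sum_def
    by (simp add: linear_sum[OF bounded_linear.linear[OF matrix_vector_mul_bounded_linear]] matrix_vector_mult_scaleR)
  have Q: "(\<Sum>k<n. x \<bullet> (Q_block h A Ad k *v c k)) = integral {-h..0} (\<lambda>\<tau>. (U (h + \<tau>) *v x) \<bullet> (Ad *v ?f \<tau>))"
  proof -
    have "((\<lambda>\<tau>. \<Sum>k<n. legendre h k \<tau> * ((U (h + \<tau>) *v x) \<bullet> (Ad *v c k))) has_integral
       (\<Sum>k<n. x \<bullet> (Q_block h A Ad k *v c k))) {-h..0}"
      by (intro has_integral_sum Q_block_inner) auto
    then show ?thesis unfolding Adf by (simp add: inner_sum_right has_integral_iff)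
  qed
  have T: "(\<Sum>j<n. \<Sum>k<n. c j \<bullet> (T_block h A Ad j k *v c k)) =
     integral {-h..0} (\<lambda>\<tau>2. integral {-h..0} (\<lambda>\<tau>1. (Ad *v ?f \<tau>1) \<bullet> (U (\<tau>1 - \<tau>2) *v (Ad *v ?f \<tau>2))))"
  proof -
    define m where "m j k \<tau>2 \<tau>1 = (legendre h j \<tau>1 * legendre h k \<tau>2) * ((Ad *v c j) \<bullet> (U (\<tau>1 - \<tau>2) *v (Ad *v c k)))" for j k \<tau>2 \<tau>1
    have cm: "continuous_on ({-h..0} \<times> cbox (-h) 0) (\<lambda>(t, s). m j k t s)" for j k
      unfolding m_def case_prod_unfold using h_pos by (intro continuous_intros) auto
    have 1: "(\<lambda>\<tau>2. integral {-h..0} (m j k \<tau>2)) integrable_on {-h..0}" for j k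
      using integral_continuous_on_param[OF cm] by (intro integrable_continuous_real) simp
    have 2: "m j k \<tau>2 integrable_on {-h..0}" for \<tau>2 j k
      unfolding m_def using h_pos by (intro integrable_continuous_real continuous_intros) auto
    have "(\<Sum>j<n. \<Sum>k<n. c j \<bullet> (T_block h A Ad j k *v c k)) = (\<Sum>j<n. \<Sum>k<n. integral {-h..0} (\<lambda>\<tau>2. integral {-h..0} (m j k \<tau>2)))"
      unfolding T_block_inner m_def ..
    also have "\<dots> = integral {-h..0} (\<lambda>\<tau>2. \<Sum>j<n. \<Sum>k<n. integral {-h..0} (m j k \<tau>2))"
      by (simp add: integral_sum integrable_sum 1)
    also have "\<dots> = integral {-h..0} (\<lambda>\<tau>2. integral {-h..0} (\<lambda>\<tau>1. \<Sum>j<n. \<Sum>k<n. m j k \<tau>2 \<tau>1))"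
      by (simp add: integral_sum integrable_sum 2)
    also have "(\<lambda>\<tau>2. integral {-h..0} (\<lambda>\<tau>1. \<Sum>j<n. \<Sum>k<n. m j k \<tau>2 \<tau>1)) =
       (\<lambda>\<tau>2. integral {-h..0} (\<lambda>\<tau>1. (Ad *v ?f \<tau>1) \<bullet> (U (\<tau>1 - \<tau>2) *v (Ad *v ?f \<tau>2))))"
    proof (intro ext arg_cong[where f = "integral {-h..0}"])
      fix \<tau>2 \<tau>1
      have "U (\<tau>1 - \<tau>2) *v (Ad *v ?f \<tau>2) = (\<Sum>k<n. legendre h k \<tau>2 *\<^sub>R (U (\<tau>1 - \<tau>2) *v (Ad *v c k)))"
        unfolding Adf
        by (simp add: linear_sum[OF bounded_linear.linear[OF matrix_vector_mul_bounded_linear]] matrix_vector_mult_scaleR)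
      then show "(\<Sum>j<n. \<Sum>k<n. m j k \<tau>2 \<tau>1) = (Ad *v ?f \<tau>1) \<bullet> (U (\<tau>1 - \<tau>2) *v (Ad *v ?f \<tau>2))"
        unfolding Adf[of \<tau>1] inner_sum_left by (simp add: inner_sum_right m_def sum_distrib_left mult_ac)
    qed
    finally show ?thesis .
  qed
  have "(\<Sum>i\<in>P_index n. \<Sum>j\<in>P_index n. v i * P_mat h A Ad i j * v j)
    = x \<bullet> (U 0 *v x) + (\<Sum>a\<in>UNIV. \<Sum>k<n. \<Sum>b\<in>UNIV. x $ a * Q_block h A Ad k $ a $ b * c k $ b)
      + ((\<Sum>k<n. \<Sum>b\<in>UNIV. \<Sum>a\<in>UNIV. c k $ b * transpose (Q_block h A Ad k) $ b $ a * x $ a)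
      + (\<Sum>j<n. \<Sum>a\<in>UNIV. \<Sum>k<n. \<Sum>b\<in>UNIV. c j $ a * (T_block h A Ad j k + I_inv_block h j k) $ a $ b * c k $ b))"
    by (simp only: sum_P_index P_mat.simps x c sum.distrib inner_matrix_vector)
  also have "\<dots> = lk x ?f"
    unfolding q1 q2 t1 I Q T lk_def by simp
  finally show ?thesis .
qed

lemma positive_definite_iff:
  "positive_definite_on (P_index n) (P_mat h A Ad) \<longleftrightarrow>
    (\<forall>x c. x \<noteq> 0 \<or> (\<exists>k<n. c k \<noteq> 0) \<longrightarrow> 0 < lk x (leg_sum h n c))"
proof
  assume pd: "positive_definite_on (P_index n) (P_mat h A Ad)"
  show "\<forall>x c. x \<noteq> 0 \<or> (\<exists>k<n. c k \<noteq> 0) \<longrightarrow> 0 < lk x (leg_sum h n c)"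
  proof (intro allI impI)
    fix x :: "real ^ 'm" and c :: "nat \<Rightarrow> real ^ 'm"
    assume nz: "x \<noteq> 0 \<or> (\<exists>k<n. c k \<noteq> 0)"
    define v where "v i = (case i of Inl a \<Rightarrow> x $ a | Inr (k, a) \<Rightarrow> c k $ a)" for i
    have "\<exists>i\<in>P_index n. v i \<noteq> 0"
    proof (cases "x = 0")
      case True
      then obtain k where k: "k < n" "c k \<noteq> 0" using nz by auto
      then obtain a where "c k $ a \<noteq> 0" by (auto simp: vec_eq_iff)
      then show ?thesis using k by (intro bexI[of _ "Inr (k, a)"]) (auto simp: v_def P_index_def)
    next
      case False
      then obtain a where "x $ a \<noteq> 0" by (auto simp: vec_eq_iff)
      then show ?thesis by (intro bexI[of _ "Inl a"]) (auto simp: v_def P_index_def)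
    qed
    then have "0 < (\<Sum>i\<in>P_index n. \<Sum>j\<in>P_index n. v i * P_mat h A Ad i j * v j)"
      using pd unfolding positive_definite_on_def by blast
    also have "\<dots> = lk x (leg_sum h n c)"
      unfolding P_mat_quadratic_form by (simp add: v_def)
    finally show "0 < lk x (leg_sum h n c)" .
  qed
next
  assume pos: "\<forall>x c. x \<noteq> 0 \<or> (\<exists>k<n. c k \<noteq> 0) \<longrightarrow> 0 < lk x (leg_sum h n c)"
  show "positive_definite_on (P_index n) (P_mat h A Ad)"
    unfolding positive_definite_on_def
  proof (intro conjI ballI allI impI)
    show "P_mat h A Ad i j = P_mat h A Ad j i" for i j by (rule P_mat_symmetric)
    fix v :: "'m + nat \<times> 'm \<Rightarrow> real" assume "\<exists>i\<in>P_index n. v i \<noteq> 0"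
    then have nz: "(\<chi> a. v (Inl a)) \<noteq> 0 \<or> (\<exists>k<n. (\<chi> a. v (Inr (k, a))) \<noteq> 0)"
      by (auto simp: P_index_def vec_eq_iff)
    show "0 < (\<Sum>i\<in>P_index n. \<Sum>j\<in>P_index n. v i * P_mat h A Ad i j * v j)"
      unfolding P_mat_quadratic_form by (rule pos[rule_format, OF nz])
  qed
qed

end

section \<open>Solutions of the time-delay system\<close>

lemma norm_mult_vec_le: "norm (X *v x) \<le> spec_norm X * norm x" for X :: "real ^ 'n ^ 'm"
  unfolding spec_norm_def by (rule onorm) (rule matrix_vector_mul_bounded_linear)

lemma spec_norm_nonneg: "spec_norm X \<ge> 0" for X :: "real ^ 'n ^ 'm"
  unfolding spec_norm_def by (rule onorm_pos_le) (rule matrix_vector_mul_bounded_linear)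

lemma spec_norm_leI: "0 \<le> b \<Longrightarrow> (\<And>x. norm (X *v x) \<le> b * norm x) \<Longrightarrow> spec_norm X \<le> b"
  for X :: "real ^ 'n ^ 'm"
  unfolding spec_norm_def by (rule onorm_bound)

lemma spec_norm_mult: "spec_norm (X ** Y) \<le> spec_norm X * spec_norm Y"
  for X :: "real ^ 'n ^ 'm" and Y :: "real ^ 'p ^ 'n"
proof (rule spec_norm_leI)
  fix x
  have "norm ((X ** Y) *v x) \<le> spec_norm X * norm (Y *v x)"
    by (simp add: matrix_vector_mul_assoc[symmetric] norm_mult_vec_le)
  also have "\<dots> \<le> spec_norm X * (spec_norm Y * norm x)"
    by (intro mult_left_mono norm_mult_vec_le spec_norm_nonneg)
  finally show "norm ((X ** Y) *v x) \<le> spec_norm X * spec_norm Y * norm x" by (simp add: mult.assoc)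
qed (simp add: spec_norm_nonneg)

lemma spec_norm_add: "spec_norm (X + Y) \<le> spec_norm X + spec_norm Y" for X :: "real ^ 'n ^ 'm"
proof (rule spec_norm_leI)
  fix x
  show "norm ((X + Y) *v x) \<le> (spec_norm X + spec_norm Y) * norm x"
    using norm_triangle_ineq[of "X *v x" "Y *v x"] norm_mult_vec_le[of X x] norm_mult_vec_le[of Y x]
    by (simp add: matrix_vector_mult_add_rdistrib distrib_right)
qed (simp add: spec_norm_nonneg)

lemma spec_norm_minus: "spec_norm (- X) = spec_norm X" for X :: "real ^ 'n ^ 'm"
proof -
  have "(*v) (- X) = (\<lambda>x. - (X *v x))"
    by (simp add: fun_eq_iff vec_eq_iff matrix_vector_mult_def sum_negf)
  then show ?thesis by (simp add: spec_norm_def onorm_neg)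
qed

lemma spec_norm_transpose_le: "spec_norm (transpose X) \<le> spec_norm X" for X :: "real ^ 'n ^ 'm"
proof (rule spec_norm_leI)
  fix x :: "real ^ 'm"
  let ?y = "transpose X *v x"
  have "norm ?y * norm ?y = ?y \<bullet> ?y" by (simp add: dot_square_norm power2_eq_square)
  also have "\<dots> = x \<bullet> (X *v ?y)" by (simp add: transpose_matrix_vector dot_lmul_matrix)
  also have "\<dots> \<le> norm x * norm (X *v ?y)" by (rule norm_cauchy_schwarz)
  also have "\<dots> \<le> norm x * (spec_norm X * norm ?y)" by (intro mult_left_mono norm_mult_vec_le) auto
  finally have "norm ?y * norm ?y \<le> (spec_norm X * norm x) * norm ?y" by (simp add: mult_ac)
  then show "norm ?y \<le> spec_norm X * norm x"
    by (cases "norm ?y = 0") (auto simp: mult_le_cancel_right spec_norm_nonneg)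
qed (rule spec_norm_nonneg)

lemma spec_norm_transpose: "spec_norm (transpose X) = spec_norm X" for X :: "real ^ 'n ^ 'm"
  using spec_norm_transpose_le[of X] spec_norm_transpose_le[of "transpose X"] by simp

lemma exp_has_integral:
  fixes r :: real
  assumes "a \<le> b"
  shows "((\<lambda>s. r * W * exp (r * s)) has_integral W * exp (r * b) - W * exp (r * a)) {a..b}"
proof (rule fundamental_theorem_of_calculus[OF assms])
  fix x
  show "((\<lambda>s. W * exp (r * s)) has_vector_derivative r * W * exp (r * x)) (at x within {a..b})"
    unfolding has_real_derivative_iff_has_vector_derivative[symmetric]
    by (auto intro!: derivative_eq_intros)
qed

text \<open>A Gronwall inequality that also covers delayed right-hand sides: the bound on the
  derivative may use the a priori bound at all times.\<close>

lemma gronwall_exp: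
  fixes z F :: "real \<Rightarrow> 'a::euclidean_space"
  assumes r: "r \<ge> 0" and T: "T \<ge> 0" and z: "continuous_on {0..T} z" and z0: "norm (z 0) \<le> C"
    and S: "finite S" and der: "\<And>s. s \<in> {0<..<T} - S \<Longrightarrow> (z has_vector_derivative F s) (at s)"
    and bound: "\<And>W s. W \<ge> C \<Longrightarrow> (\<And>t. t \<in> {0..T} \<Longrightarrow> norm (z t) \<le> W * exp (r * t)) \<Longrightarrow>
       s \<in> {0..T} \<Longrightarrow> norm (F s) \<le> r * W * exp (r * s)"
    and t: "t \<in> {0..T}"
  shows "norm (z t) \<le> C * exp (r * t)"
proof -
  have "\<exists>u\<in>{0..T}. \<forall>s\<in>{0..T}. norm (z s) * exp (- r * s) \<le> norm (z u) * exp (- r * u)"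
    using T by (intro continuous_attains_sup continuous_intros z) auto
  then obtain u where u: "u \<in> {0..T}" and max: "\<And>s. s \<in> {0..T} \<Longrightarrow> norm (z s) * exp (- r * s) \<le> norm (z u) * exp (- r * u)"
    by blast
  define W where "W = norm (z u) * exp (- r * u)"
  have le: "norm (z s) \<le> W * exp (r * s)" if "s \<in> {0..T}" for s
  proof -
    have "norm (z s) * exp (- r * s) * exp (r * s) \<le> W * exp (r * s)"
      using max[OF that] by (simp add: W_def mult_right_mono)
    then show ?thesis by (simp add: mult.assoc exp_add[symmetric])
  qed
  have "W \<le> C"
  proof (rule ccontr)
    assume "\<not> W \<le> C"
    then have WC: "W > C" by simp
    \<comment> \<open>The weighted maximum \<open>W\<close> is itself an a priori bound. Integrating
      the resulting derivative bound up to the maximizer \<open>u\<close> gives a value strictly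
      below \<open>W * exp (r * u)\<close>, which is the value at \<open>u\<close>.\<close>
    have FF: "norm (F s) \<le> r * W * exp (r * s)" if "s \<in> {0..T}" for s
      using bound[of W s] WC le that by simp
    have 1: "(F has_integral z u - z 0) {0..u}"
      using u by (intro fundamental_theorem_of_calculus_interior_strong[OF S] der continuous_on_subset[OF z]) auto
    have 2: "((\<lambda>s. r * W * exp (r * s)) has_integral W * exp (r * u) - W * exp (r * 0)) {0..u}"
      using u by (intro exp_has_integral) auto
    have "norm (z u - z 0) \<le> W * exp (r * u) - W * exp (r * 0)"
      using integral_norm_bound_integral[of F "{0..u}" "\<lambda>s. r * W * exp (r * s)"] FF u 1 2
      by (auto simp: has_integral_iff)
    then have "norm (z u) \<le> norm (z 0) + W * exp (r * u) - W"
      using norm_triangle_sub[of "z u" "z 0"] by simp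
    then have "norm (z u) < W * exp (r * u)" using z0 WC by simp
    moreover have "W * exp (r * u) = norm (z u)" by (simp add: W_def mult.assoc exp_add[symmetric])
    ultimately show False by simp
  qed
  then have "W * exp (r * t) \<le> C * exp (r * t)" by (intro mult_right_mono) auto
  with le[OF t] show ?thesis by (rule order_trans)
qed

text \<open>The integral of \<open>F\<close> recovers \<open>g\<close> across the exceptional
  points, and since \<open>F\<close> is continuous this integral is differentiable on the whole
  closed interval.\<close>

lemma derivative_extends_closed:
  fixes g F :: "real \<Rightarrow> 'a::banach"
  assumes g: "continuous_on {a..b} g" and F: "continuous_on {a..b} F" and S: "finite S"
    and der: "\<And>t. t \<in> {a<..<b} - S \<Longrightarrow> (g has_vector_derivative F t) (at t)"
    and t: "t \<in> {a..b}"
  shows "(g has_vector_derivative F t) (at t within {a..b})"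
proof -
  have eq: "g a + integral {a..s} F = g s" if "s \<in> {a..b}" for s
  proof -
    have "(F has_integral g s - g a) {a..s}"
      using that by (intro fundamental_theorem_of_calculus_interior_strong[OF S] der continuous_on_subset[OF g]) auto
    then show ?thesis by (simp add: has_integral_iff)
  qed
  have "((\<lambda>s. g a + integral {a..s} F) has_vector_derivative 0 + F t) (at t within {a..b})"
    by (intro has_vector_derivative_add has_vector_derivative_const integral_has_vector_derivative[OF F t])
  then show ?thesis by (intro has_vector_derivative_transform[OF t eq[symmetric]]) simp_all
qed

text \<open>One-sided limits bound \<open>f\<close> near every point, and bisection makes the bound
  global. It is needed because the supremum in \<open>seg_norm\<close> controls the values only of
  bounded functions.\<close>

lemma piecewise_continuous_bounded:
  fixes f :: "real \<Rightarrow> 'a::real_normed_vector"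
  assumes "piecewise_continuous a b f" "a \<le> b"
  shows "bounded (f ` {a..b})"
proof -
  have "bounded (f ` ({a..b} \<inter> {a..b}))" if "a \<le> b"
    using that
  proof (induction rule: Bolzano[of a b "\<lambda>u v. bounded (f ` ({u..v} \<inter> {a..b}))"])
    case (trans u v w)
    have "{u..w} \<inter> {a..b} \<subseteq> ({u..v} \<inter> {a..b}) \<union> ({v..w} \<inter> {a..b})" by auto
    then have "f ` ({u..w} \<inter> {a..b}) \<subseteq> f ` ({u..v} \<inter> {a..b}) \<union> f ` ({v..w} \<inter> {a..b})" by blast
    then show ?case using trans bounded_subset bounded_Un by metis
  next
    case (local t)
    have right: "\<exists>d>0. \<exists>B. \<forall>s. t < s \<and> s < t + d \<and> s \<le> b \<longrightarrow> norm (f s) \<le> B"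
    proof (cases "t < b")
      case True
      then obtain l where "(f \<longlongrightarrow> l) (at_right t)"
        using assms(1) local unfolding piecewise_continuous_def by fastforce
      then have "\<forall>\<^sub>F s in at_right t. dist (f s) l < 1" by (rule tendstoD) simp
      then obtain c where c: "c > t" "\<And>s. t < s \<Longrightarrow> s < c \<Longrightarrow> dist (f s) l < 1"
        by (auto simp: eventually_at_right_field)
      have "norm (f s) \<le> norm l + 1" if "t < s" "s < c" for s
        using c(2)[OF that] norm_triangle_sub[of "f s" l] by (simp add: dist_norm)
      then show ?thesis using c(1) by (intro exI[of _ "c - t"]) auto
    next
      case False
      then show ?thesis by (intro exI[of _ 1]) auto
    qed
    have left: "\<exists>d>0. \<exists>B. \<forall>s. t - d < s \<and> s < t \<and> a \<le> s \<longrightarrow> norm (f s) \<le> B"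
    proof (cases "a < t")
      case True
      then obtain l where "(f \<longlongrightarrow> l) (at_left t)"
        using assms(1) local unfolding piecewise_continuous_def by fastforce
      then have "\<forall>\<^sub>F s in at_left t. dist (f s) l < 1" by (rule tendstoD) simp
      then obtain c where c: "c < t" "\<And>s. c < s \<Longrightarrow> s < t \<Longrightarrow> dist (f s) l < 1"
        by (auto simp: eventually_at_left_field)
      have "norm (f s) \<le> norm l + 1" if "c < s" "s < t" for s
        using c(2)[OF that] norm_triangle_sub[of "f s" l] by (simp add: dist_norm)
      then show ?thesis using c(1) by (intro exI[of _ "t - c"]) auto
    next
      case False
      then show ?thesis by (intro exI[of _ 1]) auto
    qed
    obtain d1 B1 where 1: "d1 > 0" "\<And>s. t < s \<Longrightarrow> s < t + d1 \<Longrightarrow> s \<le> b \<Longrightarrow> norm (f s) \<le> B1"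
      using right by blast
    obtain d2 B2 where 2: "d2 > 0" "\<And>s. t - d2 < s \<Longrightarrow> s < t \<Longrightarrow> a \<le> s \<Longrightarrow> norm (f s) \<le> B2"
      using left by blast
    have "bounded (f ` ({u..v} \<inter> {a..b}))" if "u \<le> t" "t \<le> v" "v - u < min d1 d2" for u v
    proof (rule boundedI)
      fix y assume "y \<in> f ` ({u..v} \<inter> {a..b})"
      then obtain s where s: "y = f s" "u \<le> s" "s \<le> v" "a \<le> s" "s \<le> b" by auto
      show "norm y \<le> max (norm (f t)) (max B1 B2)"
        using 1(2)[of s] 2(2)[of s] s that by (cases s t rule: linorder_cases) (auto simp: le_max_iff_disj)
    qed
    then show ?case using 1(1) 2(1) by (intro exI[of _ "min d1 d2"]) auto
  qed
  then show ?thesis using assms(2) by simp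
qed

lemma norm_le_seg_norm:
  assumes "piecewise_continuous (-h) 0 \<phi>" "\<tau> \<in> {-h..0}"
  shows "norm (\<phi> \<tau>) \<le> seg_norm h \<phi>"
proof -
  have "bounded (\<phi> ` {-h..0})" using assms by (intro piecewise_continuous_bounded) auto
  then obtain B where "\<And>\<tau>. \<tau> \<in> {-h..0} \<Longrightarrow> norm (\<phi> \<tau>) \<le> B" unfolding bounded_iff by blast
  then show ?thesis unfolding seg_norm_def using assms
    by (intro cSUP_upper bdd_aboveI2) auto
qed

section \<open>Regularity and growth of solutions\<close>

lemma r_const_nonneg: "r_const A Ad \<ge> 0"
  by (simp add: r_const_def spec_norm_nonneg)

lemma norm_rhs_le:
  "norm x \<le> c \<Longrightarrow> norm y \<le> c \<Longrightarrow> norm (A *v x + Ad *v y) \<le> r_const A Ad * c"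
proof -
  assume "norm x \<le> c" "norm y \<le> c"
  then have "norm (A *v x) \<le> spec_norm A * c" "norm (Ad *v y) \<le> spec_norm Ad * c"
    using norm_mult_vec_le[of A x] norm_mult_vec_le[of Ad y] mult_left_mono[OF _ spec_norm_nonneg] order_trans by blast+
  then show ?thesis using norm_triangle_ineq[of "A *v x" "Ad *v y"] by (simp add: r_const_def distrib_right)
qed

lemma delay_solution_interior_derivative:
  assumes "delay_solution h A Ad \<phi> x"
  obtains S where "finite S" "\<And>t. t > 0 \<Longrightarrow> t \<notin> S \<Longrightarrow> (x has_vector_derivative A *v x t + Ad *v x (t - h)) (at t)"
proof -
  obtain S where S: "finite S" "\<And>t. t \<in> {0..} - S \<Longrightarrow> (x has_vector_derivative A *v x t + Ad *v x (t - h)) (at t within {0..})"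
    using assms unfolding delay_solution_def by blast
  have "at t within {0..} = at t" if "t > 0" for t :: real
    using that by (intro at_within_interior) simp
  then have "(x has_vector_derivative A *v x t + Ad *v x (t - h)) (at t)" if "t > 0" "t \<notin> S" for t
    using S(2)[of t] that by simp
  with S(1) show thesis by (rule that)
qed

text \<open>From time \<open>h\<close> on the delayed argument lies where the solution is
  continuous, so the right-hand side is continuous and the exceptional times disappear.\<close>

lemma delay_solution_derivative:
  assumes h: "h > 0" and sol: "delay_solution h A Ad \<phi> x" and ab: "h \<le> a" "t \<in> {a..b}"
  shows "(x has_vector_derivative A *v x t + Ad *v x (t - h)) (at t within {a..b})"
proof -
  obtain S where S: "finite S" "\<And>t. t > 0 \<Longrightarrow> t \<notin> S \<Longrightarrow> (x has_vector_derivative A *v x t + Ad *v x (t - h)) (at t)"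
    using delay_solution_interior_derivative[OF sol] by blast
  have x: "continuous_on {0..} x" using sol by (simp add: delay_solution_def)
  show ?thesis
  proof (rule derivative_extends_closed[OF _ _ S(1) _ ab(2)])
    show "continuous_on {a..b} x" using ab h by (intro continuous_on_subset[OF x]) auto
    have "continuous_on {a..b} (\<lambda>t. x (t - h))"
      using ab h by (intro continuous_on_compose2[OF x] continuous_intros) auto
    then show "continuous_on {a..b} (\<lambda>t. A *v x t + Ad *v x (t - h))"
      using ab h by (intro continuous_intros bounded_linear.continuous_on[OF matrix_vector_mul_bounded_linear]
        continuous_on_subset[OF x]) auto
    show "(x has_vector_derivative A *v x t + Ad *v x (t - h)) (at t)" if "t \<in> {a<..<b} - S" for t
      using that ab h by (intro S(2)) auto
  qed
qed

lemma delay_solution_growth: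
  assumes h: "h > 0" and \<phi>: "piecewise_continuous (-h) 0 \<phi>" and sol: "delay_solution h A Ad \<phi> x" and t: "t \<ge> 0"
  shows "norm (x t) \<le> seg_norm h \<phi> * exp (r_const A Ad * t)"
proof -
  obtain S where S: "finite S" "\<And>t. t > 0 \<Longrightarrow> t \<notin> S \<Longrightarrow> (x has_vector_derivative A *v x t + Ad *v x (t - h)) (at t)"
    using delay_solution_interior_derivative[OF sol] by blast
  have x: "continuous_on {0..} x" and x\<phi>: "\<And>\<tau>. \<tau> \<in> {-h..0} \<Longrightarrow> x \<tau> = \<phi> \<tau>"
    using sol by (auto simp: delay_solution_def)
  let ?r = "r_const A Ad" and ?C = "seg_norm h \<phi>"
  have C: "norm (x \<tau>) \<le> ?C" if "\<tau> \<in> {-h..0}" for \<tau>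
    using norm_le_seg_norm[OF \<phi> that] x\<phi>[OF that] by simp
  show ?thesis
  proof (rule gronwall_exp[where z = x and C = ?C and r = ?r and t = t and T = t and S = S and F = "\<lambda>s. A *v x s + Ad *v x (s - h)"])
    show "continuous_on {0..t} x" by (rule continuous_on_subset[OF x]) auto
    show "norm (x 0) \<le> ?C" using C[of 0] h by simp
    fix W s assume W: "W \<ge> ?C" and le: "\<And>t'. t' \<in> {0..t} \<Longrightarrow> norm (x t') \<le> W * exp (?r * t')" and s: "s \<in> {0..t}"
    have W0: "W \<ge> 0" using W C[of 0] h norm_ge_zero[of "x 0"] by (simp del: norm_ge_zero)
    have "norm (x (s - h)) \<le> W * exp (?r * s)"
    proof (cases "s - h \<ge> 0")
      case True
      have "norm (x (s - h)) \<le> W * exp (?r * (s - h))" using True s h by (intro le) auto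
      also have "\<dots> \<le> W * exp (?r * s)" using W0 h r_const_nonneg[of A Ad] by (intro mult_left_mono) (auto intro!: mult_left_mono)
      finally show ?thesis .
    next
      case False
      have "norm (x (s - h)) \<le> W * 1" using False s W C[of "s - h"] by simp
      also have "\<dots> \<le> W * exp (?r * s)" using W0 s r_const_nonneg[of A Ad] by (intro mult_left_mono) auto
      finally show ?thesis .
    qed
    from norm_rhs_le[OF le[OF s] this]
    show "norm (A *v x s + Ad *v x (s - h)) \<le> ?r * W * exp (?r * s)" by (simp add: mult.assoc)
  qed (use S t r_const_nonneg in auto)
qed

text \<open>If the stated history did not exist for some \<open>L\<close> and \<open>\<delta>\<close>, then the maximum of
  \<open>norm (x t) * exp (\<delta> * t)\<close> would always be attained on \<open>[0, L]\<close>, which is exponential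
  stability with rate \<open>\<delta>\<close>.\<close>

lemma not_exponentially_stable_growth:
  assumes h: "h > 0" and unstable: "\<not> exponentially_stable h A Ad" and L: "L \<ge> 0" and \<delta>: "\<delta> > 0"
  shows "\<exists>\<phi> x t. delay_solution h A Ad \<phi> x \<and> t \<ge> L \<and> x t \<noteq> 0 \<and>
     (\<forall>s\<in>{t-L..t}. norm (x s) \<le> exp (\<delta> * (t - s)) * norm (x t))"
proof (rule ccontr)
  assume contra: "\<not> ?thesis"
  let ?r = "r_const A Ad"
  define C where "C = exp ((?r + \<delta>) * L)"
  have C1: "C \<ge> 1" unfolding C_def using L \<delta> r_const_nonneg[of A Ad] by simp
  have decay: "norm (x t) * exp (\<delta> * t) \<le> C * seg_norm h \<phi>"
    if \<phi>: "piecewise_continuous (-h) 0 \<phi>" and sol: "delay_solution h A Ad \<phi> x" and t: "t \<ge> 0" for \<phi> x t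
  proof -
    have x: "continuous_on {0..} x" using sol by (simp add: delay_solution_def)
    have seg: "seg_norm h \<phi> \<ge> 0"
      using norm_le_seg_norm[OF \<phi>, of 0] h norm_ge_zero[of "\<phi> 0"] by (simp del: norm_ge_zero)
    have "\<exists>u\<in>{0..t}. \<forall>s\<in>{0..t}. norm (x s) * exp (\<delta> * s) \<le> norm (x u) * exp (\<delta> * u)"
      using t by (intro continuous_attains_sup continuous_intros continuous_on_subset[OF x]) auto
    then obtain u where u: "u \<in> {0..t}" and max: "\<And>s. s \<in> {0..t} \<Longrightarrow> norm (x s) * exp (\<delta> * s) \<le> norm (x u) * exp (\<delta> * u)"
      by blast
    have "norm (x u) * exp (\<delta> * u) \<le> C * seg_norm h \<phi>"
    proof (cases "u < L \<or> x u = 0")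
      case True
      show ?thesis
      proof (cases "x u = 0")
        case False
        then have uL: "u < L" using True by simp
        have "norm (x u) * exp (\<delta> * u) \<le> seg_norm h \<phi> * exp (?r * u) * exp (\<delta> * u)"
          using delay_solution_growth[OF h \<phi> sol, of u] u by (intro mult_right_mono) auto
        also have "\<dots> = seg_norm h \<phi> * exp ((?r + \<delta>) * u)" by (simp add: exp_add distrib_right mult.assoc)
        also have "\<dots> \<le> seg_norm h \<phi> * C"
          unfolding C_def using seg uL \<delta> r_const_nonneg[of A Ad] by (intro mult_left_mono) (auto intro!: mult_left_mono)
        finally show ?thesis by (simp add: mult.commute)
      qed (use seg C1 in simp)
    next
      case False
      have "norm (x s) \<le> exp (\<delta> * (u - s)) * norm (x u)" if "s \<in> {u-L..u}" for s
      proof -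
        have "norm (x s) * exp (\<delta> * s) \<le> norm (x u) * exp (\<delta> * u)" using that u False by (intro max) auto
        then have "norm (x s) * exp (\<delta> * s) * exp (- \<delta> * s) \<le> norm (x u) * exp (\<delta> * u) * exp (- \<delta> * s)"
          by (intro mult_right_mono) auto
        then show ?thesis by (simp add: mult.assoc exp_add[symmetric] algebra_simps)
      qed
      then show ?thesis using contra sol False by (meson not_le)
    qed
    then show ?thesis using max[of t] t by auto
  qed
  \<comment> \<open>A segment at time \<open>t\<close> looks back by up to \<open>h\<close>, which
    costs the extra factor \<open>exp (\<delta> * h)\<close>.\<close>
  have ge1: "C * exp (\<delta> * h) \<ge> 1" using C1 h \<delta> mult_mono[of 1 C 1 "exp (\<delta> * h)"] by simp
  have "\<forall>\<phi> x. piecewise_continuous (-h) 0 \<phi> \<longrightarrow> delay_solution h A Ad \<phi> x \<longrightarrow>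
        (\<forall>t\<ge>0. seg_norm h (\<lambda>\<tau>. x (t + \<tau>)) \<le> C * exp (\<delta> * h) * exp (- \<delta> * t) * seg_norm h \<phi>)"
  proof (intro allI impI)
    fix \<phi> x t assume \<phi>: "piecewise_continuous (-h) 0 \<phi>" and sol: "delay_solution h A Ad \<phi> x" and t: "t \<ge> (0::real)"
    have seg: "seg_norm h \<phi> \<ge> 0"
      using norm_le_seg_norm[OF \<phi>, of 0] h norm_ge_zero[of "\<phi> 0"] by (simp del: norm_ge_zero)
    have bound: "norm (x s) * exp (\<delta> * s) \<le> C * seg_norm h \<phi>" if s: "s \<ge> -h" for s
    proof (cases "s \<ge> 0")
      case False
      then have "norm (x s) \<le> seg_norm h \<phi>"
        using norm_le_seg_norm[OF \<phi>, of s] sol s by (simp add: delay_solution_def)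
      moreover have "exp (\<delta> * s) \<le> 1" using False \<delta> by (simp add: mult_nonneg_nonpos)
      ultimately have "norm (x s) * exp (\<delta> * s) \<le> seg_norm h \<phi> * 1" using seg by (intro mult_mono) auto
      also have "\<dots> \<le> C * seg_norm h \<phi>" using C1 seg mult_right_mono[of 1 C "seg_norm h \<phi>"] by simp
      finally show ?thesis .
    qed (rule decay[OF \<phi> sol])
    show "seg_norm h (\<lambda>\<tau>. x (t + \<tau>)) \<le> C * exp (\<delta> * h) * exp (- \<delta> * t) * seg_norm h \<phi>"
      unfolding seg_norm_def[of h "\<lambda>\<tau>. x (t + \<tau>)"]
    proof (rule cSUP_least)
      fix \<tau> assume \<tau>: "\<tau> \<in> {-h..0}"
      have "norm (x (t + \<tau>)) * exp (\<delta> * (t + \<tau>)) * exp (- \<delta> * (t + \<tau>)) \<le> C * seg_norm h \<phi> * exp (- \<delta> * (t + \<tau>))"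
        using \<tau> t by (intro mult_right_mono bound) auto
      then have "norm (x (t + \<tau>)) \<le> C * seg_norm h \<phi> * exp (- \<delta> * (t + \<tau>))"
        by (simp add: mult.assoc exp_add[symmetric])
      also have "\<dots> \<le> C * seg_norm h \<phi> * exp (\<delta> * h - \<delta> * t)"
        using C1 seg \<tau> \<delta> mult_left_mono[of "- \<tau>" h \<delta>] by (intro mult_left_mono) (auto simp: algebra_simps)
      also have "\<dots> = C * exp (\<delta> * h) * exp (- \<delta> * t) * seg_norm h \<phi>"
        by (simp add: exp_diff exp_minus divide_inverse)
      finally show "norm (x (t + \<tau>)) \<le> C * exp (\<delta> * h) * exp (- \<delta> * t) * seg_norm h \<phi>" .
    qed (use h in auto)
  qed
  then have "exponentially_stable h A Ad"
    unfolding exponentially_stable_def using ge1 \<delta> by blast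
  with unstable show False by contradiction
qed

text \<open>The rate \<open>ln 2 / (L + h)\<close> limits the values over the past of length
  \<open>L + h\<close> to twice the present one. The present value is normalized and time is
  shifted; the extra \<open>h\<close> accommodates the delayed term at \<open>-L\<close>.\<close>

lemma unstable_history:
  assumes h: "h > 0" and unstable: "\<not> exponentially_stable h A Ad" and L: "L \<ge> 0"
  obtains y where "continuous_on {-L-h..0} y" "norm (y 0) = 1" "\<And>s. s \<in> {-L-h..0} \<Longrightarrow> norm (y s) \<le> 2"
    "\<And>a b s. -L \<le> a \<Longrightarrow> b \<le> 0 \<Longrightarrow> s \<in> {a..b} \<Longrightarrow> (y has_vector_derivative A *v y s + Ad *v y (s - h)) (at s within {a..b})"
proof -
  define \<delta> where "\<delta> = ln 2 / (L + h)"
  have \<delta>: "\<delta> > 0" using h L by (simp add: \<delta>_def)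
  obtain \<phi> x t where sol: "delay_solution h A Ad \<phi> x" and t: "t \<ge> L + h" "x t \<noteq> 0"
    and bd: "\<And>s. s \<in> {t-(L+h)..t} \<Longrightarrow> norm (x s) \<le> exp (\<delta> * (t - s)) * norm (x t)"
    using not_exponentially_stable_growth[OF h unstable _ \<delta>, of "L + h"] h L by auto
  have x: "continuous_on {0..} x" using sol by (simp add: delay_solution_def)
  define y where "y s = (1 / norm (x t)) *\<^sub>R x (t + s)" for s
  show thesis
  proof
    show "continuous_on {-L-h..0} y"
      unfolding y_def using t by (intro continuous_intros continuous_on_compose2[OF x]) auto
    show "norm (y 0) = 1" using t by (simp add: y_def)
    show "norm (y s) \<le> 2" if s: "s \<in> {-L-h..0}" for s
    proof -
      have "norm (x (t + s)) \<le> exp (\<delta> * (t - (t + s))) * norm (x t)" using s by (intro bd) auto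
      also have "\<delta> * (t - (t + s)) \<le> \<delta> * (L + h)" using \<delta> s by (intro mult_left_mono) auto
      also have "\<delta> * (L + h) = ln 2" using h L by (simp add: \<delta>_def)
      finally have "norm (x (t + s)) \<le> 2 * norm (x t)" by (simp add: mult_right_mono)
      then show ?thesis using t by (simp add: y_def divide_le_eq)
    qed
    fix a b s assume ab: "-L \<le> a" "b \<le> 0" "s \<in> {a..b}"
    have 1: "((\<lambda>s. t + s) has_vector_derivative 1) (at s within {a..b})"
      unfolding has_real_derivative_iff_has_vector_derivative[symmetric] by (auto intro!: derivative_eq_intros)
    have "(x has_vector_derivative A *v x (t + s) + Ad *v x (t + s - h)) (at (t + s) within {t+a..t+b})"
      using t ab by (intro delay_solution_derivative[OF h sol]) auto
    then have 2: "(x has_vector_derivative A *v x (t + s) + Ad *v x (t + s - h)) (at (t + s) within (\<lambda>s. t + s) ` {a..b})"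
      by (simp add: add.commute)
    have "((\<lambda>s. x (t + s)) has_vector_derivative A *v x (t + s) + Ad *v x (t + s - h)) (at s within {a..b})"
      using vector_diff_chain_within[OF 1 2] by (simp add: o_def)
    from bounded_linear.has_vector_derivative[OF bounded_linear_scaleR_right this, of "1 / norm (x t)"]
    show "(y has_vector_derivative A *v y s + Ad *v y (s - h)) (at s within {a..b})"
      unfolding y_def by (simp add: matrix_vector_mult_scaleR scaleR_right_distrib add_diff_eq)
  qed
qed

text \<open>Existence for a continuous initial function with a jump at time \<open>0\<close>: the integrated
  equation is solved by contraction in the norm weighted with \<open>exp (- K t)\<close>.\<close>

lemma delay_solution_exists:
  fixes p :: "real \<Rightarrow> real ^ 'm" and A Ad :: "real ^ 'm ^ 'm"
  assumes h: "h > 0" and p: "continuous_on UNIV p"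
  shows "\<exists>x. delay_solution h A Ad (\<lambda>\<tau>. if \<tau> < 0 then p \<tau> else x0) x"
proof -
  let ?r = "r_const A Ad"
  define K where "K = ?r + 1"
  have K: "K > 0" "?r < K" unfolding K_def using r_const_nonneg[of A Ad] by simp_all
  \<comment> \<open>The unknown is the weighted solution as a bounded continuous function on all
    reals: \<open>Y\<close> removes the weight, and \<open>c\<close> freezes the argument at 0 for
    negative times. The integral of the delayed state splits into \<open>P\<close>, taken over the
    prescribed history, and an integral of the unknown up to \<open>e t\<close>.\<close>
  define c where "c t = max 0 t" for t :: real
  define e where "e t = max 0 (t - h)" for t :: real
  define Y where "Y u s = exp (K * s) *\<^sub>R apply_bcontfun u s" for u :: "real \<Rightarrow>\<^sub>C (real ^ 'm)" and s
  define P where "P t = integral {0..min t h} (\<lambda>s. p (s - h))" for t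
  define R where "R u t = x0 + A *v integral {0..t} (Y u) + Ad *v (P t + integral {0..e t} (Y u))" for u t
  define T0 where "T0 u t = exp (- K * c t) *\<^sub>R R u (c t)" for u t
  have cY: "continuous_on S (Y u)" for S u
    unfolding Y_def by (intro continuous_intros continuous_on_apply_bcontfun)
  have int_cont: "continuous_on {0..} (\<lambda>t. integral {0..t} f)" if "continuous_on UNIV f" for f :: "real \<Rightarrow> real ^ 'm"
    unfolding continuous_on_eq_continuous_within
  proof
    fix t :: real assume t: "t \<in> {0..}"
    have "f integrable_on {0..t+1}" by (intro integrable_continuous_real continuous_on_subset[OF that]) auto
    then have "continuous_on {0..t+1} (\<lambda>t. integral {0..t} f)" by (rule indefinite_integral_continuous_1)
    then have "continuous (at t within {0..t+1}) (\<lambda>t. integral {0..t} f)"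
      using t by (auto simp: continuous_on_eq_continuous_within)
    moreover have "at t within {0..t+1} = at t within {0..}"
      by (rule at_within_nhd[of t "{..<t+1}"]) (use t in auto)
    ultimately show "continuous (at t within {0..}) (\<lambda>t. integral {0..t} f)" by simp
  qed
  have cP: "continuous_on {0..} P"
  proof -
    have 1: "continuous_on {0..} (\<lambda>t. integral {0..t} (\<lambda>s. p (s - h)))"
      by (intro int_cont continuous_on_compose2[OF p] continuous_intros) auto
    show ?thesis unfolding P_def
      by (rule continuous_on_compose2[OF 1, of "{0..}" "\<lambda>t. min t h"]) (use h in \<open>auto intro!: continuous_intros\<close>)
  qed
  have cR: "continuous_on {0..} (R u)" for u
  proof -
    have 1: "continuous_on {0..} (\<lambda>t. integral {0..t} (Y u))" by (rule int_cont[OF cY])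
    have 2: "continuous_on {0..} (\<lambda>t. integral {0..e t} (Y u))"
      by (rule continuous_on_compose2[OF 1, of "{0..}" e]) (auto intro!: continuous_intros simp: e_def)
    show ?thesis unfolding R_def
      by (intro continuous_intros bounded_linear.continuous_on[OF matrix_vector_mul_bounded_linear] 1 2 cP)
  qed
  have cT0: "continuous_on UNIV (T0 u)" for u
  proof -
    have "continuous_on UNIV (\<lambda>t. R u (c t))"
      by (rule continuous_on_compose2[OF cR]) (auto intro!: continuous_intros simp: c_def)
    then show ?thesis unfolding T0_def c_def by (intro continuous_intros)
  qed
  have expK: "integral {0..t} (\<lambda>s. B * exp (K * s)) \<le> B / K * exp (K * t)" 
     "(\<lambda>s. B * exp (K * s)) integrable_on {0..t}" if "t \<ge> 0" "B \<ge> 0" for t B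
  proof -
    have "((\<lambda>s. B * exp (K * s)) has_integral B / K * exp (K * t) - B / K * exp (K * 0)) {0..t}"
      using exp_has_integral[of 0 t K "B / K"] that K by simp
    then show "integral {0..t} (\<lambda>s. B * exp (K * s)) \<le> B / K * exp (K * t)" "(\<lambda>s. B * exp (K * s)) integrable_on {0..t}"
      using that K by (auto simp: has_integral_iff)
  qed
  have intY: "norm (integral {0..s} g) \<le> B / K * exp (K * t)"
    if g: "continuous_on UNIV g" and bd: "\<And>s. norm (g s) \<le> B * exp (K * s)" and s: "0 \<le> s" "s \<le> t" and B: "B \<ge> 0"
    for g :: "real \<Rightarrow> real ^ 'm" and s t B
  proof -
    have "norm (integral {0..s} g) \<le> integral {0..s} (\<lambda>s. B * exp (K * s))"
      using bd expK(2)[of s B] s B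
      by (intro integral_norm_bound_integral integrable_continuous_real continuous_on_subset[OF g])
        (auto intro!: continuous_intros)
    also have "\<dots> \<le> B / K * exp (K * s)" by (rule expK(1)) (use s B in auto)
    also have "\<dots> \<le> B / K * exp (K * t)" using s B K by (intro mult_left_mono) auto
    finally show ?thesis .
  qed
  have e_le: "0 \<le> e t" "e t \<le> t" if "t \<ge> 0" for t using that h by (auto simp: e_def)
  have diff: "norm (T0 u t - T0 v t) \<le> ?r / K * dist u v" for u v t
  proof -
    define s where "s = c t"
    have s: "s \<ge> 0" by (simp add: s_def c_def)
    define g where "g = (\<lambda>s. Y u s - Y v s)"
    have cg: "continuous_on UNIV g" unfolding g_def by (intro continuous_intros cY)
    have bg: "norm (g s) \<le> dist u v * exp (K * s)" for s
    proof -
      have "norm (g s) = exp (K * s) * dist (apply_bcontfun u s) (apply_bcontfun v s)"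
        by (simp add: g_def Y_def scaleR_diff_right[symmetric] dist_norm)
      also have "\<dots> \<le> exp (K * s) * dist u v" by (intro mult_left_mono dist_bounded) auto
      finally show ?thesis by (simp add: mult.commute)
    qed
    have ig: "integral {0..s} (Y u) - integral {0..s} (Y v) = integral {0..s} g" for s
      unfolding g_def by (intro integral_diff[symmetric] integrable_continuous_real cY)
    have "R u s - R v s = A *v (integral {0..s} (Y u) - integral {0..s} (Y v))
        + Ad *v (integral {0..e s} (Y u) - integral {0..e s} (Y v))"
      by (simp add: R_def matrix_vector_mult_diff_distrib matrix_vector_right_distrib)
    then have "norm (R u s - R v s) \<le> ?r * (dist u v / K * exp (K * s))"
      unfolding ig using norm_rhs_le[OF intY[OF cg bg, of s s] intY[OF cg bg, of "e s" s], of A Ad] s e_le[of s] by simp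
    then have "exp (- K * s) * norm (R u s - R v s) \<le> exp (- K * s) * (?r * (dist u v / K * exp (K * s)))"
      by (intro mult_left_mono) auto
    also have "\<dots> = ?r / K * dist u v * (exp (- K * s) * exp (K * s))" by simp
    also have "exp (- K * s) * exp (K * s) = 1" by (simp add: exp_add[symmetric])
    finally show ?thesis by (simp add: T0_def s_def[symmetric] scaleR_diff_right[symmetric])
  qed
  \<comment> \<open>One bounded image suffices: by \<open>diff\<close> every other
    \<open>T0 u\<close> stays within bounded distance of it.\<close>
  have "bounded (range (T0 0))"
  proof (rule boundedI)
    fix y assume "y \<in> range (T0 0)"
    then obtain t where t: "y = T0 0 t" by auto
    define s where "s = c t"
    have s: "s \<ge> 0" by (simp add: s_def c_def)
    obtain B where B: "\<And>s. s \<in> {0..h} \<Longrightarrow> norm (P s) \<le> B"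
    proof -
      have "compact (P ` {0..h})" by (intro compact_continuous_image continuous_on_subset[OF cP]) auto
      then show thesis using that by (force dest!: compact_imp_bounded simp: bounded_iff)
    qed
    define B' where "B' = (SUP s\<in>{0..h}. norm (P s))"
    have "bdd_above ((\<lambda>s. norm (P s)) ` {0..h})" using B by (intro bdd_aboveI2) auto
    then have PB: "norm (P (min s h)) \<le> B'" unfolding B'_def using s h by (intro cSUP_upper) auto
    have "P s = P (min s h)" by (simp add: P_def)
    moreover have "Y 0 = (\<lambda>_. 0)" by (rule ext) (simp add: Y_def)
    ultimately have "R 0 s = x0 + Ad *v P (min s h)" by (simp add: R_def)
    then have "norm (R 0 s) \<le> norm x0 + spec_norm Ad * B'"
      using norm_triangle_ineq[of x0 "Ad *v P (min s h)"] norm_mult_vec_le[of Ad "P (min s h)"] mult_left_mono[OF PB spec_norm_nonneg[of Ad]]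
      by simp
    moreover have "exp (- K * s) \<le> 1" using s K by simp
    ultimately have "exp (- K * s) * norm (R 0 s) \<le> 1 * (norm x0 + spec_norm Ad * B')" by (intro mult_mono) auto
    then show "norm y \<le> norm x0 + spec_norm Ad * (SUP s\<in>{0..h}. norm (P s))"
      by (simp add: t T0_def s_def[symmetric] B'_def)
  qed
  then obtain B0 where B0: "\<And>t. norm (T0 0 t) \<le> B0" by (auto simp: bounded_iff)
  have T0_in: "T0 u \<in> bcontfun" for u
  proof (rule bcontfun_normI[OF cT0])
    fix t show "norm (T0 u t) \<le> ?r / K * dist u 0 + B0"
      using norm_triangle_sub[of "T0 u t" "T0 0 t"] diff[of u t 0] B0[of t] by simp
  qed
  define T where "T u = Bcontfun (T0 u)" for u
  have T_apply: "apply_bcontfun (T u) = T0 u" for u unfolding T_def by (rule Bcontfun_inverse[OF T0_in])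
  have "\<forall>u v. dist (T u) (T v) \<le> ?r / K * dist u v"
  proof (intro allI dist_bound)
    fix u v x show "dist (apply_bcontfun (T u) x) (apply_bcontfun (T v) x) \<le> ?r / K * dist u v"
      using diff[of u x v] by (simp add: T_apply dist_norm)
  qed
  then obtain u where u: "T u = u"
    using banach_fix_type[of "?r / K" T] K r_const_nonneg[of A Ad] by (auto simp: divide_less_eq)
  define y where "y = R u"
  have Yy: "Y u t = y t" if "t \<ge> 0" for t
  proof -
    have "apply_bcontfun u t = T0 u t" using T_apply[of u] u by simp
    then have "Y u t = (exp (K * t) * exp (- K * t)) *\<^sub>R R u t" using that by (simp add: Y_def T0_def c_def)
    then show ?thesis by (simp add: exp_add[symmetric] y_def)
  qed
  have e0: "e 0 = 0" using h by (simp add: e_def)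
  have y0: "y 0 = x0" using h e0 by (simp add: y_def R_def P_def)
  have dI: "((\<lambda>t. integral {0..t} f) has_vector_derivative f t) (at t within {0..})"
    if f: "continuous_on UNIV f" and t: "t \<ge> 0" for f :: "real \<Rightarrow> real ^ 'm" and t
  proof -
    have "((\<lambda>t. integral {0..t} f) has_vector_derivative f t) (at t within {0..t+1})"
      using t by (intro integral_has_vector_derivative continuous_on_subset[OF f]) auto
    moreover have "at t within {0..t+1} = at t within {0..}"
      by (rule at_within_nhd[of t "{..<t+1}"]) (use t in auto)
    ultimately show ?thesis by simp
  qed
  define x where "x t = (if t < 0 then p t else y t)" for t
  \<comment> \<open>At \<open>t = h\<close> the delayed argument passes the possible jump at 0, so
    this time becomes the exceptional point of the solution.\<close>
  have dy: "(y has_vector_derivative A *v y t + Ad *v x (t - h)) (at t within {0..})" if t: "t \<ge> 0" "t \<noteq> h" for t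
  proof -
    have Pe: "((\<lambda>t. P t + integral {0..e t} (Y u)) has_vector_derivative x (t - h)) (at t within {0..})"
    proof (cases "t < h")
      case True
      have "((\<lambda>t. integral {0..t} (\<lambda>s. p (s - h))) has_vector_derivative p (t - h)) (at t within {0..})"
        by (rule dI) (use t in \<open>auto intro!: continuous_on_compose2[OF p] continuous_intros\<close>)
      then have "((\<lambda>t. P t + integral {0..e t} (Y u)) has_vector_derivative p (t - h)) (at t within {0..})"
        by (rule has_vector_derivative_transform_within[where d = "h - t"])
          (use True t in \<open>auto simp: P_def e_def min_def max_def dist_real_def abs_less_iff\<close>)
      then show ?thesis using True by (simp add: x_def)
    next
      case False
      then have th: "t > h" using t by simp
      have 1: "((\<lambda>t. t - h) has_vector_derivative 1) (at t within {h..})"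
        unfolding has_real_derivative_iff_has_vector_derivative[symmetric] by (auto intro!: derivative_eq_intros)
      have "((\<lambda>t. integral {0..t} (Y u)) has_vector_derivative Y u (t - h)) (at (t - h) within {0..})"
        by (rule dI[OF cY]) (use th in auto)
      then have 2: "((\<lambda>t. integral {0..t} (Y u)) has_vector_derivative Y u (t - h)) (at (t - h) within (\<lambda>t. t - h) ` {h..})"
        by (rule has_vector_derivative_within_subset) auto
      have "((\<lambda>t. integral {0..t - h} (Y u)) has_vector_derivative Y u (t - h)) (at t within {h..})"
        using vector_diff_chain_within[OF 1 2] by (simp add: o_def)
      then have "((\<lambda>t. integral {0..t - h} (Y u)) has_vector_derivative Y u (t - h)) (at t)"
        using th by (subst (asm) at_within_interior) auto
      then have "((\<lambda>t. P h + integral {0..t - h} (Y u)) has_vector_derivative 0 + Y u (t - h)) (at t)"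
        by (intro has_vector_derivative_add has_vector_derivative_const)
      then have "((\<lambda>t. P t + integral {0..e t} (Y u)) has_vector_derivative 0 + Y u (t - h)) (at t)"
        by (rule has_vector_derivative_transform_within[where d = "t - h"])
          (use th in \<open>auto simp: P_def e_def min_def max_def dist_real_def abs_less_iff\<close>)
      then show ?thesis using th Yy[of "t - h"] by (auto simp: x_def intro: has_vector_derivative_at_within)
    qed
    have "(y has_vector_derivative (0 + A *v Y u t) + Ad *v x (t - h)) (at t within {0..})"
      unfolding y_def R_def
      by (intro has_vector_derivative_add has_vector_derivative_const
        bounded_linear.has_vector_derivative[OF matrix_vector_mul_bounded_linear] Pe dI[OF cY] t)
    then show ?thesis using Yy t by simp
  qed
  have "delay_solution h A Ad (\<lambda>\<tau>. if \<tau> < 0 then p \<tau> else x0) x"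
    unfolding delay_solution_def
  proof (intro conjI exI[of _ "{h}"] ballI)
    show "x \<tau> = (if \<tau> < 0 then p \<tau> else x0)" if "\<tau> \<in> {-h..0}" for \<tau>
      using that y0 by (auto simp: x_def)
    show "continuous_on {0..} x"
      by (rule continuous_on_eq[OF cR[of u]]) (simp add: x_def y_def)
    show "(x has_vector_derivative A *v x t + Ad *v x (t - h)) (at t within {0..})" if "t \<in> {0..} - {h}" for t
    proof -
      have "(x has_vector_derivative A *v y t + Ad *v x (t - h)) (at t within {0..})"
        by (rule has_vector_derivative_transform[OF _ _ dy]) (use that in \<open>auto simp: x_def\<close>)
      then show ?thesis using that by (simp add: x_def)
    qed
  qed simp
  then show ?thesis by blast
qed

section \<open>Bounds for the functional\<close>

text \<open>Cauchy-Schwarz in the pointwise form of \<open>2 * e * norm (g \<tau>) \<le> g \<tau>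
  \<bullet> g \<tau> + e\<^sup>2\<close>, integrated.\<close>

lemma integral_norm_le_of_square:
  fixes g :: "real \<Rightarrow> 'a::euclidean_space"
  assumes "a \<le> b" and g: "continuous_on {a..b} g" and e: "e > 0"
    and le: "integral {a..b} (\<lambda>\<tau>. g \<tau> \<bullet> g \<tau>) \<le> (b - a) * e\<^sup>2"
  shows "integral {a..b} (\<lambda>\<tau>. norm (g \<tau>)) \<le> (b - a) * e"
proof -
  have int: "(\<lambda>\<tau>. g \<tau> \<bullet> g \<tau>) integrable_on {a..b}"
    by (intro integrable_continuous_real continuous_intros g)
  have int2: "((\<lambda>\<tau>. 1 / (2 * e) * (g \<tau> \<bullet> g \<tau>) + e / 2) has_integral
     1 / (2 * e) * integral {a..b} (\<lambda>\<tau>. g \<tau> \<bullet> g \<tau>) + (b - a) * (e / 2)) {a..b}"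
    using has_integral_const_real[of "e / 2" a b] assms(1)
    by (intro has_integral_add has_integral_mult_right integrable_integral[OF int]) simp
  have pw: "norm (g \<tau>) \<le> 1 / (2 * e) * (g \<tau> \<bullet> g \<tau>) + e / 2" for \<tau>
  proof -
    have "0 \<le> (norm (g \<tau>) - e)\<^sup>2" by simp
    then show ?thesis using e by (simp add: power2_diff dot_square_norm field_simps power2_eq_square)
  qed
  have "integral {a..b} (\<lambda>\<tau>. norm (g \<tau>)) \<le> 1 / (2 * e) * integral {a..b} (\<lambda>\<tau>. g \<tau> \<bullet> g \<tau>) + (b - a) * (e / 2)"
  proof (rule has_integral_le[OF _ int2])
    show "((\<lambda>\<tau>. norm (g \<tau>)) has_integral integral {a..b} (\<lambda>\<tau>. norm (g \<tau>))) {a..b}"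
      by (intro integrable_integral integrable_continuous_real continuous_intros g)
  qed (rule pw)
  also have "\<dots> \<le> 1 / (2 * e) * ((b - a) * e\<^sup>2) + (b - a) * (e / 2)"
    by (intro add_right_mono mult_left_mono) (use le e in auto)
  also have "\<dots> = (b - a) * e" using e by (simp add: power2_eq_square field_simps)
  finally show ?thesis .
qed

context lyapunov_delay
begin

lemma U_bounded: obtains b where "b \<ge> 0" "\<And>\<tau> (y :: real ^ 'm). \<tau> \<in> {-h..h} \<Longrightarrow> norm (U \<tau> *v y) \<le> b * norm y"
proof -
  obtain K0 where K0: "K0 > 0" "\<And>(X :: real ^ 'm ^ 'm) y. norm (X *v y) \<le> norm X * norm y * K0"
    using bounded_bilinear.pos_bounded[OF bounded_bilinear_matrix_vector] by blast
  have "compact (U ` {-h..h})" by (intro compact_continuous_image continuous_on_U) auto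
  then obtain B where B: "\<And>\<tau>. \<tau> \<in> {-h..h} \<Longrightarrow> norm (U \<tau>) \<le> B"
    by (force dest!: compact_imp_bounded simp: bounded_iff)
  have "B \<ge> 0" using B[of 0] h_pos norm_ge_zero[of "U 0"] by (simp del: norm_ge_zero)
  show thesis
  proof (rule that[of "B * K0"])
    show "B * K0 \<ge> 0" using \<open>B \<ge> 0\<close> K0 by simp
    fix \<tau> and y :: "real ^ 'm" assume "\<tau> \<in> {-h..h}"
    then have "norm (U \<tau>) * norm y * K0 \<le> B * norm y * K0"
      using B K0 by (intro mult_right_mono) auto
    then show "norm (U \<tau> *v y) \<le> B * K0 * norm y" using K0(2)[of "U \<tau>" y] by (simp add: mult_ac)
  qed
qed

text \<open>The value of \<open>K\<close> stays unspecified: it determines how far back a history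
  must reach, but not \<open>n\<close>. For stable systems it shows that the functional tends to
  0.\<close>

lemma lk_bound:
  obtains K where "K > 0" "\<And>x (f :: real \<Rightarrow> real ^ 'm) s. continuous_on {-h..0} f \<Longrightarrow> norm x \<le> s \<Longrightarrow>
    (\<And>\<tau>. \<tau> \<in> {-h..0} \<Longrightarrow> norm (f \<tau>) \<le> s) \<Longrightarrow> \<bar>lk x f\<bar> \<le> K * s\<^sup>2"
proof -
  obtain b where b: "b \<ge> 0" "\<And>\<tau> y. \<tau> \<in> {-h..h} \<Longrightarrow> norm (U \<tau> *v y) \<le> b * norm y"
    using U_bounded by blast
  define a where "a = spec_norm Ad"
  have a: "a \<ge> 0" "\<And>y. norm (Ad *v y) \<le> a * norm y"
    by (simp_all add: a_def spec_norm_nonneg norm_mult_vec_le)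
  show thesis
  proof (rule that[of "b + 2 * (b * a * h) + a * b * a * h * h + h"])
    show "b + 2 * (b * a * h) + a * b * a * h * h + h > 0" using a b h_pos by (intro add_nonneg_pos) auto
    fix x :: "real ^ 'm" and f :: "real \<Rightarrow> real ^ 'm" and s
    assume f: "continuous_on {-h..0} f" and x: "norm x \<le> s" and fs: "\<And>\<tau>. \<tau> \<in> {-h..0} \<Longrightarrow> norm (f \<tau>) \<le> s"
    have s: "s \<ge> 0" using x norm_ge_zero order_trans by blast
    have Adf: "norm (Ad *v f \<tau>) \<le> a * s" if "\<tau> \<in> {-h..0}" for \<tau>
      using a(2)[of "f \<tau>"] mult_left_mono[OF fs[OF that] a(1)] by simp
    have UU: "norm (U \<tau> *v y) \<le> b * c" if "\<tau> \<in> {-h..h}" "norm y \<le> c" for \<tau> y c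
      using b(2)[OF that(1), of y] mult_left_mono[OF that(2) b(1)] by simp
    have in_le: "\<bar>u \<bullet> v\<bar> \<le> c * d" if "norm u \<le> c" "norm v \<le> d" for u v :: "real ^ 'm" and c d
      using Cauchy_Schwarz_ineq2[of u v] mult_mono[OF that] norm_ge_zero[of u] norm_ge_zero[of v] that by (smt (verit) norm_ge_zero)
    have 1: "\<bar>x \<bullet> (U 0 *v x)\<bar> \<le> s * (b * s)"
      using h_pos x by (intro in_le UU) auto
    have 2: "norm (integral {-h..0} (\<lambda>\<tau>. (U (h + \<tau>) *v x) \<bullet> (Ad *v f \<tau>))) \<le> ((b * s) * (a * s)) * (0 - (-h))"
    proof (rule integral_bound)
      show "continuous_on {-h..0} (\<lambda>\<tau>. (U (h + \<tau>) *v x) \<bullet> (Ad *v f \<tau>))"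
        by (intro continuous_intros f)
      show "norm ((U (h + \<tau>) *v x) \<bullet> (Ad *v f \<tau>)) \<le> (b * s) * (a * s)" if "\<tau> \<in> {-h..0}" for \<tau>
        unfolding real_norm_def using that x by (intro in_le UU Adf) auto
    qed (use h_pos in auto)
    have cD: "continuous_on ({-h..0} \<times> cbox (-h) 0) (\<lambda>(\<tau>2, \<tau>1). (Ad *v f \<tau>1) \<bullet> (U (\<tau>1 - \<tau>2) *v (Ad *v f \<tau>2)))"
      unfolding case_prod_unfold by (intro continuous_intros continuous_on_compose2[OF f]) auto
    have 3: "norm (integral {-h..0} (\<lambda>\<tau>2. integral {-h..0} (\<lambda>\<tau>1. (Ad *v f \<tau>1) \<bullet> (U (\<tau>1 - \<tau>2) *v (Ad *v f \<tau>2)))))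
       \<le> ((a * s) * (b * (a * s)) * (0 - (-h))) * (0 - (-h))"
    proof (rule integral_bound)
      show "continuous_on {-h..0} (\<lambda>\<tau>2. integral {-h..0} (\<lambda>\<tau>1. (Ad *v f \<tau>1) \<bullet> (U (\<tau>1 - \<tau>2) *v (Ad *v f \<tau>2))))"
        using integral_continuous_on_param[OF cD] by simp
      fix \<tau>2 assume \<tau>2: "\<tau>2 \<in> {-h..0}"
      show "norm (integral {-h..0} (\<lambda>\<tau>1. (Ad *v f \<tau>1) \<bullet> (U (\<tau>1 - \<tau>2) *v (Ad *v f \<tau>2))))
         \<le> (a * s) * (b * (a * s)) * (0 - (-h))"
      proof (rule integral_bound)
        show "continuous_on {-h..0} (\<lambda>\<tau>1. (Ad *v f \<tau>1) \<bullet> (U (\<tau>1 - \<tau>2) *v (Ad *v f \<tau>2)))"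
          by (intro continuous_intros f)
        show "norm ((Ad *v f \<tau>1) \<bullet> (U (\<tau>1 - \<tau>2) *v (Ad *v f \<tau>2))) \<le> (a * s) * (b * (a * s))" if "\<tau>1 \<in> {-h..0}" for \<tau>1
          unfolding real_norm_def using that \<tau>2 by (intro in_le UU Adf) auto
      qed (use h_pos in auto)
    qed (use h_pos in auto)
    have 4: "norm (integral {-h..0} (\<lambda>\<tau>. f \<tau> \<bullet> f \<tau>)) \<le> (s * s) * (0 - (-h))"
    proof (rule integral_bound)
      show "norm (f \<tau> \<bullet> f \<tau>) \<le> s * s" if "\<tau> \<in> {-h..0}" for \<tau>
        unfolding real_norm_def using that by (intro in_le fs)
    qed (use h_pos f in \<open>auto intro!: continuous_intros\<close>)
    have "\<bar>lk x f\<bar> \<le> s * (b * s) + 2 * (((b * s) * (a * s)) * (0 - (-h)))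
       + ((a * s) * (b * (a * s)) * (0 - (-h))) * (0 - (-h)) + (s * s) * (0 - (-h))"
      using 1 2 3 4 unfolding lk_def real_norm_def by linarith
    also have "\<dots> = (b + 2 * (b * a * h) + a * b * a * h * h + h) * s\<^sup>2"
      by (simp add: power2_eq_square algebra_simps)
    finally show "\<bar>lk x f\<bar> \<le> (b + 2 * (b * a * h) + a * b * a * h * h + h) * s\<^sup>2" .
  qed
qed

section \<open>Estimates of the kernels by the constants\<close>

abbreviation \<kappa>1 where "\<kappa>1 \<equiv> kappa1_const h A Ad"
abbreviation \<kappa>2 where "\<kappa>2 \<equiv> kappa2_const h A Ad"
abbreviation r where "r \<equiv> r_const A Ad"

lemma kappa1: "\<tau> \<in> {0..h} \<Longrightarrow> spec_norm (U \<tau> ** Ad) \<le> \<kappa>1"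
proof -
  assume \<tau>: "\<tau> \<in> {0..h}"
  obtain b where b: "b \<ge> 0" "\<And>\<tau> y. \<tau> \<in> {-h..h} \<Longrightarrow> norm (U \<tau> *v y) \<le> b * norm y"
    using U_bounded by blast
  have "spec_norm (U \<tau> ** Ad) \<le> b * spec_norm Ad" if "\<tau> \<in> {0..h}" for \<tau>
  proof -
    have "spec_norm (U \<tau>) \<le> b" by (rule spec_norm_leI[OF b]) (use that h_pos in auto)
    then show ?thesis using spec_norm_mult[of "U \<tau>" Ad] mult_right_mono[OF _ spec_norm_nonneg[of Ad]] order_trans by blast
  qed
  then show ?thesis unfolding kappa1_const_def using \<tau> by (intro cSUP_upper bdd_aboveI2) auto
qed

lemma kappa1_nonneg: "\<kappa>1 \<ge> 0"
  using kappa1[of 0] h_pos spec_norm_nonneg[of "U 0 ** Ad"] by simp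

lemma spec_norm_kernel_le: "\<tau> \<in> {-h..h} \<Longrightarrow> spec_norm (transpose Ad ** U \<tau> ** Ad) \<le> spec_norm Ad * \<kappa>1"
proof -
  have nonneg: "spec_norm (transpose Ad ** U \<tau> ** Ad) \<le> spec_norm Ad * \<kappa>1" if "\<tau> \<in> {0..h}" for \<tau>
    using spec_norm_mult[of "transpose Ad" "U \<tau> ** Ad"] mult_left_mono[OF kappa1[OF that] spec_norm_nonneg[of Ad]]
    by (simp add: spec_norm_transpose matrix_mul_assoc)
  assume \<tau>: "\<tau> \<in> {-h..h}"
  show ?thesis
  proof (cases "\<tau> \<ge> 0")
    case False
    have "transpose Ad ** U \<tau> ** Ad = transpose (transpose Ad ** U (- \<tau>) ** Ad)"
      using U_minus[of \<tau>] by (simp add: matrix_transpose_mul matrix_mul_assoc)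
    then show ?thesis using nonneg[of "- \<tau>"] \<tau> False by (simp add: spec_norm_transpose)
  qed (use nonneg \<tau> in auto)
qed

lemma kappa2: "\<tau> \<in> {-h..h} \<Longrightarrow> spec_norm (transpose Ad ** U \<tau> ** Ad) \<le> \<kappa>2"
  unfolding kappa2_const_def using spec_norm_kernel_le by (intro cSUP_upper bdd_aboveI2) auto

lemma kappa2_nonneg: "\<kappa>2 \<ge> 0"
  using kappa2[of 0] h_pos spec_norm_nonneg[of "transpose Ad ** U 0 ** Ad"] by simp

text \<open>With this inequality every error term becomes a multiple of \<open>\<kappa>1\<close>,
  and the factor \<open>r\<close> combines with a factor \<open>h\<close> to
  \<open>2 * \<mu>\<close>.\<close>

lemma kappa2_le: "\<kappa>2 \<le> r * \<kappa>1"
proof -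
  have "\<kappa>2 \<le> spec_norm Ad * \<kappa>1"
    unfolding kappa2_const_def using h_pos spec_norm_kernel_le by (intro cSUP_least) auto
  also have "\<dots> \<le> r * \<kappa>1"
    using kappa1_nonneg by (intro mult_right_mono) (simp_all add: r_const_def spec_norm_nonneg)
  finally show ?thesis .
qed

text \<open>The off-diagonal block involves \<open>transpose (U \<tau>) ** Ad\<close>, whereas \<open>\<kappa>1\<close> bounds
  \<open>U \<tau> ** Ad\<close>. The former satisfies a linear differential equation driven by the latter.\<close>

lemma transpose_U_bound:
  assumes \<tau>: "\<tau> \<in> {0..h}"
  shows "spec_norm (transpose (G \<tau>) ** Ad) \<le> \<kappa>1 * exp (r * h)"
proof (rule spec_norm_leI)
  fix v :: "real ^ 'm"
  define z where "z t = transpose (G t) *v (Ad *v v)" for t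
  define F where "F t = transpose A *v z t + transpose Ad *v (G (h - t) *v (Ad *v v))" for t
  have GAd: "norm (G t *v (Ad *v v)) \<le> \<kappa>1 * norm v" if "t \<in> {0..h}" for t
    using norm_mult_vec_le[of "G t ** Ad" v] mult_right_mono[OF kappa1[OF that], of "norm v"] that
    by (simp add: U_nonneg matrix_vector_mul_assoc)
  have z': "(z has_vector_derivative F t) (at t)" for t
  proof -
    have "((\<lambda>t. transpose (G t)) has_vector_derivative transpose A ** transpose (G t) + transpose Ad ** G (h - t)) (at t)"
      using bounded_linear.has_vector_derivative[OF bounded_linear_transpose G_deriv[of t]]
      by (simp add: transpose_add matrix_transpose_mul)
    from bounded_linear.has_vector_derivative[OF bounded_linear_matrix_vector_left this, of "Ad *v v"]
    show ?thesis unfolding z_def F_def by (simp add: matrix_vector_mult_add_rdistrib matrix_vector_mul_assoc[symmetric])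
  qed
  have zb: "norm (z \<tau>) \<le> \<kappa>1 * norm v * exp (r * \<tau>)"
  proof (rule gronwall_exp[where z = z and F = F and S = "{}" and T = h and C = "\<kappa>1 * norm v" and r = r and t = \<tau>])
    show "continuous_on {0..h} z"
      using z' by (meson continuous_at_imp_continuous_on has_vector_derivative_continuous)
    \<comment> \<open>\<open>G 0\<close> is symmetric, so at 0 the two products agree; this ties the
      bound to \<open>\<kappa>1\<close>.\<close>
    show "norm (z 0) \<le> \<kappa>1 * norm v" using GAd[of 0] h_pos by (simp add: z_def G_0_symmetric)
    fix W s assume W: "\<kappa>1 * norm v \<le> W" and le: "\<And>t. t \<in> {0..h} \<Longrightarrow> norm (z t) \<le> W * exp (r * t)" and s: "s \<in> {0..h}"
    have W0: "W \<ge> 0" using W kappa1_nonneg by (meson mult_nonneg_nonneg norm_ge_zero order_trans)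
    have "norm (transpose A *v z s) \<le> spec_norm A * (W * exp (r * s))"
      using norm_mult_vec_le[of "transpose A" "z s"] mult_left_mono[OF le[OF s] spec_norm_nonneg[of A]]
      by (simp add: spec_norm_transpose)
    moreover have "norm (transpose Ad *v (G (h - s) *v (Ad *v v))) \<le> spec_norm Ad * (W * exp (r * s))"
    proof -
      have "norm (G (h - s) *v (Ad *v v)) \<le> W * 1" using GAd[of "h - s"] s W by simp
      also have "\<dots> \<le> W * exp (r * s)" using W0 s r_const_nonneg[of A Ad] by (intro mult_left_mono) auto
      finally have "spec_norm Ad * norm (G (h - s) *v (Ad *v v)) \<le> spec_norm Ad * (W * exp (r * s))"
        by (intro mult_left_mono spec_norm_nonneg)
      then show ?thesis
        using norm_mult_vec_le[of "transpose Ad" "G (h - s) *v (Ad *v v)"] by (simp add: spec_norm_transpose)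
    qed
    ultimately show "norm (F s) \<le> r * W * exp (r * s)"
      using norm_triangle_ineq[of "transpose A *v z s" "transpose Ad *v (G (h - s) *v (Ad *v v))"]
      by (simp add: F_def r_const_def algebra_simps)
  qed (use z' \<tau> h_pos r_const_nonneg in auto)
  also have "\<kappa>1 * norm v * exp (r * \<tau>) \<le> \<kappa>1 * norm v * exp (r * h)"
    using \<tau> kappa1_nonneg r_const_nonneg[of A Ad] by (intro mult_left_mono) (auto intro!: mult_left_mono)
  finally show "norm ((transpose (G \<tau>) ** Ad) *v v) \<le> \<kappa>1 * exp (r * h) * norm v"
    by (simp add: z_def matrix_vector_mul_assoc mult_ac)
qed (use kappa1_nonneg in simp)

text \<open>The derivatives of order \<open>k\<close> of the kernel
  \<open>transpose Ad ** U (h + \<tau>)\<close> in the single integral and of the companion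
  \<open>transpose (G (- \<tau>)) ** Ad\<close>. Together they satisfy a linear equation without
  delay, so that each further derivative costs a factor \<open>r\<close>.\<close>

fun kernel_chain :: "nat \<Rightarrow> real \<Rightarrow> (real ^ 'm ^ 'm) \<times> (real ^ 'm ^ 'm)" where
  "kernel_chain 0 \<tau> = (transpose Ad ** G (h + \<tau>), transpose (G (- \<tau>)) ** Ad)"
| "kernel_chain (Suc k) \<tau> = (fst (kernel_chain k \<tau>) ** A + transpose Ad ** snd (kernel_chain k \<tau>),
     - (transpose A ** snd (kernel_chain k \<tau>)) - fst (kernel_chain k \<tau>) ** Ad)"

lemma kernel_chain_derivative:
  "((\<lambda>\<tau>. fst (kernel_chain k \<tau>)) has_vector_derivative fst (kernel_chain (Suc k) \<tau>)) (at \<tau>)"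
  "((\<lambda>\<tau>. snd (kernel_chain k \<tau>)) has_vector_derivative snd (kernel_chain (Suc k) \<tau>)) (at \<tau>)"
proof (induction k arbitrary: \<tau>)
  case 0
  have p: "((\<lambda>\<tau>. h + \<tau>) has_vector_derivative 1) (at \<tau>)" "(uminus has_vector_derivative -1) (at \<tau>)" for \<tau> :: real
    by (auto intro!: derivative_eq_intros)
  have G1: "((\<lambda>\<tau>. G (h + \<tau>)) has_vector_derivative G (h + \<tau>) ** A + transpose (G (- \<tau>)) ** Ad) (at \<tau>)" for \<tau>
    using vector_diff_chain_at[OF p(1) G_deriv] by (simp add: o_def)
  have G2: "((\<lambda>\<tau>. G (- \<tau>)) has_vector_derivative - (G (- \<tau>) ** A + transpose (G (h + \<tau>)) ** Ad)) (at \<tau>)" for \<tau>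
    using vector_diff_chain_at[OF p(2) G_deriv] by (simp add: o_def)
  case 1
  show ?case using bounded_linear.has_vector_derivative[OF bounded_linear_matrix_mult_right G1, of "transpose Ad"]
    by (simp add: matrix_add_ldistrib matrix_mul_assoc)
  case 2
  show ?case
    using bounded_linear.has_vector_derivative[OF bounded_linear_matrix_mult_left
      bounded_linear.has_vector_derivative[OF bounded_linear_transpose G2], of Ad]
    by (simp add: transpose_minus transpose_add transpose_diff matrix_transpose_mul matrix_mul_assoc
      bounded_bilinear.diff_left[OF bounded_bilinear_matrix_matrix] bounded_bilinear.add_left[OF bounded_bilinear_matrix_matrix]
      bounded_bilinear.minus_left[OF bounded_bilinear_matrix_matrix])
next
  case (Suc k)
  case 1
  show ?case
    unfolding kernel_chain.simps(2) fst_conv snd_conv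
    by (intro has_vector_derivative_add bounded_linear.has_vector_derivative[OF bounded_linear_matrix_mult_left]
      bounded_linear.has_vector_derivative[OF bounded_linear_matrix_mult_right] Suc.IH[unfolded kernel_chain.simps(2) fst_conv snd_conv])
  case 2
  show ?case
    unfolding kernel_chain.simps(2) fst_conv snd_conv
    by (intro has_vector_derivative_diff has_vector_derivative_minus bounded_linear.has_vector_derivative[OF bounded_linear_matrix_mult_left]
      bounded_linear.has_vector_derivative[OF bounded_linear_matrix_mult_right] Suc.IH[unfolded kernel_chain.simps(2) fst_conv snd_conv])
qed

lemma kernel_chain_bound:
  assumes \<tau>: "\<tau> \<in> {-h..0}"
  shows "spec_norm (fst (kernel_chain k \<tau>)) \<le> r ^ k * (\<kappa>1 * exp (r * h)) \<and>
    spec_norm (snd (kernel_chain k \<tau>)) \<le> r ^ k * (\<kappa>1 * exp (r * h))"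
proof (induction k)
  case 0
  have "transpose Ad ** G (h + \<tau>) = transpose (transpose (G (h + \<tau>)) ** Ad)" by (simp add: matrix_transpose_mul)
  then show ?case using transpose_U_bound[of "h + \<tau>"] transpose_U_bound[of "- \<tau>"] \<tau>
    by (simp add: spec_norm_transpose)
next
  case (Suc k)
  let ?S = "fst (kernel_chain k \<tau>)" and ?R = "snd (kernel_chain k \<tau>)" and ?b = "r ^ k * (\<kappa>1 * exp (r * h))"
  have b: "spec_norm ?S \<le> ?b" "spec_norm ?R \<le> ?b" using Suc by auto
  have 1: "spec_norm (?S ** X) \<le> spec_norm X * ?b" for X :: "real ^ 'm ^ 'm"
    using spec_norm_mult[of ?S X] mult_right_mono[OF b(1) spec_norm_nonneg[of X]] by (simp add: mult.commute)
  have 2: "spec_norm (transpose X ** ?R) \<le> spec_norm X * ?b" for X :: "real ^ 'm ^ 'm"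
    using spec_norm_mult[of "transpose X" ?R] mult_left_mono[OF b(2) spec_norm_nonneg[of X]] by (simp add: spec_norm_transpose)
  have rb: "spec_norm A * ?b + spec_norm Ad * ?b = r ^ Suc k * (\<kappa>1 * exp (r * h))"
    by (simp add: r_const_def algebra_simps)
  have "spec_norm (?S ** A + transpose Ad ** ?R) \<le> spec_norm A * ?b + spec_norm Ad * ?b"
    using spec_norm_add[of "?S ** A" "transpose Ad ** ?R"] 1[of A] 2[of Ad] by simp
  moreover have "spec_norm (- (transpose A ** ?R) + - (?S ** Ad)) \<le> spec_norm A * ?b + spec_norm Ad * ?b"
    using spec_norm_add[of "- (transpose A ** ?R)" "- (?S ** Ad)"] 1[of Ad] 2[of A] by (simp add: spec_norm_minus)
  ultimately show ?case unfolding rb by simp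
qed

lemma kernel_approximation:
  assumes n: "n > 0"
  obtains d where "\<And>\<tau>. \<tau> \<in> {-h..0} \<Longrightarrow>
    norm (transpose Ad *v (U (h + \<tau>) *v x) - leg_sum h n d \<tau>) \<le> 2 * (r ^ n * (\<kappa>1 * exp (r * h)) * norm x) * (h / 4) ^ n / fact n"
proof -
  define F where "F k \<tau> = fst (kernel_chain k \<tau>) *v x" for k \<tau>
  have F': "(F k has_vector_derivative F (Suc k) \<tau>) (at \<tau>)" for k \<tau>
    unfolding F_def by (rule bounded_linear.has_vector_derivative[OF bounded_linear_matrix_vector_left kernel_chain_derivative(1)])
  have "\<exists>d. \<forall>\<tau>\<in>{-h..0}. norm (F 0 \<tau> - (\<Sum>i<n. ((\<tau> + h) / h) ^ i *\<^sub>R d i))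
     \<le> 2 * (r ^ n * (\<kappa>1 * exp (r * h)) * norm x) * (h / 4) ^ n / fact n"
  proof (rule polynomial_approximation[OF n h_pos])
    show "(F k has_vector_derivative F (Suc k) \<tau>) (at \<tau> within {-h..0})" for k \<tau>
      by (rule has_vector_derivative_at_within[OF F'])
    show "continuous_on {-h..0} (F n)"
      using F' by (meson continuous_at_imp_continuous_on has_vector_derivative_continuous)
    show "norm (F n \<tau>) \<le> r ^ n * (\<kappa>1 * exp (r * h)) * norm x" if "\<tau> \<in> {-h..0}" for \<tau>
      unfolding F_def using norm_mult_vec_le[of "fst (kernel_chain n \<tau>)" x] kernel_chain_bound[OF that, of n]
        mult_right_mono[of "spec_norm (fst (kernel_chain n \<tau>))" "r ^ n * (\<kappa>1 * exp (r * h))" "norm x"] by auto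
  qed
  then obtain d where d: "\<And>\<tau>. \<tau> \<in> {-h..0} \<Longrightarrow> norm (F 0 \<tau> - (\<Sum>i<n. ((\<tau> + h) / h) ^ i *\<^sub>R d i))
     \<le> 2 * (r ^ n * (\<kappa>1 * exp (r * h)) * norm x) * (h / 4) ^ n / fact n" by blast
  obtain c where c: "\<And>\<tau>. (\<Sum>i<n. ((\<tau> + h) / h) ^ i *\<^sub>R d i) = leg_sum h n c \<tau>"
    using legendre_span[OF h_pos, where n = n and d = d] unfolding leg_sum_def by blast
  show thesis
  proof (rule that[of c])
    fix \<tau> assume \<tau>: "\<tau> \<in> {-h..0}"
    have "F 0 \<tau> = transpose Ad *v (U (h + \<tau>) *v x)"
      using \<tau> by (simp add: F_def U_nonneg matrix_vector_mul_assoc)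
    then show "norm (transpose Ad *v (U (h + \<tau>) *v x) - leg_sum h n c \<tau>)
       \<le> 2 * (r ^ n * (\<kappa>1 * exp (r * h)) * norm x) * (h / 4) ^ n / fact n"
      using d[OF \<tau>] c by simp
  qed
qed

text \<open>In the single integral the projection error \<open>g\<close> is orthogonal to
  polynomials, so only the error \<open>e'\<close> of the kernel meets it, whence
  \<open>e' * e\<close>. The double integral is bilinear, and the bound 2 on \<open>f\<close>
  produces \<open>4 * e + e\<^sup>2\<close>. The squared norm does not increase under
  projection.\<close>

lemma lk_projection:
  assumes f: "continuous_on {-h..0} f" and f2: "\<And>\<tau>. \<tau> \<in> {-h..0} \<Longrightarrow> norm (f \<tau>) \<le> 2"
    and e: "e > 0" and fd: "\<And>\<tau>. \<tau> \<in> {-h..0} \<Longrightarrow> norm (f \<tau> - leg_sum h n d \<tau>) \<le> e"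
    and \<psi>: "\<And>\<tau>. \<tau> \<in> {-h..0} \<Longrightarrow> norm (transpose Ad *v (U (h + \<tau>) *v x) - leg_sum h n d' \<tau>) \<le> e'"
  obtains c where "lk x (leg_sum h n c) \<le> lk x f + h * (2 * e' * e + h * \<kappa>2 * (4 * e + e\<^sup>2))"
proof -
  obtain c where c1: "\<And>d. ((\<lambda>\<tau>. leg_sum h n d \<tau> \<bullet> (f \<tau> - leg_sum h n c \<tau>)) has_integral 0) {-h..0}"
    and c2: "integral {-h..0} (\<lambda>\<tau>. f \<tau> \<bullet> f \<tau>) = integral {-h..0} (\<lambda>\<tau>. leg_sum h n c \<tau> \<bullet> leg_sum h n c \<tau>)
       + integral {-h..0} (\<lambda>\<tau>. (f \<tau> - leg_sum h n c \<tau>) \<bullet> (f \<tau> - leg_sum h n c \<tau>))"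
    and c3: "\<And>d. integral {-h..0} (\<lambda>\<tau>. (f \<tau> - leg_sum h n c \<tau>) \<bullet> (f \<tau> - leg_sum h n c \<tau>))
       \<le> integral {-h..0} (\<lambda>\<tau>. (f \<tau> - leg_sum h n d \<tau>) \<bullet> (f \<tau> - leg_sum h n d \<tau>))"
    using legendre_projection[OF h_pos f, of n] by blast
  define p where "p = leg_sum h n c"
  define g where "g \<tau> = f \<tau> - p \<tau>" for \<tau>
  have p: "continuous_on S p" for S unfolding p_def by (rule continuous_on_leg_sum[OF h_pos])
  have g: "continuous_on {-h..0} g" unfolding g_def by (intro continuous_intros f p)
  note int = integrable_continuous_real
  define If where "If = integral {-h..0} (\<lambda>\<tau>. norm (f \<tau>))"
  define Ig where "Ig = integral {-h..0} (\<lambda>\<tau>. norm (g \<tau>))"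
  have If0: "If \<ge> 0" and Ig0: "Ig \<ge> 0"
    unfolding If_def Ig_def by (auto intro!: integral_nonneg int continuous_intros f g)
  have "norm If \<le> 2 * (0 - (-h))" unfolding If_def
    by (rule integral_bound) (use h_pos f2 f in \<open>auto intro!: continuous_intros\<close>)
  then have If: "If \<le> 2 * h" by simp
  have "norm (integral {-h..0} (\<lambda>\<tau>. (f \<tau> - leg_sum h n d \<tau>) \<bullet> (f \<tau> - leg_sum h n d \<tau>))) \<le> e\<^sup>2 * (0 - (-h))"
  proof (rule integral_bound)
    show "continuous_on {-h..0} (\<lambda>\<tau>. (f \<tau> - leg_sum h n d \<tau>) \<bullet> (f \<tau> - leg_sum h n d \<tau>))"
      by (intro continuous_intros f continuous_on_leg_sum h_pos)
    show "norm ((f \<tau> - leg_sum h n d \<tau>) \<bullet> (f \<tau> - leg_sum h n d \<tau>)) \<le> e\<^sup>2" if "\<tau> \<in> {-h..0}" for \<tau>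
      using power_mono[OF fd[OF that], of 2] by (simp add: dot_square_norm)
  qed (use h_pos in simp)
  then have "integral {-h..0} (\<lambda>\<tau>. g \<tau> \<bullet> g \<tau>) \<le> (0 - (-h)) * e\<^sup>2"
    using c3[of d] unfolding g_def p_def by (simp add: mult.commute)
  \<comment> \<open>In mean square the projection is at least as good as the approximant
    \<open>d\<close>; from here on only the integral of \<open>norm (g \<tau>)\<close> is
    controlled.\<close>
  from integral_norm_le_of_square[OF _ g e this]
  have Ig: "Ig \<le> h * e" using h_pos by (simp add: Ig_def)
  have T2: "- (e' * (h * e)) \<le> integral {-h..0} (\<lambda>\<tau>. (U (h + \<tau>) *v x) \<bullet> (Ad *v f \<tau>))
      - integral {-h..0} (\<lambda>\<tau>. (U (h + \<tau>) *v x) \<bullet> (Ad *v p \<tau>))"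
  proof -
    define q where "q \<tau> = transpose Ad *v (U (h + \<tau>) *v x)" for \<tau>
    have cq: "continuous_on S q" for S unfolding q_def by (intro continuous_intros)
    have e'0: "e' \<ge> 0" using order_trans[OF norm_ge_zero \<psi>[of 0]] h_pos by simp
    have "integral {-h..0} (\<lambda>\<tau>. (U (h + \<tau>) *v x) \<bullet> (Ad *v f \<tau>)) - integral {-h..0} (\<lambda>\<tau>. (U (h + \<tau>) *v x) \<bullet> (Ad *v p \<tau>))
      = integral {-h..0} (\<lambda>\<tau>. (U (h + \<tau>) *v x) \<bullet> (Ad *v f \<tau>) - (U (h + \<tau>) *v x) \<bullet> (Ad *v p \<tau>))"
      by (intro integral_diff[symmetric] int continuous_intros f p)
    also have "\<dots> = integral {-h..0} (\<lambda>\<tau>. (q \<tau> - leg_sum h n d' \<tau>) \<bullet> g \<tau> + leg_sum h n d' \<tau> \<bullet> g \<tau>)"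
      by (rule integral_cong) (simp add: q_def g_def inner_transpose_left inner_diff_left inner_diff_right
        matrix_vector_mult_diff_distrib)
    also have "\<dots> = integral {-h..0} (\<lambda>\<tau>. (q \<tau> - leg_sum h n d' \<tau>) \<bullet> g \<tau>) + integral {-h..0} (\<lambda>\<tau>. leg_sum h n d' \<tau> \<bullet> g \<tau>)"
      by (intro integral_add int continuous_intros cq g continuous_on_leg_sum h_pos)
    also have "integral {-h..0} (\<lambda>\<tau>. leg_sum h n d' \<tau> \<bullet> g \<tau>) = 0"
      unfolding g_def p_def by (rule integral_unique[OF c1])
    finally have eq: "integral {-h..0} (\<lambda>\<tau>. (U (h + \<tau>) *v x) \<bullet> (Ad *v f \<tau>)) - integral {-h..0} (\<lambda>\<tau>. (U (h + \<tau>) *v x) \<bullet> (Ad *v p \<tau>))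
      = integral {-h..0} (\<lambda>\<tau>. (q \<tau> - leg_sum h n d' \<tau>) \<bullet> g \<tau>)" by simp
    have "norm (integral {-h..0} (\<lambda>\<tau>. (q \<tau> - leg_sum h n d' \<tau>) \<bullet> g \<tau>)) \<le> integral {-h..0} (\<lambda>\<tau>. e' * norm (g \<tau>))"
    proof (rule integral_norm_bound_integral)
      show "norm ((q \<tau> - leg_sum h n d' \<tau>) \<bullet> g \<tau>) \<le> e' * norm (g \<tau>)" if "\<tau> \<in> {-h..0}" for \<tau>
        using Cauchy_Schwarz_ineq2[of "q \<tau> - leg_sum h n d' \<tau>" "g \<tau>"] mult_right_mono[OF \<psi>[OF that], of "norm (g \<tau>)"]
        by (simp add: q_def)
    qed (auto intro!: int continuous_intros cq g continuous_on_leg_sum h_pos)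
    also have "\<dots> = e' * Ig" by (simp add: Ig_def)
    also have "\<dots> \<le> e' * (h * e)" using Ig e'0 by (intro mult_left_mono)
    finally show ?thesis unfolding eq real_norm_def by linarith
  qed
  define ker where "ker u t s = (Ad *v u s) \<bullet> (U (s - t) *v (Ad *v u t))" for u :: "real \<Rightarrow> real ^ 'm" and t s
  have ck: "continuous_on ({-h..0} \<times> cbox (-h) 0) (\<lambda>(t, s). ker u t s)" if "continuous_on {-h..0} u" for u
    unfolding ker_def case_prod_unfold by (intro continuous_intros continuous_on_compose2[OF that]) auto
  have ck1: "continuous_on {-h..0} (\<lambda>t. integral {-h..0} (ker u t))" if "continuous_on {-h..0} u" for u
    using integral_continuous_on_param[OF ck[OF that]] by simp
  have ck2: "continuous_on {-h..0} (ker u t)" if "continuous_on {-h..0} u" for u t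
    unfolding ker_def by (intro continuous_intros that)
  have T3: "\<bar>integral {-h..0} (\<lambda>t. integral {-h..0} (ker f t)) - integral {-h..0} (\<lambda>t. integral {-h..0} (ker p t))\<bar>
      \<le> h * (h * \<kappa>2 * (4 * e + e\<^sup>2))"
  proof -
    have bil: "\<bar>(Ad *v u) \<bullet> (U (s - t) *v (Ad *v v))\<bar> \<le> \<kappa>2 * (norm u * norm v)" if "s \<in> {-h..0}" "t \<in> {-h..0}" for u v s t
    proof -
      have "(Ad *v u) \<bullet> (U (s - t) *v (Ad *v v)) = u \<bullet> ((transpose Ad ** U (s - t) ** Ad) *v v)"
        by (simp add: matrix_vector_mul_assoc[symmetric] inner_transpose_right)
      moreover have "\<bar>u \<bullet> ((transpose Ad ** U (s - t) ** Ad) *v v)\<bar> \<le> norm u * (spec_norm (transpose Ad ** U (s - t) ** Ad) * norm v)"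
        using Cauchy_Schwarz_ineq2[of u "(transpose Ad ** U (s - t) ** Ad) *v v"]
          mult_left_mono[OF norm_mult_vec_le[of "transpose Ad ** U (s - t) ** Ad" v], of "norm u"] by simp
      moreover have "norm u * (spec_norm (transpose Ad ** U (s - t) ** Ad) * norm v) \<le> norm u * (\<kappa>2 * norm v)"
        using that by (intro mult_left_mono mult_right_mono kappa2) auto
      ultimately show ?thesis by (simp add: mult_ac)
    qed
    have pt: "\<bar>ker f t s - ker p t s\<bar> \<le> \<kappa>2 * (norm (g s) * norm (f t) + norm (f s) * norm (g t) + norm (g s) * norm (g t))"
      if "s \<in> {-h..0}" "t \<in> {-h..0}" for s t
    proof -
      have pf: "p \<tau> = f \<tau> - g \<tau>" for \<tau> by (simp add: g_def)
      have "ker f t s - ker p t s = (Ad *v g s) \<bullet> (U (s - t) *v (Ad *v f t)) + (Ad *v f s) \<bullet> (U (s - t) *v (Ad *v g t))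
         - (Ad *v g s) \<bullet> (U (s - t) *v (Ad *v g t))"
        unfolding ker_def pf by (simp add: matrix_vector_mult_diff_distrib inner_diff_left inner_diff_right)
      then show ?thesis using bil[OF that, of "g s" "f t"] bil[OF that, of "f s" "g t"] bil[OF that, of "g s" "g t"]
        by (simp add: distrib_left)
    qed
    have inner: "\<bar>integral {-h..0} (ker f t) - integral {-h..0} (ker p t)\<bar> \<le> \<kappa>2 * (Ig * norm (f t) + If * norm (g t) + Ig * norm (g t))"
      if t: "t \<in> {-h..0}" for t
    proof -
      have a: "integral {-h..0} (ker f t) - integral {-h..0} (ker p t) = integral {-h..0} (\<lambda>s. ker f t s - ker p t s)"
        by (intro integral_diff[symmetric] int ck2 f p)
      have b: "norm (integral {-h..0} (\<lambda>s. ker f t s - ker p t s))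
        \<le> integral {-h..0} (\<lambda>s. \<kappa>2 * (norm (g s) * norm (f t) + norm (f s) * norm (g t) + norm (g s) * norm (g t)))"
        by (rule integral_norm_bound_integral) (use pt t in \<open>auto intro!: int continuous_intros ck2 f p g\<close>)
      have c: "integral {-h..0} (\<lambda>s. \<kappa>2 * (norm (g s) * norm (f t) + norm (f s) * norm (g t) + norm (g s) * norm (g t)))
        = \<kappa>2 * (Ig * norm (f t) + If * norm (g t) + Ig * norm (g t))"
        unfolding Ig_def If_def
        by (intro integral_unique has_integral_mult_right has_integral_add has_integral_mult_left integrable_integral int continuous_intros f g)
      show ?thesis using b unfolding a c real_norm_def .
    qed
    have a: "integral {-h..0} (\<lambda>t. integral {-h..0} (ker f t)) - integral {-h..0} (\<lambda>t. integral {-h..0} (ker p t))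
       = integral {-h..0} (\<lambda>t. integral {-h..0} (ker f t) - integral {-h..0} (ker p t))"
      by (intro integral_diff[symmetric] int ck1 f p)
    have b: "norm (integral {-h..0} (\<lambda>t. integral {-h..0} (ker f t) - integral {-h..0} (ker p t)))
       \<le> integral {-h..0} (\<lambda>t. \<kappa>2 * (Ig * norm (f t) + If * norm (g t) + Ig * norm (g t)))"
      by (rule integral_norm_bound_integral) (use inner in \<open>auto intro!: int continuous_intros ck1 f p g\<close>)
    have c: "integral {-h..0} (\<lambda>t. \<kappa>2 * (Ig * norm (f t) + If * norm (g t) + Ig * norm (g t)))
       = \<kappa>2 * (Ig * integral {-h..0} (\<lambda>t. norm (f t)) + If * integral {-h..0} (\<lambda>t. norm (g t)) + Ig * integral {-h..0} (\<lambda>t. norm (g t)))"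
      by (intro integral_unique has_integral_mult_right has_integral_add integrable_integral int continuous_intros f g)
    have "\<bar>integral {-h..0} (\<lambda>t. integral {-h..0} (ker f t)) - integral {-h..0} (\<lambda>t. integral {-h..0} (ker p t))\<bar>
      \<le> \<kappa>2 * (Ig * If + If * Ig + Ig * Ig)"
      using b unfolding a c real_norm_def If_def[symmetric] Ig_def[symmetric] .
    also have "\<dots> \<le> \<kappa>2 * ((h * e) * (2 * h) + (2 * h) * (h * e) + (h * e) * (h * e))"
      using If Ig If0 Ig0 kappa2_nonneg h_pos e by (intro mult_left_mono add_mono mult_mono) auto
    also have "\<dots> = h * (h * \<kappa>2 * (4 * e + e\<^sup>2))" by (simp add: power2_eq_square algebra_simps)
    finally show ?thesis .
  qed
  have T4: "integral {-h..0} (\<lambda>\<tau>. p \<tau> \<bullet> p \<tau>) \<le> integral {-h..0} (\<lambda>\<tau>. f \<tau> \<bullet> f \<tau>)"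
    unfolding c2 p_def[symmetric] g_def[symmetric] by (simp add: integral_nonneg int continuous_intros g)
  have "lk x p \<le> lk x f + h * (2 * e' * e + h * \<kappa>2 * (4 * e + e\<^sup>2))"
    using T2 T3 T4 unfolding lk_def ker_def by (simp add: distrib_left algebra_simps)
  then show thesis unfolding p_def by (rule that)
qed

end

section \<open>Instability\<close>

text \<open>The integrand is the square of a linear lower bound for a function that has norm
  \<open>m\<close> at \<open>c\<close> and Lipschitz constant \<open>r * m\<close> to its
  left.\<close>

lemma cubic_has_integral:
  fixes r m b c :: real
  assumes r: "r > 0" and b: "b \<ge> 0"
  shows "((\<lambda>s. m\<^sup>2 * (1 - r * (c - s))\<^sup>2) has_integral m\<^sup>2 / (3 * r) * (1 - (1 - r * b) ^ 3)) {c - b..c}"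
proof -
  have "((\<lambda>s. m\<^sup>2 * (1 - r * (c - s))\<^sup>2) has_integral
     m\<^sup>2 / (3 * r) * (1 - r * (c - c)) ^ 3 - m\<^sup>2 / (3 * r) * (1 - r * (c - (c - b))) ^ 3) {c - b..c}"
  proof (rule fundamental_theorem_of_calculus)
    fix s
    have "((\<lambda>s. 1 - r * (c - s)) has_real_derivative r) (at s within {c - b..c})"
      by (auto intro!: derivative_eq_intros)
    from DERIV_cmult[OF DERIV_power[OF this, of 3], of "m\<^sup>2 / (3 * r)"]
    show "((\<lambda>s. m\<^sup>2 / (3 * r) * (1 - r * (c - s)) ^ 3) has_vector_derivative m\<^sup>2 * (1 - r * (c - s))\<^sup>2) (at s within {c - b..c})"
      unfolding has_real_derivative_iff_has_vector_derivative[symmetric] using r by (simp add: power2_eq_square mult.assoc)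
  qed (use b in auto)
  moreover have "m\<^sup>2 / (3 * r) * (1 - r * (c - c)) ^ 3 - m\<^sup>2 / (3 * r) * (1 - r * (c - (c - b))) ^ 3
      = m\<^sup>2 / (3 * r) * (1 - (1 - r * b) ^ 3)"
    by (simp add: algebra_simps diff_divide_distrib)
  ultimately show ?thesis by simp
qed

lemma lipschitz_of_derivative_bound:
  fixes y :: "real \<Rightarrow> 'a::euclidean_space"
  assumes "a \<le> b" and "\<And>s. s \<in> {a..b} \<Longrightarrow> (y has_vector_derivative F s) (at s within {a..b})"
    and "\<And>s. s \<in> {a..b} \<Longrightarrow> norm (F s) \<le> B"
  shows "norm (y b - y a) \<le> B * (b - a)"
proof -
  have FI: "(F has_integral y b - y a) {a..b}"
    by (rule fundamental_theorem_of_calculus) (use assms in auto)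
  have "B \<ge> 0" using assms(1) assms(3)[of a] norm_ge_zero[of "F a"] by (simp del: norm_ge_zero)
  have "norm (y b - y a) \<le> B * measure lborel (cbox a b)"
    using has_integral_bound[of B F "y b - y a" a b] FI assms(3) \<open>B \<ge> 0\<close> by simp
  then show ?thesis using assms(1) by simp
qed

section \<open>Histories of unstable systems, cut into windows of length \<open>h\<close>\<close>

context lyapunov_delay
begin

text \<open>The equation holds on \<open>[-L, 0]\<close>; the values reach back by a further
  \<open>h\<close> for the delayed term. Quantifying over subintervals provides one-sided
  derivatives at the ends of each window.\<close>

definition history :: "real \<Rightarrow> (real \<Rightarrow> real ^ 'm) \<Rightarrow> bool" where
  "history L y \<longleftrightarrow> continuous_on {-L-h..0} y \<and> norm (y 0) = 1 \<and> (\<forall>s\<in>{-L-h..0}. norm (y s) \<le> 2) \<and>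
    (\<forall>a b s. -L \<le> a \<longrightarrow> b \<le> 0 \<longrightarrow> s \<in> {a..b} \<longrightarrow>
      (y has_vector_derivative A *v y s + Ad *v y (s - h)) (at s within {a..b}))"

lemma historyD:
  assumes "history L y"
  shows "continuous_on {-L-h..0} y" "norm (y 0) = 1" "\<And>s. s \<in> {-L-h..0} \<Longrightarrow> norm (y s) \<le> 2"
    "\<And>a b s. -L \<le> a \<Longrightarrow> b \<le> 0 \<Longrightarrow> s \<in> {a..b} \<Longrightarrow> (y has_vector_derivative A *v y s + Ad *v y (s - h)) (at s within {a..b})"
  using assms unfolding history_def by blast+

definition window :: "(real \<Rightarrow> real ^ 'm) \<Rightarrow> nat \<Rightarrow> real \<Rightarrow> real ^ 'm" where
  "window y k \<tau> = y (\<tau> - real k * h)"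

lemma window_continuous:
  assumes "history L y" "real k * h \<le> L"
  shows "continuous_on {-h..0} (window y k)"
  unfolding window_def
proof (intro continuous_on_compose2[OF historyD(1)[OF assms(1)]] continuous_intros)
  have "0 \<le> real k * h" using h_pos by simp
  then show "(\<lambda>\<tau>. \<tau> - real k * h) ` {-h..0} \<subseteq> {-L-h..0}" using assms(2) by auto
qed

lemma window_integral:
  fixes u :: "real \<Rightarrow> real"
  shows "integral {-h..0} (\<lambda>\<tau>. u (\<tau> - c)) = integral {-h-c..-c} u"
proof -
  have "integral {-h-c..-c} u = integral {-h-c+c..-c+c} (\<lambda>\<tau>. u (\<tau> - c))"
  proof (cases "u integrable_on {-h-c..-c}")
    case True
    have "((\<lambda>\<tau>. u (1 *\<^sub>R \<tau> + (-c))) has_integral (1 / \<bar>1\<bar> ^ DIM(real)) *\<^sub>R integral (cbox (-h-c) (-c)) u)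
       ((\<lambda>x. (1 / 1) *\<^sub>R x + - ((1 / 1) *\<^sub>R (-c))) ` cbox (-h-c) (-c))"
      by (rule has_integral_affinity) (use True in auto)
    then show ?thesis by (simp add: has_integral_iff)
  next
    case False
    \<comment> \<open>If \<open>u\<close> is not integrable, neither is its shift, and both
      integrals are 0 by convention.\<close>
    have "\<not> (\<lambda>\<tau>. u (\<tau> - c)) integrable_on {-h..0}"
    proof
      assume "(\<lambda>\<tau>. u (\<tau> - c)) integrable_on {-h..0}"
      then have "((\<lambda>\<tau>. u (1 *\<^sub>R (1 *\<^sub>R \<tau> + c) + - c)) has_integral (1 / \<bar>1\<bar> ^ DIM(real)) *\<^sub>R integral (cbox (-h) 0) (\<lambda>\<tau>. u (\<tau> - c)))
       ((\<lambda>x. (1 / 1) *\<^sub>R x + - ((1 / 1) *\<^sub>R c)) ` cbox (-h) 0)"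
        using has_integral_affinity[of "\<lambda>\<tau>. u (\<tau> - c)" "integral {-h..0} (\<lambda>\<tau>. u (\<tau> - c))" "-h" 0 1 c] by auto
      then show False using False by (auto simp: has_integral_iff)
    qed
    then show ?thesis using False by (simp add: not_integrable_integral)
  qed
  then show ?thesis by simp
qed

lemma window_step:
  assumes y: "history L y" and k: "real (Suc k) * h \<le> L"
  shows "lk (y (- real k * h)) (window y k) =
    lk (y (- real (Suc k) * h)) (window y (Suc k)) - integral {-h..0} (\<lambda>\<tau>. window y (Suc k) \<tau> \<bullet> window y (Suc k) \<tau>)"
proof -
  have "lk (window y k 0) (window y k) = lk (window y k (-h)) (window y (Suc k))
     - integral {-h..0} (\<lambda>\<tau>. window y (Suc k) \<tau> \<bullet> window y (Suc k) \<tau>)"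
  proof (rule lk_step)
    show "continuous_on {-h..0} (window y (Suc k))" by (rule window_continuous[OF y k])
    fix t assume t: "t \<in> {-h..0}"
    have k0: "0 \<le> real k * h" using h_pos by simp
    have 1: "((\<lambda>\<tau>. \<tau> - real k * h) has_vector_derivative 1) (at t within {-h..0})"
      unfolding has_real_derivative_iff_has_vector_derivative[symmetric] by (auto intro!: derivative_eq_intros)
    have "(y has_vector_derivative A *v y (t - real k * h) + Ad *v y (t - real k * h - h))
       (at (t - real k * h) within {-h - real k * h..- real k * h})"
      by (rule historyD(4)[OF y]) (use t k k0 in \<open>auto simp: distrib_right\<close>)
    then have 2: "(y has_vector_derivative A *v y (t - real k * h) + Ad *v y (t - real k * h - h))
       (at (t - real k * h) within (\<lambda>\<tau>. \<tau> - real k * h) ` {-h..0})" by simp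
    have "((\<lambda>\<tau>. y (\<tau> - real k * h)) has_vector_derivative A *v y (t - real k * h) + Ad *v y (t - real k * h - h)) (at t within {-h..0})"
      using vector_diff_chain_within[OF 1 2] by (simp add: o_def)
    then show "(window y k has_vector_derivative A *v window y k t + Ad *v window y (Suc k) t) (at t within {-h..0})"
      by (simp add: window_def[abs_def] algebra_simps)
  qed
  moreover have "- h - real k * h = - real (Suc k) * h" by (simp add: algebra_simps)
  ultimately show ?thesis by (simp add: window_def)
qed

lemma window_sum:
  assumes y: "history L y" and k: "real k * h \<le> L"
  shows "lk (y 0) (window y 0) = lk (y (- real k * h)) (window y k) - integral {- h - real k * h..- h} (\<lambda>s. y s \<bullet> y s)"
  using k
proof (induction k)
  case 0
  then show ?case by simp
next
  case (Suc k)
  have kL: "real k * h \<le> L" using Suc.prems h_pos by (simp add: distrib_right)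
  have k0: "0 \<le> real k * h" using h_pos by simp
  have "integral {-h..0} (\<lambda>\<tau>. window y (Suc k) \<tau> \<bullet> window y (Suc k) \<tau>)
    = integral {- h - real (Suc k) * h..- real (Suc k) * h} (\<lambda>s. y s \<bullet> y s)"
    using window_integral[of "\<lambda>s. y s \<bullet> y s" "real (Suc k) * h"] by (simp only: window_def mult_minus_left)
  moreover have "integral {- h - real (Suc k) * h..- h - real k * h} (\<lambda>s. y s \<bullet> y s) + integral {- h - real k * h..- h} (\<lambda>s. y s \<bullet> y s)
     = integral {- h - real (Suc k) * h..- h} (\<lambda>s. y s \<bullet> y s)"
    using h_pos k0 Suc.prems
    by (intro Henstock_Kurzweil_Integration.integral_combine integrable_continuous_real continuous_intros
      continuous_on_subset[OF historyD(1)[OF y]]) (auto simp: distrib_right)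
  moreover have "- h - real k * h = - real (Suc k) * h" by (simp add: algebra_simps)
  ultimately show ?case using Suc.IH[OF kL] window_step[OF y Suc.prems] by simp
qed

lemma history_rhs_bound:
  assumes y: "history L y" and s: "s \<in> {-L..0}"
  shows "norm (A *v y s + Ad *v y (s - h)) \<le> r * 2"
  using s h_pos by (intro norm_rhs_le historyD(3)[OF y]) auto

text \<open>Since the functional is bounded along a history, \<open>norm (y s)\<^sup>2\<close> has a bounded integral, so
  among sufficiently many windows there is one on which the history is uniformly small.\<close>

lemma small_window:
  assumes \<epsilon>: "\<epsilon> > 0" and r: "r > 0"
  obtains N where "\<And>L y. history L y \<Longrightarrow> real N * h + h \<le> L \<Longrightarrow>
    \<exists>k. 1 \<le> k \<and> k \<le> N \<and> (\<forall>\<tau>\<in>{-h..0}. norm (window y k \<tau>) \<le> \<epsilon>)"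
proof -
  obtain K where K: "K > 0" "\<And>x (f :: real \<Rightarrow> real ^ 'm) s. continuous_on {-h..0} f \<Longrightarrow> norm x \<le> s \<Longrightarrow>
    (\<And>\<tau>. \<tau> \<in> {-h..0} \<Longrightarrow> norm (f \<tau>) \<le> s) \<Longrightarrow> \<bar>lk x f\<bar> \<le> K * s\<^sup>2" using lk_bound by blast
  \<comment> \<open>A history has Lipschitz constant \<open>2 * r\<close>, so a value above
    \<epsilon> keeps the norm above \<open>\<epsilon> / 2\<close> over the length
    \<open>len\<close>. Being at most half a window, \<open>len\<close> fits on one side of any
    point of the window.\<close>
  define len where "len = min (h / 2) (\<epsilon> / (4 * r))"
  have len: "len > 0" "len \<le> h / 2" "len * (4 * r) \<le> \<epsilon>"
    using h_pos \<epsilon> r by (auto simp: len_def min_def field_simps)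
  define \<beta> where "\<beta> = (\<epsilon> / 2)\<^sup>2 * len"
  have \<beta>: "\<beta> > 0" using \<epsilon> len by (simp add: \<beta>_def)
  \<comment> \<open>Each window without small values costs the functional at least \<beta>, while
    its values at both ends are bounded by \<open>K * 2\<^sup>2\<close>; hence
    \<open>8 * K\<close>.\<close>
  obtain N where N: "8 * K < real N * \<beta>" using \<beta> ex_less_of_nat_mult by blast
  show thesis
  proof (rule that[of N], rule ccontr)
    fix L y assume y: "history L y" and NL: "real N * h + h \<le> L"
    assume contra: "\<nexists>k. 1 \<le> k \<and> k \<le> N \<and> (\<forall>\<tau>\<in>{-h..0}. norm (window y k \<tau>) \<le> \<epsilon>)"
    have big: "\<beta> \<le> integral {-h..0} (\<lambda>\<tau>. window y k \<tau> \<bullet> window y k \<tau>)" if k: "1 \<le> k" "k \<le> N" for k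
    proof -
      have "real k * h \<le> real N * h" using k h_pos by (intro mult_right_mono) auto
      then have kL': "real k * h + h \<le> L" using NL by linarith
      then have kL: "real k * h \<le> L" using h_pos by simp
      have k1: "h \<le> real k * h" using k h_pos mult_right_mono[of 1 "real k" h] by simp
      have cw: "continuous_on {-h..0} (window y k)" by (rule window_continuous[OF y kL])
      obtain \<tau>0 where \<tau>0: "\<tau>0 \<in> {-h..0}" "norm (window y k \<tau>0) > \<epsilon>" using contra k by (meson not_le)
      have lip: "norm (window y k v - window y k u) \<le> (r * 2) * (v - u)" if uv: "-h \<le> u" "u \<le> v" "v \<le> 0" "-L \<le> u - real k * h" for u v
      proof -
        have "v - real k * h \<le> 0" using uv k1 h_pos by linarith
        then have "norm (y (v - real k * h) - y (u - real k * h)) \<le> (r * 2) * ((v - real k * h) - (u - real k * h))"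
          by (intro lipschitz_of_derivative_bound[where F = "\<lambda>s. A *v y s + Ad *v y (s - h)"])
            (use uv in \<open>auto intro!: historyD(4)[OF y] history_rhs_bound[OF y]\<close>)
        then show ?thesis by (simp add: window_def)
      qed
      obtain a where a: "-h \<le> a" "a + len \<le> 0" "\<And>\<tau>. \<tau> \<in> {a..a+len} \<Longrightarrow> norm (window y k \<tau>) \<ge> \<epsilon> / 2"
      proof (cases "\<tau>0 \<le> - h / 2")
        case True
        have "norm (window y k \<tau>) \<ge> \<epsilon> / 2" if \<tau>: "\<tau> \<in> {\<tau>0..\<tau>0+len}" for \<tau>
        proof -
          have "norm (window y k \<tau> - window y k \<tau>0) \<le> (r * 2) * (\<tau> - \<tau>0)"
            using \<tau> \<tau>0 True len kL' by (intro lip) auto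
          also have "\<dots> \<le> (r * 2) * len" using \<tau> r by (intro mult_left_mono) auto
          also have "(r * 2) * len \<le> \<epsilon> / 2" using len(3) by (simp add: field_simps)
          finally have "norm (window y k \<tau> - window y k \<tau>0) \<le> \<epsilon> / 2" .
          then show ?thesis using \<tau>0(2) norm_triangle_ineq2[of "window y k \<tau>0" "window y k \<tau>"]
            by (simp add: norm_minus_commute)
        qed
        then show thesis using that[of \<tau>0] \<tau>0(1) True len by auto
      next
        case False
        have "norm (window y k \<tau>) \<ge> \<epsilon> / 2" if \<tau>: "\<tau> \<in> {\<tau>0-len..\<tau>0}" for \<tau>
        proof -
          have "norm (window y k \<tau>0 - window y k \<tau>) \<le> (r * 2) * (\<tau>0 - \<tau>)"
            using \<tau> \<tau>0 False len kL' by (intro lip) auto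
          also have "\<dots> \<le> (r * 2) * len" using \<tau> r by (intro mult_left_mono) auto
          also have "(r * 2) * len \<le> \<epsilon> / 2" using len(3) by (simp add: field_simps)
          finally have "norm (window y k \<tau>0 - window y k \<tau>) \<le> \<epsilon> / 2" .
          then show ?thesis using \<tau>0(2) norm_triangle_ineq2[of "window y k \<tau>0" "window y k \<tau>"] by simp
        qed
        then show thesis using that[of "\<tau>0 - len"] \<tau>0(1) False len by auto
      qed
      have "((\<lambda>\<tau>::real. (\<epsilon> / 2)\<^sup>2) has_integral (\<epsilon> / 2)\<^sup>2 * len) {a..a+len}"
        using has_integral_const_real[of "(\<epsilon> / 2)\<^sup>2" a "a + len"] len by (simp add: mult.commute)
      from integral_unique[OF this] have "\<beta> = integral {a..a+len} (\<lambda>\<tau>. (\<epsilon> / 2)\<^sup>2)" by (simp only: \<beta>_def)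
      also have "\<dots> \<le> integral {a..a+len} (\<lambda>\<tau>. window y k \<tau> \<bullet> window y k \<tau>)"
      proof (rule integral_le)
        show "(\<epsilon> / 2)\<^sup>2 \<le> window y k \<tau> \<bullet> window y k \<tau>" if "\<tau> \<in> {a..a+len}" for \<tau>
          using power_mono[OF a(3)[OF that], of 2] \<epsilon> by (simp add: dot_square_norm)
      qed (use a in \<open>auto intro!: integrable_continuous_real continuous_intros continuous_on_subset[OF cw]\<close>)
      also have "\<dots> \<le> integral {-h..0} (\<lambda>\<tau>. window y k \<tau> \<bullet> window y k \<tau>)"
        by (rule integral_subset_le) (use a in \<open>auto intro!: integrable_continuous_real continuous_intros continuous_on_subset[OF cw]\<close>)
      finally show ?thesis .
    qed
    have "lk (y 0) (window y 0) \<le> lk (y (- real n * h)) (window y n) - real n * \<beta>" if "n \<le> N" for n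
      using that
    proof (induction n)
      case (Suc n)
      have "real (Suc n) * h \<le> real N * h" using Suc.prems h_pos by (intro mult_right_mono) auto
      then have "real (Suc n) * h \<le> L" using NL h_pos by linarith
      from window_step[OF y this] big[of "Suc n"] Suc show ?case by (simp add: distrib_right)
    qed simp
    from this[of N] have le: "lk (y 0) (window y 0) \<le> lk (y (- real N * h)) (window y N) - real N * \<beta>" by simp
    have bd: "\<bar>lk (y (- real k * h)) (window y k)\<bar> \<le> K * 2\<^sup>2" if "k \<le> N" for k
    proof -
      have "real k * h \<le> real N * h" using that h_pos by (intro mult_right_mono) auto
      then have kL: "real k * h \<le> L" using NL h_pos by linarith
      have k0: "0 \<le> real k * h" using h_pos by simp
      have w2: "norm (window y k \<tau>) \<le> 2" if "\<tau> \<in> {-h..0}" for \<tau>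
      proof -
        have "\<tau> \<le> 0" "-h \<le> \<tau>" using that by auto
        then have "\<tau> - real k * h \<le> 0" "-L-h \<le> \<tau> - real k * h" using k0 kL by linarith+
        then show ?thesis unfolding window_def by (intro historyD(3)[OF y]) simp
      qed
      have "norm (y (- real k * h)) \<le> 2" using w2[of 0] h_pos by (simp add: window_def)
      then show ?thesis by (intro K(2) window_continuous[OF y kL] w2)
    qed
    show False using le bd[of 0] bd[of N] N by simp
  qed
qed

text \<open>The maximum \<open>m\<close> of \<open>norm (y s)\<close> over the history before \<open>-h\<close> is at least
  \<open>exp (- r h)\<close> by Gronwall's inequality. Starting from the small window, the Lipschitz constant
  \<open>r m\<close> forces the squared norm to have integral about \<open>m\<^sup>2 / (3 r)\<close> before the maximum is reached.\<close>

lemma lk_history_negative: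
  assumes r: "r > 0"
  obtains L where "L \<ge> 0" "\<And>L' y. L' \<ge> L \<Longrightarrow> history L' y \<Longrightarrow> lk (y 0) y \<le> - exp (- 2 * r * h) / (4 * r)"
proof -
  obtain K where K: "K > 0" "\<And>x (f :: real \<Rightarrow> real ^ 'm) s. continuous_on {-h..0} f \<Longrightarrow> norm x \<le> s \<Longrightarrow>
    (\<And>\<tau>. \<tau> \<in> {-h..0} \<Longrightarrow> norm (f \<tau>) \<le> s) \<Longrightarrow> \<bar>lk x f\<bar> \<le> K * s\<^sup>2" using lk_bound by blast
  define m0 where "m0 = exp (- r * h)"
  have m0: "m0 > 0" by (simp add: m0_def)
  \<comment> \<open>Smallness relative to the maximum \<open>m\<close>: the value
    \<open>1 / 2\<close> gives the integral at least \<open>7 * m\<^sup>2 / (24 * r)\<close>, and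
    the root bounds the functional on the small window by \<open>m\<^sup>2 / (24 * r)\<close>. The
    difference is the \<open>m\<^sup>2 / (4 * r)\<close> of the claim.\<close>
  define \<theta> where "\<theta> = min (1 / 2) (sqrt (1 / (24 * r * K)))"
  have \<theta>: "\<theta> > 0" "\<theta> \<le> 1 / 2" using r K by (auto simp: \<theta>_def)
  have "\<theta>\<^sup>2 \<le> (sqrt (1 / (24 * r * K)))\<^sup>2" using \<theta> by (intro power_mono) (auto simp: \<theta>_def)
  then have "\<theta>\<^sup>2 \<le> 1 / (24 * r * K)" using r K by simp
  then have \<theta>K: "K * \<theta>\<^sup>2 \<le> 1 / (24 * r)" using r K by (simp add: field_simps)
  define \<epsilon> where "\<epsilon> = \<theta> * m0"
  have \<epsilon>: "\<epsilon> > 0" using \<theta> m0 by (simp add: \<epsilon>_def)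
  obtain N where N: "\<And>L y. history L y \<Longrightarrow> real N * h + h \<le> L \<Longrightarrow>
    \<exists>k. 1 \<le> k \<and> k \<le> N \<and> (\<forall>\<tau>\<in>{-h..0}. norm (window y k \<tau>) \<le> \<epsilon>)" using small_window[OF \<epsilon> r] by blast
  show thesis
  proof (rule that[of "real N * h + h"])
    show "real N * h + h \<ge> 0" using h_pos by simp
    fix L y assume L: "L \<ge> real N * h + h" and y: "history L y"
    obtain k where k: "1 \<le> k" "k \<le> N" and small: "\<And>\<tau>. \<tau> \<in> {-h..0} \<Longrightarrow> norm (window y k \<tau>) \<le> \<epsilon>"
      using N[OF y L] by blast
    have "real k * h \<le> real N * h" using k h_pos by (intro mult_right_mono) auto
    then have kL: "real k * h \<le> L" using L h_pos by linarith
    define t where "t = - real k * h"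
    have th: "t \<le> - h" using k h_pos mult_right_mono[of 1 "real k" h] by (simp add: t_def)
    have tL: "- L \<le> t" using kL by (simp add: t_def)
    have y_small: "norm (y s) \<le> \<epsilon>" if "s \<in> {t - h..t}" for s
      using small[of "s - t"] that by (simp add: window_def t_def)
    have cy: "continuous_on S y" if "S \<subseteq> {t - h..0}" for S
      by (rule continuous_on_subset[OF historyD(1)[OF y]]) (use that tL in auto)
    have "\<exists>u\<in>{t-h..-h}. \<forall>s\<in>{t-h..-h}. norm (y s) \<le> norm (y u)"
      using th h_pos by (intro continuous_attains_sup continuous_intros cy) auto
    then obtain u where u: "u \<in> {t-h..-h}" and max: "\<And>s. s \<in> {t-h..-h} \<Longrightarrow> norm (y s) \<le> norm (y u)" by blast
    define m where "m = norm (y u)"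
    have m: "m \<ge> m0"
    proof -
      define z where "z s = y (s - h)" for s
      have "norm (z h) \<le> m * exp (r * h)"
      proof (rule gronwall_exp[where z = z and F = "\<lambda>s. A *v y (s - h) + Ad *v y (s - h - h)" and T = h and S = "{}" and C = m and r = r and t = h])
        show "continuous_on {0..h} z" unfolding z_def
          by (intro continuous_on_compose2[OF cy[of "{t-h..0}"]] continuous_intros) (use th h_pos in auto)
        show "norm (z 0) \<le> m" using max[of "-h"] th h_pos by (simp add: z_def m_def)
        show "(z has_vector_derivative A *v y (s - h) + Ad *v y (s - h - h)) (at s)" if s: "s \<in> {0<..<h} - {}" for s
        proof -
          have 1: "((\<lambda>s. s - h) has_vector_derivative 1) (at s within {0..h})"
            unfolding has_real_derivative_iff_has_vector_derivative[symmetric] by (auto intro!: derivative_eq_intros)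
          have 2: "(y has_vector_derivative A *v y (s - h) + Ad *v y (s - h - h)) (at (s - h) within (\<lambda>s. s - h) ` {0..h})"
          proof -
            have img: "(\<lambda>s. s - h) ` {0..h} = {-h..0}" by simp
            show ?thesis unfolding img by (rule historyD(4)[OF y]) (use s th tL in auto)
          qed
          have "(z has_vector_derivative A *v y (s - h) + Ad *v y (s - h - h)) (at s within {0..h})"
            using vector_diff_chain_within[OF 1 2] by (simp add: o_def z_def[abs_def])
          then show ?thesis using s by (subst (asm) at_within_interior) auto
        qed
        fix W s assume W: "m \<le> W" and le: "\<And>t. t \<in> {0..h} \<Longrightarrow> norm (z t) \<le> W * exp (r * t)" and s: "s \<in> {0..h}"
        have m0': "0 \<le> m" by (simp add: m_def)
        have "norm (y (s - h - h)) \<le> m * 1" using max[of "s - h - h"] s th by (simp add: m_def)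
        also have "\<dots> \<le> W * exp (r * s)" using W s r m0' by (intro mult_mono) auto
        finally have "norm (y (s - h - h)) \<le> W * exp (r * s)" .
        from norm_rhs_le[OF le[OF s, unfolded z_def] this, of A Ad]
        show "norm (A *v y (s - h) + Ad *v y (s - h - h)) \<le> r * W * exp (r * s)" by (simp add: mult.assoc)
      qed (use r h_pos in auto)
      then have "1 \<le> m * exp (r * h)" using historyD(2)[OF y] by (simp add: z_def)
      then have "1 * exp (- r * h) \<le> m * exp (r * h) * exp (- r * h)" by (intro mult_right_mono) auto
      then show ?thesis by (simp add: m0_def mult.assoc exp_add[symmetric])
    qed
    have mpos: "m > 0" using m m0 by simp
    have \<epsilon>m: "\<epsilon> \<le> \<theta> * m" using m \<theta> by (simp add: \<epsilon>_def mult_left_mono)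
    have "\<theta> * m \<le> 1 / 2 * m" using \<theta> mpos by (intro mult_right_mono) auto
    then have "\<epsilon> < m" using \<epsilon>m mpos by linarith
    have ut: "u > t"
    proof (rule ccontr)
      assume "\<not> u > t"
      then have "m \<le> \<epsilon>" using y_small[of u] u by (simp add: m_def)
      then show False using \<open>\<epsilon> < m\<close> by simp
    qed
    have lower: "m * (1 - r * (u - s)) \<le> norm (y s)" if s: "s \<in> {t..u}" for s
    proof -
      have "norm (y u - y s) \<le> (r * m) * (u - s)"
      proof (rule lipschitz_of_derivative_bound[where F = "\<lambda>s. A *v y s + Ad *v y (s - h)"])
        show "(y has_vector_derivative A *v y v + Ad *v y (v - h)) (at v within {s..u})" if "v \<in> {s..u}" for v
          using that s u tL h_pos by (intro historyD(4)[OF y]) auto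
        show "norm (A *v y v + Ad *v y (v - h)) \<le> r * m" if "v \<in> {s..u}" for v
          unfolding m_def using that s u h_pos by (intro norm_rhs_le max) auto
      qed (use s in auto)
      then have "m - norm (y s) \<le> r * m * (u - s)"
        using norm_triangle_ineq2[of "y u" "y s"] by (simp add: m_def)
      then show ?thesis by (simp add: algebra_simps)
    qed
    \<comment> \<open>Going left from the maximum, either the linear lower bound reaches 0 before
      \<open>t\<close>, or at \<open>t\<close>, where the history is small, it has already dropped
      to at most \<open>\<theta> * m\<close>.\<close>
    define b where "b = min (1 / r) (u - t)"
    have b: "b \<ge> 0" "b \<le> u - t" "r * b \<le> 1" using r ut by (auto simp: b_def min_def field_simps)
    have tb: "1 - r * b \<le> \<theta>"
    proof (cases "1 / r \<le> u - t")
      case True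
      then have "r * b = 1" using r by (simp add: b_def)
      then show ?thesis using \<theta> by simp
    next
      case False
      then have "b = u - t" by (simp add: b_def)
      then have "m * (1 - r * b) \<le> norm (y t)" using lower[of t] ut by simp
      also have "\<dots> \<le> \<epsilon>" using y_small[of t] h_pos by simp
      also have "\<dots> \<le> m * \<theta>" using \<epsilon>m by (simp add: mult.commute)
      finally show ?thesis using mpos by simp
    qed
    have "(1 - r * b) ^ 3 \<le> (1 / 2) ^ 3" using tb \<theta> b by (intro power_mono) auto
    then have cube: "7 / 8 \<le> 1 - (1 - r * b) ^ 3" by (simp add: power3_eq_cube)
    have "7 * m\<^sup>2 / (24 * r) = m\<^sup>2 / (3 * r) * (7 / 8)" using r by simp
    also have "\<dots> \<le> m\<^sup>2 / (3 * r) * (1 - (1 - r * b) ^ 3)" using cube r by (intro mult_left_mono) auto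
    also have "\<dots> = integral {u - b..u} (\<lambda>s. m\<^sup>2 * (1 - r * (u - s))\<^sup>2)"
      using cubic_has_integral[OF r b(1)] by (simp add: has_integral_iff)
    also have "\<dots> \<le> integral {u - b..u} (\<lambda>s. y s \<bullet> y s)"
    proof (rule integral_le)
      show "m\<^sup>2 * (1 - r * (u - s))\<^sup>2 \<le> y s \<bullet> y s" if s: "s \<in> {u - b..u}" for s
      proof -
        have "r * (u - s) \<le> r * b" using s r by (intro mult_left_mono) auto
        then have "0 \<le> m * (1 - r * (u - s))" using b(3) mpos by simp
        moreover have "m * (1 - r * (u - s)) \<le> norm (y s)" using s b by (intro lower) auto
        ultimately have "(m * (1 - r * (u - s)))\<^sup>2 \<le> (norm (y s))\<^sup>2" by (intro power_mono)
        then show ?thesis by (simp add: power_mult_distrib dot_square_norm)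
      qed
      show "(\<lambda>s. m\<^sup>2 * (1 - r * (u - s))\<^sup>2) integrable_on {u - b..u}"
        by (intro integrable_continuous_real continuous_intros)
      show "(\<lambda>s. y s \<bullet> y s) integrable_on {u - b..u}"
        by (intro integrable_continuous_real continuous_intros cy) (use u b h_pos in auto)
    qed
    also have "\<dots> \<le> integral {t - h..- h} (\<lambda>s. y s \<bullet> y s)"
      using u b h_pos by (intro integral_subset_le integrable_continuous_real continuous_intros cy) auto
    finally have int: "7 * m\<^sup>2 / (24 * r) \<le> integral {t - h..- h} (\<lambda>s. y s \<bullet> y s)" .
    have "\<bar>lk (y t) (window y k)\<bar> \<le> K * \<epsilon>\<^sup>2"
      using small y_small[of t] h_pos by (intro K(2) window_continuous[OF y kL]) auto
    also have "\<dots> \<le> K * (\<theta> * m)\<^sup>2" using \<epsilon>m \<epsilon> K by (intro mult_left_mono power_mono) auto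
    also have "\<dots> = (K * \<theta>\<^sup>2) * m\<^sup>2" by (simp add: power_mult_distrib)
    also have "\<dots> \<le> 1 / (24 * r) * m\<^sup>2" using \<theta>K by (intro mult_right_mono) auto
    finally have "lk (y t) (window y k) \<le> m\<^sup>2 / (24 * r)" by simp
    moreover have "lk (y 0) (window y 0) = lk (y t) (window y k) - integral {t - h..- h} (\<lambda>s. y s \<bullet> y s)"
    proof -
      have "- h - real k * h = t - h" by (simp add: t_def)
      then show ?thesis using window_sum[OF y kL] by (simp only: t_def[symmetric])
    qed
    ultimately have "lk (y 0) (window y 0) \<le> m\<^sup>2 / (24 * r) - 7 * m\<^sup>2 / (24 * r)" using int by linarith
    also have "\<dots> = - (m\<^sup>2 / (4 * r))" using r by (simp add: field_simps)
    also have "\<dots> \<le> - (m0\<^sup>2 / (4 * r))" using m m0 r by (simp add: divide_right_mono power_mono)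
    also have "m0\<^sup>2 = exp (- 2 * r * h)" by (simp add: m0_def power2_eq_square exp_add[symmetric])
    also have "window y 0 = y" by (simp add: window_def[abs_def])
    finally show "lk (y 0) y \<le> - exp (- 2 * r * h) / (4 * r)" by simp
  qed
qed

end

section \<open>Derivatives of histories and the failure of positive definiteness\<close>

context lyapunov_delay
begin

text \<open>The derivative of order \<open>k\<close> of a history, obtained by iterating the
  equation. Each order uses up a length \<open>h\<close> of the past and contributes a factor
  \<open>r\<close> to the bound.\<close>

fun derivative_chain :: "(real \<Rightarrow> real ^ 'm) \<Rightarrow> nat \<Rightarrow> real \<Rightarrow> real ^ 'm" where
  "derivative_chain y 0 s = y s"
| "derivative_chain y (Suc k) s = A *v derivative_chain y k s + Ad *v derivative_chain y k (s - h)"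

lemma derivative_chain_derivative:
  assumes y: "history L y"
  shows "-L + real k * h \<le> a \<Longrightarrow> b \<le> 0 \<Longrightarrow> s \<in> {a..b} \<Longrightarrow>
    (derivative_chain y k has_vector_derivative derivative_chain y (Suc k) s) (at s within {a..b})"
proof (induction k arbitrary: a b s)
  case 0
  then show ?case using historyD(4)[OF y, of a b s] by simp
next
  case (Suc k)
  have a: "-L + real k * h \<le> a - h" using Suc.prems by (simp add: distrib_right)
  have 1: "((\<lambda>s. s - h) has_vector_derivative 1) (at s within {a..b})"
    unfolding has_real_derivative_iff_has_vector_derivative[symmetric] by (auto intro!: derivative_eq_intros)
  have img: "(\<lambda>s. s - h) ` {a..b} = {a-h..b-h}" by simp
  have 2: "(derivative_chain y k has_vector_derivative derivative_chain y (Suc k) (s - h)) (at (s - h) within (\<lambda>s. s - h) ` {a..b})"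
    unfolding img by (rule Suc.IH[OF a]) (use Suc.prems h_pos in auto)
  have 3: "((\<lambda>s. derivative_chain y k (s - h)) has_vector_derivative derivative_chain y (Suc k) (s - h)) (at s within {a..b})"
    using vector_diff_chain_within[OF 1 2] by (simp add: o_def)
  have 4: "(derivative_chain y k has_vector_derivative derivative_chain y (Suc k) s) (at s within {a..b})"
    by (rule Suc.IH) (use Suc.prems a h_pos in auto)
  have "((\<lambda>s. A *v derivative_chain y k s + Ad *v derivative_chain y k (s - h)) has_vector_derivative
     A *v derivative_chain y (Suc k) s + Ad *v derivative_chain y (Suc k) (s - h)) (at s within {a..b})"
    by (intro has_vector_derivative_add bounded_linear.has_vector_derivative[OF matrix_vector_mul_bounded_linear] 3 4)
  then show ?case by simp
qed

lemma derivative_chain_bound: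
  assumes y: "history L y"
  shows "s \<in> {-L - h + real k * h..0} \<Longrightarrow> norm (derivative_chain y k s) \<le> r ^ k * 2"
proof (induction k arbitrary: s)
  case 0
  then show ?case using historyD(3)[OF y, of s] by simp
next
  case (Suc k)
  have "norm (derivative_chain y k s) \<le> r ^ k * 2" "norm (derivative_chain y k (s - h)) \<le> r ^ k * 2"
    using Suc.prems h_pos by (auto intro!: Suc.IH simp: distrib_right)
  from norm_rhs_le[OF this, of A Ad] show ?case by (simp add: mult.assoc)
qed

lemma unstable_not_positive:
  assumes unstable: "\<not> exponentially_stable h A Ad" and r: "r > 0"
  defines "n \<equiv> N_fun h A Ad (E_fun h A Ad (eta0_const h A Ad))"
  shows "\<exists>x c. x \<noteq> 0 \<and> lk x (leg_sum h n c) \<le> 0"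
proof -
  define \<eta> where "\<eta> = eta0_const h A Ad"
  define \<epsilon> where "\<epsilon> = E_fun h A Ad \<eta>"
  define \<mu> where "\<mu> = mu_const h A Ad"
  define \<delta> where "\<delta> = 4 * (\<mu> / 2) ^ n / fact n"
  have \<eta>: "\<eta> > 0" "\<eta> \<le> exp (- 2 * r * h) / (4 * r)" unfolding \<eta>_def using eta0_bounds[OF h_pos r] by auto
  have \<epsilon>: "\<epsilon> > 0" "(\<kappa>2 + 1) * \<epsilon>\<^sup>2 + 2 * (\<kappa>1 + \<kappa>2) * \<epsilon> = \<eta> / h"
    unfolding \<epsilon>_def using E_fun[OF h_pos \<eta>(1) kappa1_nonneg kappa2_nonneg] by auto
  have n: "\<delta> * (exp (2 * \<mu>) * (\<delta> / 2) + 4 * \<mu> + \<mu> * \<delta>) \<le> \<epsilon>" "n \<ge> 4"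
    unfolding \<delta>_def \<mu>_def n_def \<epsilon>_def[symmetric] \<eta>_def[symmetric] using N_fun_sufficient[OF h_pos r \<epsilon>(1)] by auto
  have \<mu>: "\<mu> > 0" "2 * \<mu> = r * h" using h_pos r by (simp_all add: \<mu>_def mu_const_def)
  have \<delta>: "\<delta> > 0" using \<mu> by (simp add: \<delta>_def)
  obtain L0 where L0: "L0 \<ge> 0" "\<And>L y. L \<ge> L0 \<Longrightarrow> history L y \<Longrightarrow> lk (y 0) y \<le> - exp (- 2 * r * h) / (4 * r)"
    using lk_history_negative[OF r] by blast
  \<comment> \<open>The chain up to order \<open>n\<close> must be differentiable on all of
    \<open>[-h, 0]\<close>; the derivative of order \<open>n\<close> uses up \<open>n * h\<close>,
    and the interval itself needs one more \<open>h\<close>.\<close>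
  define L where "L = max L0 (real (Suc n) * h)"
  obtain y where "continuous_on {-L-h..0} y" "norm (y 0) = 1" "\<And>s. s \<in> {-L-h..0} \<Longrightarrow> norm (y s) \<le> 2"
    "\<And>a b s. -L \<le> a \<Longrightarrow> b \<le> 0 \<Longrightarrow> s \<in> {a..b} \<Longrightarrow> (y has_vector_derivative A *v y s + Ad *v y (s - h)) (at s within {a..b})"
    using unstable_history[OF h_pos unstable, of L] L0(1) unfolding L_def by (metis max.coboundedI1)
  then have y: "history L y" unfolding history_def by blast
  define x where "x = y 0"
  have x: "norm x = 1" unfolding x_def by (rule historyD(2)[OF y])
  have lk_y: "lk x y \<le> - \<eta>" using L0(2)[OF _ y] \<eta>(2) by (simp add: L_def x_def)
  have nL: "real k * h \<le> L" if "k \<le> Suc n" for k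
  proof -
    have "real k * h \<le> real (Suc n) * h" using that h_pos by (intro mult_right_mono) auto
    then show ?thesis by (simp add: L_def)
  qed
  have n0: "n > 0" using n by simp
  have chain_der: "(derivative_chain y k has_vector_derivative derivative_chain y (Suc k) \<tau>) (at \<tau> within {-h..0})"
    if "k \<le> n" "\<tau> \<in> {-h..0}" for k \<tau>
    using nL[of "Suc k"] that by (intro derivative_chain_derivative[OF y]) (auto simp: distrib_right)
  have chain_bd: "norm (derivative_chain y n \<tau>) \<le> r ^ n * 2" if "\<tau> \<in> {-h..0}" for \<tau>
    using nL[of n] that by (intro derivative_chain_bound[OF y]) auto
  have chain0: "derivative_chain y 0 = y" by (rule ext) simp
  have cont_n: "continuous_on {-h..0} (derivative_chain y n)"
    using chain_der[OF order_refl] by (rule continuous_on_vector_derivative)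
  have "\<exists>d. \<forall>\<tau>\<in>{-h..0}. norm (derivative_chain y 0 \<tau> - (\<Sum>i<n. ((\<tau> + h) / h) ^ i *\<^sub>R d i))
      \<le> 2 * (r ^ n * 2) * (h / 4) ^ n / fact n"
    by (rule polynomial_approximation[OF n0 h_pos]) (use chain_der chain_bd cont_n in auto)
  then obtain d0 where d0: "\<And>\<tau>. \<tau> \<in> {-h..0} \<Longrightarrow> norm (y \<tau> - (\<Sum>i<n. ((\<tau> + h) / h) ^ i *\<^sub>R d0 i))
      \<le> 2 * (r ^ n * 2) * (h / 4) ^ n / fact n" unfolding chain0 by blast
  obtain d where "\<And>\<tau>. (\<Sum>i<n. ((\<tau> + h) / h) ^ i *\<^sub>R d0 i) = leg_sum h n d \<tau>"
    using legendre_span[OF h_pos, where n = n and d = d0] unfolding leg_sum_def by blast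
  moreover have \<delta>_eq: "r ^ n * (h / 4) ^ n = (\<mu> / 2) ^ n"
    unfolding power_mult_distrib[symmetric] \<mu>_def mu_const_def by (simp add: mult.commute)
  then have "2 * (r ^ n * 2) * (h / 4) ^ n / fact n = \<delta>" by (simp add: \<delta>_def mult_ac)
  ultimately have d: "norm (y \<tau> - leg_sum h n d \<tau>) \<le> \<delta>" if "\<tau> \<in> {-h..0}" for \<tau>
    using d0[OF that] by simp
  obtain d' where "\<And>\<tau>. \<tau> \<in> {-h..0} \<Longrightarrow> norm (transpose Ad *v (U (h + \<tau>) *v x) - leg_sum h n d' \<tau>)
      \<le> 2 * (r ^ n * (\<kappa>1 * exp (r * h)) * norm x) * (h / 4) ^ n / fact n"
    using kernel_approximation[OF n0, of x] by blast
  moreover have "2 * (r ^ n * (\<kappa>1 * exp (r * h)) * norm x) * (h / 4) ^ n / fact n = \<kappa>1 * exp (2 * \<mu>) * (\<delta> / 2)"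
  proof -
    have "2 * (r ^ n * (\<kappa>1 * exp (r * h)) * norm x) * (h / 4) ^ n / fact n
      = \<kappa>1 * exp (2 * \<mu>) * (2 * (r ^ n * (h / 4) ^ n) / fact n)"
      unfolding \<mu>(2) x by (simp add: mult_ac)
    then show ?thesis by (simp add: \<delta>_eq \<delta>_def)
  qed
  ultimately have d': "norm (transpose Ad *v (U (h + \<tau>) *v x) - leg_sum h n d' \<tau>) \<le> \<kappa>1 * exp (2 * \<mu>) * (\<delta> / 2)"
    if "\<tau> \<in> {-h..0}" for \<tau> using that by simp
  have L0': "L \<ge> 0" using L0(1) by (simp add: L_def)
  have cy: "continuous_on {-h..0} y"
    by (rule continuous_on_subset[OF historyD(1)[OF y]]) (use L0' in auto)
  have y2: "norm (y \<tau>) \<le> 2" if "\<tau> \<in> {-h..0}" for \<tau>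
    using that L0' by (intro historyD(3)[OF y]) auto
  obtain c where "lk x (leg_sum h n c) \<le> lk x y + h * (2 * (\<kappa>1 * exp (2 * \<mu>) * (\<delta> / 2)) * \<delta> + h * \<kappa>2 * (4 * \<delta> + \<delta>\<^sup>2))"
    using lk_projection[OF cy y2 \<delta> d d'] by blast
  also have "\<dots> \<le> - \<eta> + \<eta>"
  proof (rule add_mono[OF lk_y])
    \<comment> \<open>The double integral brings one more factor \<open>h\<close> than
      \<open>E_fun\<close> accounts for; passing from \<open>\<kappa>2\<close> to
      \<open>\<kappa>1\<close> turns it into \<open>2 * \<mu>\<close>, which
      \<open>N_fun_sufficient\<close> allows for.\<close>
    have "h * \<kappa>2 \<le> h * (r * \<kappa>1)" using kappa2_le h_pos by (intro mult_left_mono) auto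
    also have "\<dots> = 2 * \<mu> * \<kappa>1" by (simp add: \<mu>(2))
    finally have "h * \<kappa>2 * (4 * \<delta> + \<delta>\<^sup>2) \<le> 2 * \<mu> * \<kappa>1 * (4 * \<delta> + \<delta>\<^sup>2)" using \<delta> by (intro mult_right_mono) auto
    then have "2 * (\<kappa>1 * exp (2 * \<mu>) * (\<delta> / 2)) * \<delta> + h * \<kappa>2 * (4 * \<delta> + \<delta>\<^sup>2)
      \<le> 2 * (\<kappa>1 * exp (2 * \<mu>) * (\<delta> / 2)) * \<delta> + 2 * \<mu> * \<kappa>1 * (4 * \<delta> + \<delta>\<^sup>2)" by simp
    also have "\<dots> = 2 * \<kappa>1 * (\<delta> * (exp (2 * \<mu>) * (\<delta> / 2) + 4 * \<mu> + \<mu> * \<delta>))"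
      by (simp add: power2_eq_square algebra_simps)
    also have "\<dots> \<le> 2 * \<kappa>1 * \<epsilon>" using n(1) kappa1_nonneg by (intro mult_left_mono) auto
    also have "\<dots> \<le> (\<kappa>2 + 1) * \<epsilon>\<^sup>2 + 2 * (\<kappa>1 + \<kappa>2) * \<epsilon>"
      using kappa2_nonneg \<epsilon>(1) by (simp add: distrib_right distrib_left)
    finally have "2 * (\<kappa>1 * exp (2 * \<mu>) * (\<delta> / 2)) * \<delta> + h * \<kappa>2 * (4 * \<delta> + \<delta>\<^sup>2) \<le> \<eta> / h" unfolding \<epsilon>(2) .
    then have "h * (2 * (\<kappa>1 * exp (2 * \<mu>) * (\<delta> / 2)) * \<delta> + h * \<kappa>2 * (4 * \<delta> + \<delta>\<^sup>2)) \<le> h * (\<eta> / h)"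
      using h_pos by (intro mult_left_mono) auto
    then show "h * (2 * (\<kappa>1 * exp (2 * \<mu>) * (\<delta> / 2)) * \<delta> + h * \<kappa>2 * (4 * \<delta> + \<delta>\<^sup>2)) \<le> \<eta>" using h_pos by simp
  qed
  finally have "lk x (leg_sum h n c) \<le> 0" by simp
  moreover have "x \<noteq> 0" using x by auto
  ultimately show ?thesis by blast
qed

section \<open>Stability\<close>

lemma norm_le_seg_norm_continuous:
  assumes "continuous_on {-h..0} f" "\<tau> \<in> {-h..0}"
  shows "norm (f \<tau>) \<le> seg_norm h f"
proof -
  have "compact (f ` {-h..0})" by (intro compact_continuous_image assms) auto
  then obtain B where "\<And>\<tau>. \<tau> \<in> {-h..0} \<Longrightarrow> norm (f \<tau>) \<le> B"
    by (force dest!: compact_imp_bounded simp: bounded_iff)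
  then show ?thesis unfolding seg_norm_def using assms by (intro cSUP_upper bdd_aboveI2) auto
qed

lemma piecewise_continuous_jump:
  fixes f :: "real \<Rightarrow> 'a::real_normed_vector"
  assumes f: "continuous_on UNIV f"
  shows "piecewise_continuous (-h) 0 (\<lambda>\<tau>. if \<tau> < 0 then f \<tau> else x)"
  unfolding piecewise_continuous_def
proof (intro conjI exI[of _ "{0}"] ballI)
  show "continuous_on ({-h..0} - {0}) (\<lambda>\<tau>. if \<tau> < 0 then f \<tau> else x)"
    by (rule continuous_on_eq[OF continuous_on_subset[OF f]]) auto
  have lim: "(f \<longlongrightarrow> f t) (at t within S)" for t S
    using f continuous_on_def tendsto_within_subset by (metis UNIV_I subset_UNIV)
  fix t :: real
  {
    assume t: "t \<in> {-h..<0}"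
    have "\<forall>\<^sub>F \<tau> in at_right t. f \<tau> = (if \<tau> < 0 then f \<tau> else x)"
      using t by (auto simp: eventually_at_right_field intro!: exI[of _ 0])
    from Lim_transform_eventually[OF lim this]
    show "\<exists>l. ((\<lambda>\<tau>. if \<tau> < 0 then f \<tau> else x) \<longlongrightarrow> l) (at_right t)" by blast
  next
    assume t: "t \<in> {-h<..0}"
    have "\<forall>\<^sub>F \<tau> in at_left t. f \<tau> = (if \<tau> < 0 then f \<tau> else x)"
      using t by (auto simp: eventually_at_left_field intro!: exI[of _ "t - 1"])
    from Lim_transform_eventually[OF lim this]
    show "\<exists>l. ((\<lambda>\<tau>. if \<tau> < 0 then f \<tau> else x) \<longlongrightarrow> l) (at_left t)" by blast
  }
qed simp

text \<open>Along the solution the functional is nonincreasing from window to window and tends to 0,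
  so it is nonnegative after two windows; the decrements of these two windows form the lower bound.
  The second one belongs to the solution on \<open>[0, h]\<close>, which starts in
  \<open>x0\<close>, and detects \<open>x0\<close> even if \<open>f\<close> vanishes.\<close>

lemma stable_lk_lower_bound:
  assumes stable: "exponentially_stable h A Ad" and f: "continuous_on UNIV f"
  obtains g where "continuous_on {-h..0} g" "g (-h) = x0"
    "integral {-h..0} (\<lambda>\<tau>. f \<tau> \<bullet> f \<tau>) + integral {-h..0} (\<lambda>\<tau>. g \<tau> \<bullet> g \<tau>) \<le> lk x0 f"
proof -
  \<comment> \<open>The jump at 0 allows the present value to be chosen independently of the
    segment. Stability speaks only about given solutions, so one must be constructed.\<close>
  define \<phi> where "\<phi> \<tau> = (if \<tau> < 0 then f \<tau> else x0)" for \<tau>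
  obtain x where sol: "delay_solution h A Ad \<phi> x"
    unfolding \<phi>_def using delay_solution_exists[OF h_pos f, of A Ad x0] by blast
  have \<phi>: "piecewise_continuous (-h) 0 \<phi>" unfolding \<phi>_def by (rule piecewise_continuous_jump[OF f])
  obtain \<kappa> \<alpha> where \<alpha>: "\<alpha> > 0" and decay: "\<And>t. t \<ge> 0 \<Longrightarrow> seg_norm h (\<lambda>\<tau>. x (t + \<tau>)) \<le> \<kappa> * exp (- \<alpha> * t) * seg_norm h \<phi>"
    using stable \<phi> sol unfolding exponentially_stable_def by blast
  have cx: "continuous_on {0..} x" and x\<phi>: "\<And>\<tau>. \<tau> \<in> {-h..0} \<Longrightarrow> x \<tau> = \<phi> \<tau>"
    using sol by (auto simp: delay_solution_def)
  define W where "W k \<tau> = x (real k * h + \<tau>)" for k \<tau>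
  have kh: "h \<le> real k * h" if "k \<ge> 1" for k using that h_pos mult_right_mono[of 1 "real k" h] by simp
  have cW: "continuous_on {-h..0} (W k)" if "k \<ge> 1" for k
    unfolding W_def by (intro continuous_on_compose2[OF cx] continuous_intros) (use kh[OF that] in auto)
  have shift: "((\<lambda>\<tau>. c + \<tau>) has_vector_derivative 1) (at t within S)" for c t :: real and S
    unfolding has_real_derivative_iff_has_vector_derivative[symmetric] by (auto intro!: derivative_eq_intros)
  have x0: "x 0 = x0" using x\<phi>[of 0] h_pos by (simp add: \<phi>_def)
  \<comment> \<open>The first window is treated separately: its delayed values are those of
    \<open>f\<close>, and \<open>f 0\<close> may differ from \<open>x 0\<close>. The equation driven
    by \<open>f\<close> extends to the closed interval by continuity.\<close>
  have first: "lk (x h) (W 1) = lk x0 f - integral {-h..0} (\<lambda>\<tau>. f \<tau> \<bullet> f \<tau>)"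
  proof -
    obtain S where S: "finite S" "\<And>t. t > 0 \<Longrightarrow> t \<notin> S \<Longrightarrow> (x has_vector_derivative A *v x t + Ad *v x (t - h)) (at t)"
      using delay_solution_interior_derivative[OF sol] by blast
    have fc: "continuous_on {-h..0} f" by (rule continuous_on_subset[OF f]) auto
    have "lk (W 1 0) (W 1) = lk (W 1 (-h)) f - integral {-h..0} (\<lambda>\<tau>. f \<tau> \<bullet> f \<tau>)"
    proof (rule lk_step[OF fc])
      fix t assume t: "t \<in> {-h..0}"
      show "(W 1 has_vector_derivative A *v W 1 t + Ad *v f t) (at t within {-h..0})"
      proof (rule derivative_extends_closed[OF cW _ _ _ t, where S = "(\<lambda>s. s - h) ` S"])
        show "continuous_on {-h..0} (\<lambda>t. A *v W 1 t + Ad *v f t)"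
          by (intro continuous_intros cW fc) simp
        fix s assume s: "s \<in> {-h<..<0} - (\<lambda>s. s - h) ` S"
        have "h + s \<notin> S"
        proof
          assume "h + s \<in> S"
          then have "(h + s) - h \<in> (\<lambda>s. s - h) ` S" by (rule imageI)
          then show False using s by simp
        qed
        then have "(x has_vector_derivative A *v x (h + s) + Ad *v x (h + s - h)) (at (h + s))"
          using s by (intro S(2)) auto
        from vector_diff_chain_at[OF shift[of h s UNIV] this]
        have "((\<lambda>\<tau>. x (h + \<tau>)) has_vector_derivative A *v x (h + s) + Ad *v x s) (at s)" by (simp add: o_def)
        moreover have "x s = f s" using x\<phi>[of s] s by (simp add: \<phi>_def)
        ultimately show "(W 1 has_vector_derivative A *v W 1 s + Ad *v f s) (at s)"
          by (simp add: W_def[abs_def])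
      qed (use S in auto)
    qed
    then show ?thesis by (simp add: W_def x0)
  qed
  define V where "V k = lk (x (real k * h)) (W k)" for k
  have step: "V (Suc k) = V k - integral {-h..0} (\<lambda>\<tau>. W k \<tau> \<bullet> W k \<tau>)" if k: "k \<ge> 1" for k
  proof -
    have "lk (W (Suc k) 0) (W (Suc k)) = lk (W (Suc k) (-h)) (W k) - integral {-h..0} (\<lambda>\<tau>. W k \<tau> \<bullet> W k \<tau>)"
    proof (rule lk_step[OF cW[OF k]])
      fix t assume t: "t \<in> {-h..0}"
      let ?c = "real (Suc k) * h"
      have img: "(\<lambda>\<tau>. ?c + \<tau>) ` {-h..0} = {?c - h..?c}" by simp
      have "(x has_vector_derivative A *v x (?c + t) + Ad *v x (?c + t - h)) (at (?c + t) within (\<lambda>\<tau>. ?c + \<tau>) ` {-h..0})"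
        unfolding img using t kh[OF k] by (intro delay_solution_derivative[OF h_pos sol]) (auto simp: distrib_right)
      from vector_diff_chain_within[OF shift this]
      show "(W (Suc k) has_vector_derivative A *v W (Suc k) t + Ad *v W k t) (at t within {-h..0})"
        by (simp add: W_def[abs_def] o_def algebra_simps)
    qed
    then show ?thesis by (simp add: V_def W_def distrib_right)
  qed
  have nonneg: "0 \<le> integral {-h..0} (\<lambda>\<tau>. W k \<tau> \<bullet> W k \<tau>)" if "k \<ge> 1" for k
    by (intro integral_nonneg integrable_continuous_real continuous_intros cW that) auto
  have mono: "V (k + 2) \<le> V 2" for k
  proof (induction k)
    case (Suc k)
    have "V (Suc (k + 2)) \<le> V (k + 2)" using step[of "k + 2"] nonneg[of "k + 2"] by simp
    with Suc show ?case by simp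
  qed (simp add: numeral_2_eq_2)
  obtain K where K: "K > 0" "\<And>x (f :: real \<Rightarrow> real ^ 'm) s. continuous_on {-h..0} f \<Longrightarrow> norm x \<le> s \<Longrightarrow>
    (\<And>\<tau>. \<tau> \<in> {-h..0} \<Longrightarrow> norm (f \<tau>) \<le> s) \<Longrightarrow> \<bar>lk x f\<bar> \<le> K * s\<^sup>2" using lk_bound by blast
  define s where "s k = \<kappa> * exp (- \<alpha> * h) ^ k * seg_norm h \<phi>" for k
  have Vs: "\<bar>V k\<bar> \<le> K * (s k)\<^sup>2" if k: "k \<ge> 1" for k
  proof -
    have Ws: "norm (W k \<tau>) \<le> s k" if "\<tau> \<in> {-h..0}" for \<tau>
    proof -
      have "norm (W k \<tau>) \<le> seg_norm h (W k)" by (rule norm_le_seg_norm_continuous[OF cW[OF k] that])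
      also have "\<dots> \<le> \<kappa> * exp (- \<alpha> * (real k * h)) * seg_norm h \<phi>"
        using decay[of "real k * h"] h_pos by (simp add: W_def[abs_def])
      also have "exp (- \<alpha> * (real k * h)) = exp (- \<alpha> * h) ^ k" by (simp add: exp_of_nat_mult[symmetric] mult_ac)
      finally show ?thesis by (simp add: s_def)
    qed
    have "norm (x (real k * h)) \<le> s k" using Ws[of 0] h_pos by (simp add: W_def)
    then show ?thesis unfolding V_def by (intro K(2) cW k Ws)
  qed
  have "s \<longlonglongrightarrow> \<kappa> * 0 * seg_norm h \<phi>"
    unfolding s_def using \<alpha> h_pos by (intro tendsto_intros LIMSEQ_realpow_zero) auto
  then have "(\<lambda>k. K * (s k)\<^sup>2) \<longlonglongrightarrow> K * (\<kappa> * 0 * seg_norm h \<phi>)\<^sup>2" by (intro tendsto_intros)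
  then have Klim: "(\<lambda>k. K * (s k)\<^sup>2) \<longlonglongrightarrow> 0" by simp
  have "V \<longlonglongrightarrow> 0"
  proof (rule Lim_null_comparison[OF _ Klim])
    show "\<forall>\<^sub>F k in sequentially. norm (V k) \<le> K * (s k)\<^sup>2"
      using Vs by (auto simp: eventually_sequentially intro!: exI[of _ 1])
  qed
  then have "(\<lambda>k. V (k + 2)) \<longlonglongrightarrow> 0" by (rule LIMSEQ_ignore_initial_segment)
  then have "0 \<le> V 2" using mono by (intro LIMSEQ_le_const2[of _ _ "V 2"]) auto
  then have "integral {-h..0} (\<lambda>\<tau>. W 1 \<tau> \<bullet> W 1 \<tau>) \<le> V 1" using step[of 1] by (simp add: numeral_2_eq_2)
  then have "integral {-h..0} (\<lambda>\<tau>. f \<tau> \<bullet> f \<tau>) + integral {-h..0} (\<lambda>\<tau>. W 1 \<tau> \<bullet> W 1 \<tau>) \<le> lk x0 f"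
    using first by (simp add: V_def)
  moreover have "W 1 (-h) = x0" by (simp add: W_def x0)
  ultimately show thesis using that[of "W 1"] cW[of 1] by simp
qed

text \<open>If \<open>x = 0\<close>, some Legendre coefficient is nonzero and the first integral is
  positive. Otherwise the second one is, as \<open>g\<close> is continuous with
  \<open>g (-h) = x\<close>.\<close>

lemma stable_positive:
  assumes stable: "exponentially_stable h A Ad" and nz: "x \<noteq> 0 \<or> (\<exists>k<n. c k \<noteq> 0)"
  shows "0 < lk x (leg_sum h n c)"
proof -
  let ?f = "leg_sum h n c"
  have cf: "continuous_on S ?f" for S by (rule continuous_on_leg_sum[OF h_pos])
  obtain g where g: "continuous_on {-h..0} g" "g (-h) = x"
    and le: "integral {-h..0} (\<lambda>\<tau>. ?f \<tau> \<bullet> ?f \<tau>) + integral {-h..0} (\<lambda>\<tau>. g \<tau> \<bullet> g \<tau>) \<le> lk x ?f"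
    using stable_lk_lower_bound[OF stable cf] by blast
  have g0: "0 \<le> integral {-h..0} (\<lambda>\<tau>. g \<tau> \<bullet> g \<tau>)"
    by (intro integral_nonneg integrable_continuous_real continuous_intros g) auto
  have f_eq: "integral {-h..0} (\<lambda>\<tau>. ?f \<tau> \<bullet> ?f \<tau>) = (\<Sum>k<n. h / (2 * real k + 1) * (c k \<bullet> c k))"
    using leg_sum_norm_square[OF h_pos, of n c] by (simp add: has_integral_iff)
  have f0: "0 \<le> integral {-h..0} (\<lambda>\<tau>. ?f \<tau> \<bullet> ?f \<tau>)"
    by (intro integral_nonneg integrable_continuous_real continuous_intros cf) auto
  show ?thesis
  proof (cases "x = 0")
    case True
    then obtain k where k: "k < n" "c k \<noteq> 0" using nz by blast
    have "0 < (\<Sum>k<n. h / (2 * real k + 1) * (c k \<bullet> c k))"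
      by (rule sum_pos2[of _ k]) (use k h_pos in auto)
    then show ?thesis using le g0 f_eq by simp
  next
    case False
    have "integral {-h..0} (\<lambda>\<tau>. g \<tau> \<bullet> g \<tau>) \<noteq> 0"
    proof
      assume "integral {-h..0} (\<lambda>\<tau>. g \<tau> \<bullet> g \<tau>) = 0"
      then have "\<forall>\<tau>\<in>{-h..0}. g \<tau> \<bullet> g \<tau> = 0"
        using h_pos by (subst (asm) integral_eq_0_iff) (auto intro!: continuous_intros g)
      then show False using False g(2) h_pos by (auto dest!: bspec[of _ _ "-h"])
    qed
    then show ?thesis using le g0 f0 by simp
  qed
qed

text \<open>If both matrices vanished, \<open>algebraic_property\<close> would read
  \<open>0 = - mat 1\<close>; invertibility of \<open>lyap_N\<close> thus excludes this case, in
  which the constants divide by 0.\<close>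

lemma r_pos: "r > 0"
proof (rule ccontr)
  assume "\<not> r > 0"
  then have "spec_norm A = 0" "spec_norm Ad = 0"
    using spec_norm_nonneg[of A] spec_norm_nonneg[of Ad] by (auto simp: r_const_def)
  then have "A *v x = 0" "Ad *v x = 0" for x
    using norm_mult_vec_le[of A x] norm_mult_vec_le[of Ad x] by simp_all
  then have "A = 0" "Ad = 0" by (auto simp: matrix_eq)
  moreover have "transpose (0 :: real ^ 'm ^ 'm) = 0" by (simp add: transpose_def vec_eq_iff)
  ultimately have "mat 1 = (0 :: real ^ 'm ^ 'm)" using algebraic_property by simp
  then have "mat 1 $ i $ i = (0 :: real)" for i :: 'm by simp
  then show False by (simp add: mat_def)
qed

end

theorem theorem1:
  fixes h :: real and A Ad :: "real ^ 'm ^ 'm"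
  assumes "h > 0"
    and "invertible (lyap_N h A Ad)"
  shows "exponentially_stable h A Ad \<longleftrightarrow>
    positive_definite_on (P_index (N_fun h A Ad (E_fun h A Ad (eta0_const h A Ad)))) (P_mat h A Ad)"
proof -
  interpret lyapunov_delay h A Ad by unfold_locales (rule assms)+
  show ?thesis
    unfolding positive_definite_iff
    using stable_positive unstable_not_positive[OF _ r_pos] by (metis not_le)
qed

end
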